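(* Let $\pi=(\pi_j)_{j\in\mathbb{Z}}$ be a random probability distribution on $\mathbb{Z}$ such that the set $K=\{i\in\mathbb{Z}:\mathbf{P}(\pi_i>0)>0\}$ is finite, $|K|<\infty$, and such that every subvector of $(\pi_i)_{i\in K}$ is exchangeable. Let $\Pi=(\pi_{ij})_{i,j\in\mathbb{Z}}$ be a random matrix such that the vectors $(\pi_{i,i+j})_{j\in\mathbb{Z}}$, $i\in\mathbb{Z}$, are i.i.d. copies of $\pi$. Let $\tau=(\tau_i)_{i\in\mathbb{Z}}$ be a sequence of non-negative i.i.d. random variables with finite mean and finite variance, independent of $\Pi$. Then $$\tau'=\tau\,\Pi\stackrel{D}{=}\tau$$ if and only if the components of $\tau$ are Gamma-distributed, $\tau_j\sim\Gamma(a,\gamma)$ for some $a,\gamma>0$, and $\pi$ is Dirichlet-distributed, $(\pi_i)_{i\in K}\sim\mathrm{Dirichlet}\big((a/|K|)_{i\in K}\big)$ (with the same $a$).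
   Context: A random probability distribution on $\mathbb{Z}$ is a random vector $(\pi_j)_{j\in\mathbb{Z}}$ with $\pi_j\ge0$ and $\sum_j\pi_j=1$. Sequences are row vectors: $(\tau\,\Pi)_j=\sum_{i\in\mathbb{Z}}\tau_i\pi_{ij}$. $\stackrel{D}{=}$ denotes equality in distribution of sequences. $\Gamma(a,\gamma)$ is the Gamma distribution with shape $a$ and rate $\gamma$, with density $\frac{\gamma^a}{\Gamma(a)}x^{a-1}e^{-\gamma x}$, $x>0$. For $\alpha_1,\dots,\alpha_r>0$, $\mathrm{Dirichlet}(\alpha_1,\dots,\alpha_r)$ is the distribution of $(Y_1/Y,\dots,Y_r/Y)$, where $Y_i\sim\Gamma(\alpha_i,1)$ are independent and $Y=Y_1+\dots+Y_r$; for $r\ge2$ it is the distribution on the simplex $\{(x_1,\dots,x_r): x_i\ge0,\ x_1+\dots+x_r=1\}$ with density $\frac{\Gamma(\sum_i\alpha_i)}{\prod_i\Gamma(\alpha_i)}\prod_i x_i^{\alpha_i-1}$.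
   Formalization: The "only if" part is claimed only when |K| ≠ 1, τ is not a.s. zero, and not both τ is a.s. constant and π is deterministic; in these cases τΠ has the law of τ although τ need not be Gamma. The "if" part is proved in all cases. *)

theory Defs
  imports "HOL-Probability.Probability"
begin

definition gamma_density :: "real \<Rightarrow> real \<Rightarrow> real \<Rightarrow> real" where
  "gamma_density a \<gamma> x =
     (if 0 < x then \<gamma> powr a / Gamma a * x powr (a - 1) * exp (- \<gamma> * x) else 0)"

definition gamma_distribution :: "real \<Rightarrow> real \<Rightarrow> real measure" where
  "gamma_distribution a \<gamma> = density lborel (\<lambda>x. ennreal (gamma_density a \<gamma> x))"

text \<open>Vectors indexed by a set \<open>J\<close> are extensional functions on \<open>J\<close>, i.e. elements of the
  space of the product measure over \<open>J\<close>.\<close>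

definition vector_law :: "'a measure \<Rightarrow> int set \<Rightarrow> (int \<Rightarrow> 'a \<Rightarrow> real) \<Rightarrow> (int \<Rightarrow> real) measure" where
  "vector_law M J X = distr M (PiM J (\<lambda>_. borel)) (\<lambda>\<omega>. \<lambda>j\<in>J. X j \<omega>)"

abbreviation sequence_law :: "'a measure \<Rightarrow> (int \<Rightarrow> 'a \<Rightarrow> real) \<Rightarrow> (int \<Rightarrow> real) measure" where
  "sequence_law M X \<equiv> vector_law M UNIV X"

definition dirichlet_distribution :: "int set \<Rightarrow> (int \<Rightarrow> real) \<Rightarrow> (int \<Rightarrow> real) measure" where
  "dirichlet_distribution J \<alpha> =
     vector_law (PiM J (\<lambda>i. gamma_distribution (\<alpha> i) 1)) J (\<lambda>i y. y i / (\<Sum>k\<in>J. y k))"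

definition random_probability_distribution :: "'a measure \<Rightarrow> (int \<Rightarrow> 'a \<Rightarrow> real) \<Rightarrow> bool" where
  "random_probability_distribution N \<pi> \<longleftrightarrow>
     (\<forall>j. \<pi> j \<in> borel_measurable N) \<and>
     (AE \<omega> in N. (\<forall>j. 0 \<le> \<pi> j \<omega>) \<and> ((\<lambda>j. \<pi> j \<omega>) has_sum 1) UNIV)"

definition exchangeable :: "'a measure \<Rightarrow> int set \<Rightarrow> (int \<Rightarrow> 'a \<Rightarrow> real) \<Rightarrow> bool" where
  "exchangeable N J X \<longleftrightarrow>
     (\<forall>\<sigma>. \<sigma> permutes J \<longrightarrow> vector_law N J (\<lambda>i. X (\<sigma> i)) = vector_law N J X)"

text \<open>Independence of two random elements whose values may have different types;
  \<^const>\<open>prob_space.indep_var\<close> requires both to have the same type.\<close>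

definition indep_elements ::
  "'a measure \<Rightarrow> 'b measure \<Rightarrow> ('a \<Rightarrow> 'b) \<Rightarrow> 'c measure \<Rightarrow> ('a \<Rightarrow> 'c) \<Rightarrow> bool" where
  "indep_elements M S X T Y \<longleftrightarrow>
     X \<in> measurable M S \<and> Y \<in> measurable M T \<and>
     prob_space.indep_set M (sets (vimage_algebra (space M) X S)) (sets (vimage_algebra (space M) Y T))"

text \<open>The sum over all rows has almost surely only finitely many nonzero terms in the setting
  considered here; on the exceptional null set \<^const>\<open>infsum\<close> takes some default value.\<close>

definition row_times_matrix ::
  "(int \<Rightarrow> 'a \<Rightarrow> real) \<Rightarrow> (int \<Rightarrow> int \<Rightarrow> 'a \<Rightarrow> real) \<Rightarrow> int \<Rightarrow> 'a \<Rightarrow> real" where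
  "row_times_matrix \<tau> P j \<omega> = (\<Sum>\<^sub>\<infinity>i\<in>UNIV. \<tau> i \<omega> * P i j \<omega>)"

definition gamma_dirichlet ::
  "'a measure \<Rightarrow> (int \<Rightarrow> 'a \<Rightarrow> real) \<Rightarrow> 'b measure \<Rightarrow> (int \<Rightarrow> 'b \<Rightarrow> real) \<Rightarrow> int set \<Rightarrow> bool" where
  "gamma_dirichlet M \<tau> N \<pi> K \<longleftrightarrow>
     (\<exists>a>0. \<exists>\<gamma>>0. (\<forall>j. distr M borel (\<tau> j) = gamma_distribution a \<gamma>) \<and>
        vector_law N K \<pi> = dirichlet_distribution K (\<lambda>_. a / real (card K)))"

text \<open>The trivial solutions of \<open>\<tau> P = \<tau>\<close> (in law), which need not be Gamma-Dirichlet: a single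
  point in \<open>K\<close> (the matrix is a shift), \<open>\<tau>\<close> equal to zero, and \<open>\<tau>\<close> constant with \<open>\<pi>\<close> deterministic
  (hence uniform on \<open>K\<close> by exchangeability).\<close>

definition degenerate ::
  "'a measure \<Rightarrow> (int \<Rightarrow> 'a \<Rightarrow> real) \<Rightarrow> 'b measure \<Rightarrow> (int \<Rightarrow> 'b \<Rightarrow> real) \<Rightarrow> int set \<Rightarrow> bool" where
  "degenerate M \<tau> N \<pi> K \<longleftrightarrow>
     card K = 1 \<or>
     (\<exists>c. (AE \<omega> in M. \<tau> 0 \<omega> = c) \<and> (c = 0 \<or> (\<forall>i\<in>K. \<exists>p. AE \<omega> in N. \<pi> i \<omega> = p)))"

end

theory Submission imports Defs begin

text \<open>Row \<open>i\<close> of the matrix splits the size \<open>\<tau>\<^sub>i\<close> into the shares \<open>\<tau>\<^sub>i \<pi>\<^sub>i\<^sub>,\<^sub>i\<^sub>+\<^sub>m\<close>, \<open>m \<in> K\<close>, and \<open>\<tau>'\<^sub>j\<close> collects one share from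
  each of \<open>|K|\<close> different rows. If the sizes are Gamma and the proportions Dirichlet with matching
  parameters, all shares are independent Gamma variables of shape \<open>a / |K|\<close>, so regrouping them by columns
  instead of rows yields again independent Gamma variables of shape \<open>a\<close>. The only analytic input is the
  independence of the sum and the proportions of independent Gamma variables
  (\<open>gamma_mixture_over_dirichlet\<close>).

  For the converse, let \<open>L\<close> be the joint Laplace transform of the shares of one row and \<open>\<phi>\<close> that of a size.
  Testing the equality of laws against finitely supported \<open>t \<ge> 0\<close> gives (\<open>same_law_iff_windows\<close>)
  the window equation \<open>(\<Prod>i. L (\<lambda>m. t (i + m))) = (\<Prod>j. \<phi> (t j))\<close>.
  Exchangeability makes \<open>L\<close> symmetric. For a test sequence supported in \<open>K\<close>, a window either sees the
  whole support, and then its factor is \<open>L(t)\<close> irrespective of its position, or it sees fewer points.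
  Induction on the number of points shows that \<open>L\<close> is a product of one-dimensional transforms
  (\<open>window_equation_factorizes\<close>). Hence the shares of one row are independent of each other.

  Now the size is a sum of independent shares and is independent of the proportions, which is the setting
  of Lukacs' theorem. Writing the second moments of the shares, tilted by \<open>exp (- u \<tau>)\<close>, in both ways
  (\<open>moment_identity\<close>) gives a differential equation for the transform \<open>h\<close> of a share which outside the
  trivial cases has only Gamma transforms as solutions (\<open>marginal_laplace_is_gamma\<close>, \<open>gamma_laplace_of_ode\<close>). Finite variance makes this
  equation valid on the closed half-line, so that it can be integrated from the values at \<open>u = 0\<close>.

  Laws are recovered from Laplace transforms by \<open>laplace_determines_law\<close>. Working with Laplace rather than
  Fourier transforms avoids logarithms of complex functions with possible zeros: all transforms are positive on the half-line, and
  positive numbers with equal powers are equal.\<close>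

section \<open>Uniqueness of Laplace transforms\<close>

text \<open>The Taylor polynomials of the exponential approximate the characteristic function of a law on
  \<open>[-1, 1]\<close>, with an error that tends to zero and depends on the moments only through a bound, so the
  moments determine the characteristic function and Levy's uniqueness theorem applies.\<close>

lemma bounded_moments_determine_distribution:
  fixes \<mu> \<nu> :: "real measure"
  assumes mu: "real_distribution \<mu>" and nu: "real_distribution \<nu>"
    and bmu: "AE x in \<mu>. \<bar>x\<bar> \<le> 1" and bnu: "AE x in \<nu>. \<bar>x\<bar> \<le> 1"
    and moments: "\<And>n::nat. (\<integral>x. x ^ n \<partial>\<mu>) = (\<integral>x. x ^ n \<partial>\<nu>)"
  shows "\<mu> = \<nu>"
proof (rule Levy_uniqueness[OF mu nu])
  have approx: "cmod (char M t - (\<Sum>k\<le>n. ((\<i> * t) ^ k / fact k) * complex_of_real (\<integral>x. x ^ k \<partial>M)))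
      \<le> 2 * \<bar>t\<bar> ^ n / fact n"
    if "real_distribution M" and b: "AE x in M. \<bar>x\<bar> \<le> 1" for M :: "real measure" and t n
  proof -
    interpret real_distribution M by fact
    have pw: "AE x in M. \<bar>x ^ k\<bar> \<le> 1" for k
      using b by eventually_elim (simp add: power_abs power_le_one)
    have int: "integrable M (\<lambda>x. x ^ k)" for k
      by (rule integrable_const_bound[of _ 1]) (use pw in auto)
    have "expectation (\<lambda>x. \<bar>x\<bar> ^ n) \<le> expectation (\<lambda>x. 1)"
      by (rule integral_mono_AE) (use int[THEN integrable_abs, of n] pw[of n] in \<open>auto simp: power_abs\<close>)
    then have le: "expectation (\<lambda>x. \<bar>x\<bar> ^ n) \<le> 1"
      by (simp add: prob_space[unfolded space_eq_univ])
    have "cmod (char M t - (\<Sum>k\<le>n. ((\<i> * t) ^ k / fact k) * complex_of_real (\<integral>x. x ^ k \<partial>M)))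
        \<le> (2 * \<bar>t\<bar> ^ n / fact n) * expectation (\<lambda>x. \<bar>x\<bar> ^ n)"
      by (rule char_approx1[OF int])
    also have "\<dots> \<le> (2 * \<bar>t\<bar> ^ n / fact n) * 1"
      by (rule mult_left_mono[OF le]) simp
    finally show ?thesis by simp
  qed
  show "char \<mu> = char \<nu>"
  proof
    fix t
    have "cmod (char \<mu> t - char \<nu> t) \<le> 4 * (\<bar>t\<bar> ^ n / fact n)" for n
    proof -
      let ?p = "\<Sum>k\<le>n. ((\<i> * t) ^ k / fact k) * complex_of_real (\<integral>x. x ^ k \<partial>\<nu>)"
      have "cmod (char \<mu> t - char \<nu> t) \<le> cmod (char \<mu> t - ?p) + cmod (char \<nu> t - ?p)"
        using norm_triangle_ineq4[of "char \<mu> t - ?p" "char \<nu> t - ?p"] by simp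
      also have "\<dots> \<le> 2 * \<bar>t\<bar> ^ n / fact n + 2 * \<bar>t\<bar> ^ n / fact n"
        using approx[OF mu bmu, of t n] approx[OF nu bnu, of t n] unfolding moments
        by (rule add_mono)
      finally show ?thesis by simp
    qed
    moreover have "(\<lambda>n. 4 * (\<bar>t\<bar> ^ n / fact n)) \<longlonglongrightarrow> 4 * 0"
      using summable_LIMSEQ_zero[OF summable_exp[of "\<bar>t\<bar>"]]
      by (intro tendsto_mult tendsto_const) (simp add: divide_inverse mult.commute)
    ultimately have "cmod (char \<mu> t - char \<nu> t) \<le> 0"
      by (intro LIMSEQ_le_const[where X="\<lambda>n. 4 * (\<bar>t\<bar> ^ n / fact n)"]) auto
    then show "char \<mu> t = char \<nu> t" by simp
  qed
qed

text \<open>The values of the Laplace transform of \<open>X\<close> at the natural numbers are the moments of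
  \<open>exp (- X)\<close>, which is bounded by 1. The weights \<open>w\<close>, \<open>v\<close> make the statement usable twice: as a
  uniqueness theorem for one coordinate while the others are kept fixed, and as a criterion for
  independence from an event.\<close>

lemma laplace_determines_weighted_law:
  fixes X w :: "'a \<Rightarrow> real" and Y v :: "'b \<Rightarrow> real"
  assumes M: "finite_measure M" and N: "finite_measure N"
    and [measurable]: "X \<in> borel_measurable M" "w \<in> borel_measurable M"
      "Y \<in> borel_measurable N" "v \<in> borel_measurable N"
    and X0: "AE \<omega> in M. 0 \<le> X \<omega>" and Y0: "AE \<omega> in N. 0 \<le> Y \<omega>"
    and w: "AE \<omega> in M. 0 \<le> w \<omega>" "AE \<omega> in M. w \<omega> \<le> 1"
    and v: "AE \<omega> in N. 0 \<le> v \<omega>" "AE \<omega> in N. v \<omega> \<le> 1"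
    and eq: "\<And>n::nat. (\<integral>\<omega>. w \<omega> * exp (- (real n * X \<omega>)) \<partial>M) = (\<integral>\<omega>. v \<omega> * exp (- (real n * Y \<omega>)) \<partial>N)"
    and B: "B \<in> sets borel"
  shows "(\<integral>\<omega>. w \<omega> * indicator B (X \<omega>) \<partial>M) = (\<integral>\<omega>. v \<omega> * indicator B (Y \<omega>) \<partial>N)"
proof -
  define c where "c = (\<integral>\<omega>. w \<omega> \<partial>M)"
  have c': "c = (\<integral>\<omega>. v \<omega> \<partial>N)" using eq[of 0] by (simp add: c_def)
  have intw: "integrable M w"
    by (rule finite_measure.integrable_const_bound[OF M, of _ 1]) (use w in \<open>auto elim: eventually_elim2\<close>)
  have intv: "integrable N v"
    by (rule finite_measure.integrable_const_bound[OF N, of _ 1]) (use v in \<open>auto elim: eventually_elim2\<close>)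
  have "c \<ge> 0" unfolding c_def by (rule integral_nonneg_AE) fact
  show ?thesis
  proof (cases "c = 0")
    case True
    have "AE \<omega> in M. w \<omega> = 0"
      using integral_nonneg_eq_0_iff_AE[OF intw w(1)] True c_def by simp
    then have "(\<integral>\<omega>. w \<omega> * indicator B (X \<omega>) \<partial>M) = (\<integral>\<omega>. 0 \<partial>M)"
      using B by (intro integral_cong_AE) auto
    moreover have "AE \<omega> in N. v \<omega> = 0"
      using integral_nonneg_eq_0_iff_AE[OF intv v(1)] True c' by simp
    then have "(\<integral>\<omega>. v \<omega> * indicator B (Y \<omega>) \<partial>N) = (\<integral>\<omega>. 0 \<partial>N)"
      using B by (intro integral_cong_AE) auto
    ultimately show ?thesis by simp
  next
    case False
    with \<open>c \<ge> 0\<close> have c: "c > 0" by simp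
    let ?tilted = "\<lambda>M w X. distr (density M (\<lambda>\<omega>. ennreal (w \<omega> / c))) borel (\<lambda>\<omega>. exp (- X \<omega>))"
    have law: "real_distribution (?tilted M w X)"
      "AE x in ?tilted M w X. \<bar>x\<bar> \<le> 1"
      "\<And>f::real\<Rightarrow>real. f \<in> borel_measurable borel \<Longrightarrow>
         (\<integral>x. f x \<partial>?tilted M w X) = (\<integral>\<omega>. w \<omega> * f (exp (- X \<omega>)) \<partial>M) / c"
      if [measurable]: "X \<in> borel_measurable M" "w \<in> borel_measurable M"
        and w: "AE \<omega> in M. 0 \<le> w \<omega>" and X0: "AE \<omega> in M. 0 \<le> X \<omega>"
        and intw: "integrable M w" and cw: "(\<integral>\<omega>. w \<omega> \<partial>M) = c"
      for M :: "'c measure" and w X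
    proof -
      have "(\<integral>\<^sup>+\<omega>. ennreal (w \<omega> / c) \<partial>M) = ennreal (\<integral>\<omega>. w \<omega> / c \<partial>M)"
        using w c by (intro nn_integral_eq_integral integrable_divide intw) (auto elim!: eventually_mono)
      also have "\<dots> = 1" using cw c by simp
      finally have "prob_space (density M (\<lambda>\<omega>. ennreal (w \<omega> / c)))"
        by (intro prob_spaceI) (simp add: emeasure_density cong: nn_integral_cong)
      then show "real_distribution (?tilted M w X)"
        by (intro prob_space.real_distribution_distr) auto
      have "AE \<omega> in density M (\<lambda>\<omega>. ennreal (w \<omega> / c)). \<bar>exp (- X \<omega>)\<bar> \<le> 1"
        using X0 by (subst AE_density) (auto elim: eventually_mono)
      then show "AE x in ?tilted M w X. \<bar>x\<bar> \<le> 1"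
        by (subst AE_distr_iff) auto
      show "(\<integral>x. f x \<partial>?tilted M w X) = (\<integral>\<omega>. w \<omega> * f (exp (- X \<omega>)) \<partial>M) / c"
        if [measurable]: "f \<in> borel_measurable borel" for f :: "real \<Rightarrow> real"
      proof -
        have "(\<integral>x. f x \<partial>?tilted M w X) = (\<integral>\<omega>. (w \<omega> / c) * f (exp (- X \<omega>)) \<partial>M)"
          using w c by (subst integral_distr, simp, simp, subst integral_density) (auto elim!: eventually_mono)
        then show ?thesis by simp
      qed
    qed
    note lawM = law[of X M w, OF _ _ w(1) X0 intw c_def[symmetric], simplified]
    note lawN = law[of Y N v, OF _ _ v(1) Y0 intv c'[symmetric], simplified]
    have pow: "exp (- x) ^ n = exp (- (real n * x))" for n and x :: real
      by (simp flip: exp_of_nat_mult)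
    have same: "?tilted M w X = ?tilted N v Y"
      by (rule bounded_moments_determine_distribution[OF lawM(1) lawN(1) lawM(2) lawN(2)])
        (simp add: lawM(3) lawN(3) pow eq)
    have ind: "indicator B (- ln (exp (- x))) = (indicator B x :: real)" for x by simp
    have "(\<integral>x. indicator B (- ln x) \<partial>?tilted M w X) = (\<integral>x. indicator B (- ln x) \<partial>?tilted N v Y)"
      unfolding same ..
    with B c show ?thesis
      by (subst (asm) lawM(3), simp, subst (asm) lawN(3)) (simp_all add: ind)
  qed
qed

text \<open>Uniqueness for the joint Laplace transform, reduced to one dimension by replacing the factors
  \<open>exp (- t\<^sub>j X\<^sub>j)\<close> with indicators of \<open>X\<^sub>j\<close> one coordinate at a time. After finitely many replacements this
  gives the probabilities of all cylinder sets, and these determine a law on an infinite product.\<close>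

lemma laplace_determines_law:
  fixes X :: "int \<Rightarrow> 'a \<Rightarrow> real" and Y :: "int \<Rightarrow> 'b \<Rightarrow> real"
  assumes M: "prob_space M" and N: "prob_space N"
    and mX: "\<And>j. j \<in> J \<Longrightarrow> X j \<in> borel_measurable M" and mY: "\<And>j. j \<in> J \<Longrightarrow> Y j \<in> borel_measurable N"
    and X0: "\<And>j. j \<in> J \<Longrightarrow> AE \<omega> in M. 0 \<le> X j \<omega>" and Y0: "\<And>j. j \<in> J \<Longrightarrow> AE \<omega> in N. 0 \<le> Y j \<omega>"
    and eq: "\<And>T t. finite T \<Longrightarrow> T \<subseteq> J \<Longrightarrow> (\<And>j. 0 \<le> t j) \<Longrightarrow>
       (\<integral>\<omega>. exp (- (\<Sum>j\<in>T. t j * X j \<omega>)) \<partial>M) = (\<integral>\<omega>. exp (- (\<Sum>j\<in>T. t j * Y j \<omega>)) \<partial>N)"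
  shows "vector_law M J X = vector_law N J Y"
proof -
  interpret M: prob_space M by fact
  interpret N: prob_space N by fact
  have cyl: "\<And>T t A. finite T \<Longrightarrow> T \<subseteq> J \<Longrightarrow> T \<inter> F = {} \<Longrightarrow> (\<And>j. 0 \<le> t j) \<Longrightarrow> (\<And>j. j \<in> F \<Longrightarrow> A j \<in> sets borel) \<Longrightarrow>
      (\<integral>\<omega>. (\<Prod>j\<in>F. indicator (A j) (X j \<omega>)) * exp (- (\<Sum>j\<in>T. t j * X j \<omega>)) \<partial>M) =
      (\<integral>\<omega>. (\<Prod>j\<in>F. indicator (A j) (Y j \<omega>)) * exp (- (\<Sum>j\<in>T. t j * Y j \<omega>)) \<partial>N)"
    if "finite F" "F \<subseteq> J" for F
    using that
  proof (induction F rule: finite_induct)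
    case empty
    then show ?case by (simp add: eq)
  next
    case (insert n F)
    let ?w = "\<lambda>X \<omega>. (\<Prod>j\<in>F. indicator (A j) (X j \<omega>)) * exp (- (\<Sum>j\<in>T. t j * X j \<omega>))"
    have n: "n \<in> J" "F \<subseteq> J" using insert.prems by auto
    note T = insert.prems
    have [measurable]: "X n \<in> borel_measurable M" "Y n \<in> borel_measurable N"
      using n mX mY by auto
    have ind [measurable]: "(\<lambda>\<omega>. indicator (A j) (X j \<omega>) :: real) \<in> borel_measurable M"
      "(\<lambda>\<omega>. indicator (A j) (Y j \<omega>) :: real) \<in> borel_measurable N" if "j \<in> F" for j
      using that n T by (auto intro!: measurable_compose[OF mX borel_measurable_indicator]
          measurable_compose[OF mY borel_measurable_indicator])
    have mw [measurable]: "?w X \<in> borel_measurable M" "?w Y \<in> borel_measurable N"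
      using mX mY T n by (auto intro!: borel_measurable_times borel_measurable_prod borel_measurable_exp
          borel_measurable_uminus borel_measurable_sum ind simp: subset_iff)
    have w0: "0 \<le> ?w X \<omega>" "0 \<le> ?w Y \<omega>'" for \<omega> \<omega>'
      by (auto intro!: mult_nonneg_nonneg prod_nonneg)
    have le: "?w Z \<omega> \<le> 1" if "\<And>j. j \<in> T \<Longrightarrow> 0 \<le> Z j \<omega>" for Z :: "int \<Rightarrow> 'c \<Rightarrow> real" and \<omega>
      using that T by (intro mult_le_one prod_le_1 conjI) (auto intro!: sum_nonneg mult_nonneg_nonneg prod_nonneg)
    have wX: "AE \<omega> in M. ?w X \<omega> \<le> 1"
    proof -
      have "AE \<omega> in M. \<forall>j\<in>T. 0 \<le> X j \<omega>"
        using X0 T by (intro AE_finite_allI) auto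
      then show ?thesis by eventually_elim (rule le, auto)
    qed
    have wY: "AE \<omega> in N. ?w Y \<omega> \<le> 1"
    proof -
      have "AE \<omega> in N. \<forall>j\<in>T. 0 \<le> Y j \<omega>"
        using Y0 T by (intro AE_finite_allI) auto
      then show ?thesis by eventually_elim (rule le, auto)
    qed
    have "(\<integral>\<omega>. ?w X \<omega> * indicator (A n) (X n \<omega>) \<partial>M) = (\<integral>\<omega>. ?w Y \<omega> * indicator (A n) (Y n \<omega>) \<partial>N)"
    proof (rule laplace_determines_weighted_law)
      fix k :: nat
      have nT: "n \<notin> T" "finite T" using T by auto
      have split: "?w Z \<omega> * exp (- (real k * Z n \<omega>)) =
          (\<Prod>j\<in>F. indicator (A j) (Z j \<omega>)) * exp (- (\<Sum>j\<in>insert n T. (t(n := real k)) j * Z j \<omega>))"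
        for Z :: "int \<Rightarrow> 'c \<Rightarrow> real" and \<omega>
      proof -
        have "(\<Sum>j\<in>insert n T. (t(n := real k)) j * Z j \<omega>) = real k * Z n \<omega> + (\<Sum>j\<in>T. t j * Z j \<omega>)"
          using nT by (simp, intro sum.cong) auto
        then show ?thesis by (simp add: exp_add [symmetric] algebra_simps exp_minus exp_diff divide_simps)
      qed
      show "(\<integral>\<omega>. ?w X \<omega> * exp (- (real k * X n \<omega>)) \<partial>M) = (\<integral>\<omega>. ?w Y \<omega> * exp (- (real k * Y n \<omega>)) \<partial>N)"
        unfolding split
        by (rule insert.IH) (use T n \<open>n \<notin> F\<close> in auto)
    qed (use X0 Y0 n T wX wY w0 in \<open>auto intro: M.finite_measure_axioms N.finite_measure_axioms\<close>)
    then show ?case using insert.hyps by (simp add: mult_ac)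
  qed
  have rX: "(\<lambda>\<omega>. \<lambda>j\<in>J. X j \<omega>) \<in> measurable M (PiM J (\<lambda>_. borel))"
    by (intro measurable_restrict mX)
  have rY: "(\<lambda>\<omega>. \<lambda>j\<in>J. Y j \<omega>) \<in> measurable N (PiM J (\<lambda>_. borel))"
    by (intro measurable_restrict mY)
  show ?thesis unfolding vector_law_def
  proof (rule measure_eqI_PiM_infinite)
    show "finite_measure (distr M (PiM J (\<lambda>_. borel)) (\<lambda>\<omega>. \<lambda>j\<in>J. X j \<omega>))"
      using M.prob_space_distr[OF rX] by (simp add: prob_space_def)
    fix A :: "int \<Rightarrow> real set" and F assume F: "finite F" "F \<subseteq> J" and A: "\<And>i. i \<in> F \<Longrightarrow> A i \<in> sets borel"
    let ?C = "prod_emb J (\<lambda>_. borel) F (Pi\<^sub>E F A)"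
    have C: "?C \<in> sets (PiM J (\<lambda>_. borel))"
      using F A by (intro sets_PiM_I) auto
    have ind: "(\<Prod>j\<in>F. indicator (A j) (Z j \<omega>)) = (indicator ((\<lambda>\<omega>. \<lambda>j\<in>J. Z j \<omega>) -` ?C \<inter> S) \<omega> :: real)"
      if "\<omega> \<in> S" for Z :: "int \<Rightarrow> 'c \<Rightarrow> real" and \<omega> S
      using F that
      by (subst prod.cong[OF refl, of F _ "\<lambda>j. if Z j \<omega> \<in> A j then 1 else 0"])
         (auto simp: indicator_def prod_emb_def subset_iff restrict_def PiE_iff extensional_def split: if_splits)
    have "(\<integral>\<omega>. (\<Prod>j\<in>F. indicat_real (A j) (X j \<omega>)) \<partial>M) = (\<integral>\<omega>. (\<Prod>j\<in>F. indicat_real (A j) (Y j \<omega>)) \<partial>N)"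
      using cyl[OF F, of "{}" "\<lambda>_. 0" A] A by simp
    also have "(\<integral>\<omega>. (\<Prod>j\<in>F. indicat_real (A j) (X j \<omega>)) \<partial>M) = (\<integral>\<omega>. indicator ((\<lambda>\<omega>. \<lambda>j\<in>J. X j \<omega>) -` ?C \<inter> space M) \<omega> \<partial>M)"
      by (intro Bochner_Integration.integral_cong refl ind)
    also have "(\<integral>\<omega>. (\<Prod>j\<in>F. indicat_real (A j) (Y j \<omega>)) \<partial>N) = (\<integral>\<omega>. indicator ((\<lambda>\<omega>. \<lambda>j\<in>J. Y j \<omega>) -` ?C \<inter> space N) \<omega> \<partial>N)"
      by (intro Bochner_Integration.integral_cong refl ind)
    finally show "emeasure (distr M (PiM J (\<lambda>_. borel)) (\<lambda>\<omega>. \<lambda>j\<in>J. X j \<omega>)) ?C =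
        emeasure (distr N (PiM J (\<lambda>_. borel)) (\<lambda>\<omega>. \<lambda>j\<in>J. Y j \<omega>)) ?C"
      using C measurable_sets[OF rX C] measurable_sets[OF rY C]
      by (simp add: emeasure_distr[OF rX C] emeasure_distr[OF rY C] M.emeasure_eq_measure N.emeasure_eq_measure)
  qed simp_all
qed

lemma laplace_PiM:
  fixes \<mu> :: "int \<Rightarrow> real measure" and s :: "int \<Rightarrow> real"
  assumes K: "finite K"
    and \<mu>: "\<And>m. m \<in> K \<Longrightarrow> prob_space (\<mu> m)" "\<And>m. m \<in> K \<Longrightarrow> sets (\<mu> m) = sets borel"
      "\<And>m. m \<in> K \<Longrightarrow> AE x in \<mu> m. 0 \<le> x"
    and s: "\<And>m. m \<in> K \<Longrightarrow> 0 \<le> s m"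
  shows "(\<integral>y. exp (- (\<Sum>m\<in>K. s m * y m)) \<partial>PiM K \<mu>) = (\<Prod>m\<in>K. \<integral>x. exp (- (s m * x)) \<partial>\<mu> m)"
proof -
  define \<mu>' where "\<mu>' m = (if m \<in> K then \<mu> m else return borel 0)" for m
  interpret product_prob_space \<mu>' K
    using \<mu>(1) by (auto simp: \<mu>'_def product_prob_space_def product_prob_space_axioms_def product_sigma_finite_def
        intro!: prob_space_imp_sigma_finite prob_space_return)
  have eq: "PiM K \<mu> = PiM K \<mu>'" by (intro PiM_cong) (auto simp: \<mu>'_def)
  have "(\<integral>y. exp (- (\<Sum>m\<in>K. s m * y m)) \<partial>PiM K \<mu>) = (\<integral>y. (\<Prod>m\<in>K. exp (- (s m * y m))) \<partial>PiM K \<mu>')"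
    unfolding eq using K by (simp add: exp_sum sum_negf[symmetric])
  also have "\<dots> = (\<Prod>m\<in>K. \<integral>x. exp (- (s m * x)) \<partial>\<mu>' m)"
  proof (rule product_integral_prod[OF K])
    fix m assume m: "m \<in> K"
    interpret prob_space "\<mu> m" using \<mu>(1) m .
    have sets: "sets (\<mu> m) = sets borel" using \<mu>(2) m .
    have "AE x in \<mu> m. norm (exp (- (s m * x))) \<le> 1"
      using \<mu>(3)[OF m] s[OF m] by (auto elim!: eventually_mono)
    then have "integrable (\<mu> m) (\<lambda>x. exp (- (s m * x)))"
      by (intro integrable_const_bound[of _ 1]) (auto simp: measurable_cong_sets[OF sets refl])
    then show "integrable (\<mu>' m) (\<lambda>x. exp (- (s m * x)))" using m by (simp add: \<mu>'_def)
  qed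
  also have "\<dots> = (\<Prod>m\<in>K. \<integral>x. exp (- (s m * x)) \<partial>\<mu> m)"
    by (intro prod.cong) (auto simp: \<mu>'_def)
  finally show ?thesis .
qed

lemma vector_law_coordinates:
  assumes "sets G = sets (PiM J (\<lambda>_. borel))"
  shows "vector_law G J (\<lambda>m y. y m) = G"
proof -
  have sp: "space G = extensional J" using sets_eq_imp_space_eq[OF assms] by (simp add: space_PiM PiE_def)
  have "vector_law G J (\<lambda>m y. y m) = distr G G (\<lambda>y. y)"
    unfolding vector_law_def using assms sp by (intro distr_cong) (auto simp: extensional_restrict)
  then show ?thesis by (simp add: distr_id2)
qed

text \<open>A factorizing joint Laplace transform means independence.\<close>

lemma vector_law_eq_PiM_of_laplace:
  fixes X :: "int \<Rightarrow> 'a \<Rightarrow> real" and \<mu> :: "int \<Rightarrow> real measure"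
  assumes Q: "prob_space Q" and K: "finite K"
    and X: "\<And>m. m \<in> K \<Longrightarrow> X m \<in> borel_measurable Q" and X0: "\<And>m. m \<in> K \<Longrightarrow> AE \<omega> in Q. 0 \<le> X m \<omega>"
    and \<mu>: "\<And>m. m \<in> K \<Longrightarrow> prob_space (\<mu> m)" "\<And>m. m \<in> K \<Longrightarrow> sets (\<mu> m) = sets borel"
      "\<And>m. m \<in> K \<Longrightarrow> AE x in \<mu> m. 0 \<le> x"
    and eq: "\<And>t. (\<And>m. 0 \<le> t m) \<Longrightarrow>
      (\<integral>\<omega>. exp (- (\<Sum>m\<in>K. t m * X m \<omega>)) \<partial>Q) = (\<Prod>m\<in>K. \<integral>x. exp (- (t m * x)) \<partial>\<mu> m)"
  shows "vector_law Q K X = PiM K \<mu>"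
proof -
  have sets: "sets (PiM K \<mu>) = sets (PiM K (\<lambda>_. borel))"
    using \<mu>(2) by (intro sets_PiM_cong) auto
  have "vector_law Q K X = vector_law (PiM K \<mu>) K (\<lambda>m y. y m)"
  proof (rule laplace_determines_law[OF Q])
    show "prob_space (PiM K \<mu>)" using \<mu>(1) by (rule prob_space_PiM)
    show "(\<lambda>y. y m) \<in> borel_measurable (PiM K \<mu>)" if "m \<in> K" for m
      using measurable_component_singleton[OF that, of "\<lambda>_. borel"]
      by (simp add: measurable_cong_sets[OF sets refl])
    show "AE y in PiM K \<mu>. 0 \<le> y m" if "m \<in> K" for m
      using \<mu> that by (intro AE_PiM_component) auto
    fix T t assume T: "finite T" "T \<subseteq> K" and t: "\<And>j::int. 0 \<le> (t j :: real)"
    define t' where "t' m = (if m \<in> T then t m else 0)" for m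
    have t0: "0 \<le> t' m" for m using t by (simp add: t'_def)
    have ext: "(\<Sum>m\<in>T. t m * z m) = (\<Sum>m\<in>K. t' m * z m)" for z
      using T K by (intro sum.mono_neutral_cong_left) (auto simp: t'_def)
    show "(\<integral>\<omega>. exp (- (\<Sum>m\<in>T. t m * X m \<omega>)) \<partial>Q) = (\<integral>y. exp (- (\<Sum>m\<in>T. t m * y m)) \<partial>PiM K \<mu>)"
      unfolding ext using eq[OF t0] laplace_PiM[OF K \<mu>, where s = t'] t0 by simp
  qed (use X X0 in auto)
  then show ?thesis by (simp add: vector_law_coordinates[OF sets])
qed

lemma laplace_determines_distr:
  fixes X :: "'a \<Rightarrow> real" and Y :: "'b \<Rightarrow> real"
  assumes M: "prob_space M" and N: "prob_space N"
    and X [measurable]: "X \<in> borel_measurable M" and Y [measurable]: "Y \<in> borel_measurable N"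
    and X0: "AE \<omega> in M. 0 \<le> X \<omega>" and Y0: "AE \<omega> in N. 0 \<le> Y \<omega>"
    and eq: "\<And>u. 0 \<le> u \<Longrightarrow> (\<integral>\<omega>. exp (- (u * X \<omega>)) \<partial>M) = (\<integral>\<omega>. exp (- (u * Y \<omega>)) \<partial>N)"
  shows "distr M borel X = distr N borel Y"
proof (rule measure_eqI)
  interpret M: prob_space M by fact
  interpret N: prob_space N by fact
  fix B assume "B \<in> sets (distr M borel X)"
  then have B [measurable]: "B \<in> sets borel" by simp
  have "(\<integral>\<omega>. 1 * indicat_real B (X \<omega>) \<partial>M) = (\<integral>\<omega>. 1 * indicat_real B (Y \<omega>) \<partial>N)"
    by (rule laplace_determines_weighted_law)
      (use X0 Y0 eq in \<open>auto intro: M.finite_measure_axioms N.finite_measure_axioms\<close>)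
  moreover have "indicat_real B (X \<omega>) = indicat_real (X -` B \<inter> space M) \<omega>" if "\<omega> \<in> space M" for \<omega>
    using that by (simp add: indicator_def)
  moreover have "indicat_real B (Y \<omega>) = indicat_real (Y -` B \<inter> space N) \<omega>" if "\<omega> \<in> space N" for \<omega>
    using that by (simp add: indicator_def)
  ultimately have "(\<integral>\<omega>. indicat_real (X -` B \<inter> space M) \<omega> \<partial>M) = (\<integral>\<omega>. indicat_real (Y -` B \<inter> space N) \<omega> \<partial>N)"
    by (simp cong: Bochner_Integration.integral_cong)
  then show "emeasure (distr M borel X) B = emeasure (distr N borel Y) B"
    by (simp add: emeasure_distr M.emeasure_eq_measure N.emeasure_eq_measure)
qed simp

section \<open>Integrals of independent random elements\<close>

lemma joint_law_of_independent:
  fixes X :: "'a \<Rightarrow> 'b" and Y :: "'a \<Rightarrow> 'c"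
  assumes M: "prob_space M" and X [measurable]: "X \<in> measurable M S" and Y [measurable]: "Y \<in> measurable M T"
    and indep: "\<And>A B. A \<in> sets S \<Longrightarrow> B \<in> sets T \<Longrightarrow>
      measure M ((X -` A \<inter> space M) \<inter> (Y -` B \<inter> space M)) =
      measure M (X -` A \<inter> space M) * measure M (Y -` B \<inter> space M)"
  shows "distr M S X \<Otimes>\<^sub>M distr M T Y = distr M (S \<Otimes>\<^sub>M T) (\<lambda>\<omega>. (X \<omega>, Y \<omega>))"
proof (rule pair_measure_eqI)
  interpret M: prob_space M by fact
  show "sigma_finite_measure (distr M S X)" "sigma_finite_measure (distr M T Y)"
    using M.prob_space_distr[OF X] M.prob_space_distr[OF Y] by (auto simp: prob_space_imp_sigma_finite)
  fix A B assume A: "A \<in> sets (distr M S X)" and B: "B \<in> sets (distr M T Y)"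
  have "(\<lambda>\<omega>. (X \<omega>, Y \<omega>)) -` (A \<times> B) \<inter> space M = (X -` A \<inter> space M) \<inter> (Y -` B \<inter> space M)"
    by auto
  with A B indep[of A B] show "emeasure (distr M S X) A * emeasure (distr M T Y) B =
      emeasure (distr M (S \<Otimes>\<^sub>M T) (\<lambda>\<omega>. (X \<omega>, Y \<omega>))) (A \<times> B)"
    by (simp add: emeasure_distr M.emeasure_eq_measure ennreal_mult'')
qed (simp cong: sets_pair_measure_cong)

text \<open>Fubini's theorem for independent random elements whose values may lie in different types; the
  hypothesis on events is the one that \<^const>\<open>indep_elements\<close> delivers.\<close>

lemma integral_of_independent:
  fixes X :: "'a \<Rightarrow> 'b" and Y :: "'a \<Rightarrow> 'c" and f :: "'b \<times> 'c \<Rightarrow> real"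
  assumes M: "prob_space M" and X [measurable]: "X \<in> measurable M S" and Y [measurable]: "Y \<in> measurable M T"
    and indep: "\<And>A B. A \<in> sets S \<Longrightarrow> B \<in> sets T \<Longrightarrow>
      measure M ((X -` A \<inter> space M) \<inter> (Y -` B \<inter> space M)) =
      measure M (X -` A \<inter> space M) * measure M (Y -` B \<inter> space M)"
    and f [measurable]: "f \<in> borel_measurable (S \<Otimes>\<^sub>M T)" and bound: "\<And>z. \<bar>f z\<bar> \<le> C"
  shows "(\<integral>\<omega>. f (X \<omega>, Y \<omega>) \<partial>M) = (\<integral>\<omega>. (\<integral>\<omega>'. f (X \<omega>', Y \<omega>) \<partial>M) \<partial>M)"
proof -
  interpret M: prob_space M by fact
  interpret X: prob_space "distr M S X" by (rule M.prob_space_distr) fact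
  interpret Y: prob_space "distr M T Y" by (rule M.prob_space_distr) fact
  interpret XY: pair_prob_space "distr M S X" "distr M T Y" ..
  have sets: "sets (distr M S X \<Otimes>\<^sub>M distr M T Y) = sets (S \<Otimes>\<^sub>M T)"
    by (intro sets_pair_measure_cong) auto
  have int: "integrable (distr M S X \<Otimes>\<^sub>M distr M T Y) f"
    by (rule XY.integrable_const_bound[of _ C]) (use bound in \<open>auto simp: measurable_cong_sets[OF sets refl]\<close>)
  have meas: "f \<circ> (\<lambda>x. (x, Y \<omega>)) \<in> borel_measurable S" if "\<omega> \<in> space M" for \<omega>
    using that measurable_space[OF Y] by (auto simp: comp_def)
  have "(\<integral>\<omega>. f (X \<omega>, Y \<omega>) \<partial>M) = (\<integral>z. f z \<partial>distr M (S \<Otimes>\<^sub>M T) (\<lambda>\<omega>. (X \<omega>, Y \<omega>)))"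
    by (subst integral_distr) auto
  also have "\<dots> = (\<integral>z. f z \<partial>(distr M S X \<Otimes>\<^sub>M distr M T Y))"
    by (simp add: joint_law_of_independent[OF M X Y indep])
  also have "\<dots> = (\<integral>y. (\<integral>x. f (x, y) \<partial>distr M S X) \<partial>distr M T Y)"
    using XY.integral_snd[of "\<lambda>x y. f (x, y)"] int by simp
  also have "\<dots> = (\<integral>\<omega>. (\<integral>x. f (x, Y \<omega>) \<partial>distr M S X) \<partial>M)"
    by (subst integral_distr) (auto intro!: X.borel_measurable_lebesgue_integral)
  also have "\<dots> = (\<integral>\<omega>. (\<integral>\<omega>'. f (X \<omega>', Y \<omega>) \<partial>M) \<partial>M)"
    by (intro Bochner_Integration.integral_cong refl integral_distr X) (use meas in \<open>auto simp: comp_def\<close>)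
  finally show ?thesis .
qed

section \<open>Gamma and Dirichlet distributions\<close>

lemma borel_measurable_gamma_density [measurable]: "gamma_density a \<gamma> \<in> borel_measurable borel"
  unfolding gamma_density_def by measurable

lemma sets_gamma_distribution [simp, measurable_cong]: "sets (gamma_distribution a \<gamma>) = sets borel"
  and space_gamma_distribution [simp]: "space (gamma_distribution a \<gamma>) = UNIV"
  by (simp_all add: gamma_distribution_def)

lemma gamma_density_nonneg: "0 < a \<Longrightarrow> 0 < \<gamma> \<Longrightarrow> 0 \<le> gamma_density a \<gamma> x"
  by (simp add: gamma_density_def)

lemma nn_integral_gamma_density:
  assumes "0 < a" "0 < \<gamma>"
  shows "(\<integral>\<^sup>+x. ennreal (gamma_density a \<gamma> x) \<partial>lborel) = 1"
proof -
  let ?g = "\<lambda>t. indicator {0..} t * t powr (a - 1) / exp t :: real"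
  have Gpos: "Gamma a > 0" using assms by simp
  note G = Gpos Gpos[THEN less_imp_neq, THEN not_sym]
  have "ennreal (Gamma a) = ennreal \<bar>\<gamma>\<bar> * (\<integral>\<^sup>+x. ennreal (?g (0 + \<gamma> * x)) \<partial>lborel)"
    unfolding Gamma_conv_nn_integral_real[OF assms(1)]
    by (rule nn_integral_real_affine) (use assms in auto)
  also have "\<dots> = (\<integral>\<^sup>+x. ennreal \<gamma> * ennreal (?g (0 + \<gamma> * x)) \<partial>lborel)"
    using assms by (subst nn_integral_cmult) auto
  also have "\<dots> = (\<integral>\<^sup>+x. ennreal (Gamma a) * ennreal (gamma_density a \<gamma> x) \<partial>lborel)"
  proof (intro nn_integral_cong)
    fix x :: real
    have "\<gamma> * ?g (0 + \<gamma> * x) = Gamma a * gamma_density a \<gamma> x"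
    proof (cases "0 < x")
      case True
      have "\<gamma> * (\<gamma> * x) powr (a - 1) = \<gamma> powr a * x powr (a - 1)"
        using assms True powr_add[of \<gamma> 1 "a - 1"] by (simp add: powr_mult)
      with True assms G show ?thesis
        by (simp add: gamma_density_def indicator_def exp_minus divide_simps) (simp add: mult_ac)?
    next
      case False
      with assms show ?thesis
        by (cases "x = 0") (auto simp: gamma_density_def indicator_def zero_le_mult_iff)
    qed
    then show "ennreal \<gamma> * ennreal (?g (0 + \<gamma> * x)) = ennreal (Gamma a) * ennreal (gamma_density a \<gamma> x)"
      using assms G(1) by (subst (1 2) ennreal_mult''[symmetric]) (auto simp: gamma_density_nonneg)
  qed
  also have "\<dots> = ennreal (Gamma a) * (\<integral>\<^sup>+x. ennreal (gamma_density a \<gamma> x) \<partial>lborel)"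
    by (rule nn_integral_cmult) auto
  finally have "ennreal (Gamma a) * 1 = ennreal (Gamma a) * (\<integral>\<^sup>+x. ennreal (gamma_density a \<gamma> x) \<partial>lborel)"
    by simp
  then show ?thesis
    using G by (subst (asm) ennreal_mult_cancel_left) auto
qed

lemma prob_space_gamma_distribution: "0 < a \<Longrightarrow> 0 < \<gamma> \<Longrightarrow> prob_space (gamma_distribution a \<gamma>)"
  by (rule prob_spaceI) (simp add: gamma_distribution_def emeasure_density nn_integral_gamma_density)

lemma AE_gamma_distribution_pos: "AE x in gamma_distribution a \<gamma>. 0 < x"
  unfolding gamma_distribution_def
  by (subst AE_density) (auto simp: gamma_density_def split: if_splits)

lemma laplace_gamma_distribution:
  assumes "0 < a" "0 < \<gamma>" "0 \<le> u"
  shows "(\<integral>x. exp (- (u * x)) \<partial>gamma_distribution a \<gamma>) = (1 + u / \<gamma>) powr (- a)"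
proof -
  have r: "\<gamma> powr a / (\<gamma> + u) powr a = (1 + u / \<gamma>) powr (- a)"
  proof -
    have "1 + u / \<gamma> = (\<gamma> + u) / \<gamma>" using assms by (simp add: field_simps)
    then show ?thesis using assms by (simp add: powr_minus powr_divide)
  qed
  have int1: "(\<integral>x. gamma_density a (\<gamma> + u) x \<partial>lborel) = 1"
    using nn_integral_gamma_density[of a "\<gamma> + u"] assms
    by (subst integral_eq_nn_integral) (auto simp: gamma_density_nonneg)
  have "(\<integral>x. exp (- (u * x)) \<partial>gamma_distribution a \<gamma>) = (\<integral>x. gamma_density a \<gamma> x * exp (- (u * x)) \<partial>lborel)"
    unfolding gamma_distribution_def
    using assms by (subst integral_density) (auto simp: gamma_density_nonneg)
  also have "\<dots> = (\<integral>x. \<gamma> powr a / (\<gamma> + u) powr a * gamma_density a (\<gamma> + u) x \<partial>lborel)"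
    using assms by (intro Bochner_Integration.integral_cong refl)
      (auto simp: gamma_density_def exp_add[symmetric] algebra_simps)
  also have "\<dots> = \<gamma> powr a / (\<gamma> + u) powr a"
    using int1 by simp
  finally show ?thesis using r by simp
qed

lemma prob_space_PiM_gamma: 
  assumes "\<And>i. i \<in> K \<Longrightarrow> 0 < \<alpha> i"
  shows "prob_space (PiM K (\<lambda>i. gamma_distribution (\<alpha> i) 1))"
  using assms by (intro prob_space_PiM prob_space_gamma_distribution) auto

lemma laplace_PiM_gamma:
  fixes K :: "int set" and s :: "int \<Rightarrow> real"
  assumes K: "finite K" and \<alpha>: "0 < \<alpha>" and s: "\<And>m. m \<in> K \<Longrightarrow> 0 \<le> s m"
  shows "(\<integral>y. exp (- (\<Sum>m\<in>K. s m * y m)) \<partial>PiM K (\<lambda>_. gamma_distribution \<alpha> 1)) =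
    (\<Prod>m\<in>K. (1 + s m) powr (- \<alpha>))"
proof -
  have "(\<integral>y. exp (- (\<Sum>m\<in>K. s m * y m)) \<partial>PiM K (\<lambda>_. gamma_distribution \<alpha> 1)) =
      (\<Prod>m\<in>K. \<integral>x. exp (- (s m * x)) \<partial>gamma_distribution \<alpha> 1)"
    by (rule laplace_PiM[OF K])
      (use AE_gamma_distribution_pos[of \<alpha> 1] \<alpha> s in \<open>auto intro: prob_space_gamma_distribution elim!: eventually_mono\<close>)
  also have "\<dots> = (\<Prod>m\<in>K. (1 + s m) powr (- \<alpha>))"
    using \<alpha> s by (intro prod.cong refl) (simp add: laplace_gamma_distribution)
  finally show ?thesis .
qed

text \<open>Multiplying a Gamma density by \<open>exp (- u x)\<close> only changes its rate. Hence the exponential tilt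
  of a vector of independent Gamma variables by their sum is, up to normalization, the same vector
  divided by \<open>1 + u\<close>. This replaces the change of variables from the vector to its sum and its
  proportions.\<close>

lemma tilted_gamma_vector_is_scaled:
  fixes K :: "int set" and F :: "(int \<Rightarrow> real) \<Rightarrow> real"
  assumes K: "finite K" and \<alpha>: "0 < \<alpha>" and u: "0 \<le> u"
    and F [measurable]: "F \<in> borel_measurable (PiM K (\<lambda>_. borel))"
  defines "G \<equiv> PiM K (\<lambda>_. gamma_distribution \<alpha> 1)"
  shows "(\<integral>y. exp (- (u * (\<Sum>m\<in>K. y m))) * F y \<partial>G) =
    (1 + u) powr (- (\<alpha> * card K)) * (\<integral>y. F (\<lambda>m\<in>K. y m / (1 + u)) \<partial>G)"
proof -
  interpret prob_space G unfolding G_def using \<alpha> by (intro prob_space_PiM_gamma)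
  have sets [measurable_cong]: "sets G = sets (PiM K (\<lambda>_. borel))"
    unfolding G_def by (intro sets_PiM_cong) auto
  have comp [measurable]: "(\<lambda>y. y m) \<in> borel_measurable G" if "m \<in> K" for m
    using measurable_component_singleton[OF that, of "\<lambda>_. borel"] by (simp add: measurable_cong_sets[OF sets refl])
  have pos: "AE y in G. \<forall>m\<in>K. 0 < y m" unfolding G_def
    using K \<alpha> by (intro AE_finite_allI AE_PiM_component prob_space_gamma_distribution AE_gamma_distribution_pos) auto
  define a where "a = \<alpha> * card K"
  define W where "W y = (1 + u) powr a * exp (- (u * (\<Sum>m\<in>K. y m)))" for y :: "int \<Rightarrow> real"
  have W0: "0 \<le> W y" for y by (simp add: W_def)
  have Wm [measurable]: "W \<in> borel_measurable G" unfolding W_def by measurable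
  have lap: "(\<integral>y. W y * exp (- (\<Sum>m\<in>K. t m * y m)) \<partial>G) = (1 + u) powr a * (\<Prod>m\<in>K. (1 + (u + t m)) powr (- \<alpha>))"
    if "\<And>m. m \<in> K \<Longrightarrow> 0 \<le> t m" for t
  proof -
    have "(\<integral>y. W y * exp (- (\<Sum>m\<in>K. t m * y m)) \<partial>G) = (\<integral>y. (1 + u) powr a * exp (- (\<Sum>m\<in>K. (u + t m) * y m)) \<partial>G)"
      by (intro Bochner_Integration.integral_cong refl)
        (simp add: W_def sum.distrib algebra_simps sum_distrib_left exp_add[symmetric])
    also have "\<dots> = (1 + u) powr a * (\<Prod>m\<in>K. (1 + (u + t m)) powr (- \<alpha>))"
      using laplace_PiM_gamma[OF K \<alpha>, of "\<lambda>m. u + t m"] u that by (simp add: G_def)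
    finally show ?thesis .
  qed
  have pu: "(\<Prod>m\<in>K. (1 + u) powr (- \<alpha>)) = (1 + u) powr (- a)"
    using u by (simp add: a_def powr_power mult.commute)
  have uu: "(1 + u) powr a * (1 + u) powr (- a) = 1"
    using u by (simp add: powr_add[symmetric])
  have nn: "(\<integral>\<^sup>+y. ennreal (W y) \<partial>G) = 1"
  proof -
    have int: "integrable G W"
      by (rule integrable_const_bound[of _ "(1 + u) powr a"])
        (use pos u in \<open>auto elim!: eventually_mono simp: W_def less_imp_le intro!: mult_left_le mult_nonneg_nonneg sum_nonneg\<close>)
    have "(\<integral>y. W y \<partial>G) = 1"
      using lap[of "\<lambda>_. 0"] pu uu by simp
    then show ?thesis using nn_integral_eq_integral[OF int] W0 by simp
  qed
  have Wprob: "prob_space (density G W)"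
    by (intro prob_spaceI) (simp add: emeasure_density nn cong: nn_integral_cong)
  have law: "vector_law (density G W) K (\<lambda>m y. y m) = vector_law G K (\<lambda>m y. y m / (1 + u))"
  proof (rule laplace_determines_law[OF Wprob prob_space_axioms])
    fix T t assume T: "finite T" "T \<subseteq> K" and t: "\<And>j::int. 0 \<le> (t j :: real)"
    define t' where "t' m = (if m \<in> T then t m else 0)" for m
    have t0: "0 \<le> t' m" for m using t by (simp add: t'_def)
    have ext: "(\<Sum>m\<in>T. t m * z m) = (\<Sum>m\<in>K. t' m * z m)" for z
      using T K by (intro sum.mono_neutral_cong_left) (auto simp: t'_def)
    have factor: "(\<Prod>m\<in>K. (1 + (u + t' m)) powr (- \<alpha>)) =
        (\<Prod>m\<in>K. (1 + u) powr (- \<alpha>) * (1 + t' m / (1 + u)) powr (- \<alpha>))"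
    proof (intro prod.cong refl)
      fix m
      have "1 + (u + t' m) = (1 + u) * (1 + t' m / (1 + u))" using u by (simp add: field_simps)
      then show "(1 + (u + t' m)) powr (- \<alpha>) = (1 + u) powr (- \<alpha>) * (1 + t' m / (1 + u)) powr (- \<alpha>)"
        using u t0[of m] by (simp add: powr_mult)
    qed
    have "(\<integral>y. exp (- (\<Sum>m\<in>T. t m * y m)) \<partial>density G W) = (\<integral>y. W y * exp (- (\<Sum>m\<in>K. t' m * y m)) \<partial>G)"
      unfolding ext using W0 by (subst integral_density) auto
    also have "\<dots> = (1 + u) powr a * (\<Prod>m\<in>K. (1 + (u + t' m)) powr (- \<alpha>))"
      by (rule lap) (rule t0)
    also have "\<dots> = ((1 + u) powr a * (1 + u) powr (- a)) * (\<Prod>m\<in>K. (1 + t' m / (1 + u)) powr (- \<alpha>))"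
      unfolding factor prod.distrib pu by (rule mult.assoc[symmetric])
    also have "\<dots> = (\<Prod>m\<in>K. (1 + t' m / (1 + u)) powr (- \<alpha>))"
      unfolding uu by (rule mult_1)
    also have "\<dots> = (\<integral>y. exp (- (\<Sum>m\<in>K. (t' m / (1 + u)) * y m)) \<partial>G)"
      using u t0 unfolding G_def by (subst laplace_PiM_gamma[OF K \<alpha>]) auto
    also have "\<dots> = (\<integral>y. exp (- (\<Sum>m\<in>T. t m * (y m / (1 + u)))) \<partial>G)"
      unfolding ext by simp
    finally show "(\<integral>y. exp (- (\<Sum>m\<in>T. t m * y m)) \<partial>density G W) = (\<integral>y. exp (- (\<Sum>m\<in>T. t m * (y m / (1 + u)))) \<partial>G)" .
  next
    fix m assume m: "m \<in> K"
    show "(\<lambda>y. y m) \<in> borel_measurable (density G W)" "(\<lambda>y. y m / (1 + u)) \<in> borel_measurable G"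
      using m by measurable
    have m0: "AE y in G. 0 \<le> y m" using pos by eventually_elim (use m in \<open>auto simp: less_imp_le\<close>)
    then show "AE y in density G W. 0 \<le> y m" by (subst AE_density) auto
    show "AE y in G. 0 \<le> y m / (1 + u)" using m0 by eventually_elim (use u in simp)
  qed
  have "(\<integral>y. exp (- (u * (\<Sum>m\<in>K. y m))) * F y \<partial>G) = (1 + u) powr (- a) * (\<integral>y. W y * F y \<partial>G)"
  proof -
    have "exp (- (u * (\<Sum>m\<in>K. y m))) * F y = (1 + u) powr (- a) * (W y * F y)" for y
    proof -
      have "(1 + u) powr (- a) * (W y * F y) =
          ((1 + u) powr a * (1 + u) powr (- a)) * (exp (- (u * (\<Sum>m\<in>K. y m))) * F y)"
        by (simp only: W_def mult_ac)
      also have "\<dots> = exp (- (u * (\<Sum>m\<in>K. y m))) * F y" unfolding uu by simp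
      finally show ?thesis ..
    qed
    then show ?thesis by (simp only: integral_mult_right_zero)
  qed
  also have "(\<integral>y. W y * F y \<partial>G) = (\<integral>y. F y \<partial>density G W)"
    using W0 by (subst integral_density) auto
  also have "\<dots> = (\<integral>y. F (\<lambda>m\<in>K. y m) \<partial>density G W)"
    by (intro Bochner_Integration.integral_cong refl)
      (auto simp: G_def space_PiM PiE_restrict)
  also have "\<dots> = (\<integral>y. F y \<partial>vector_law (density G W) K (\<lambda>m y. y m))"
    unfolding vector_law_def by (subst integral_distr) (auto intro!: measurable_restrict)
  also have "\<dots> = (\<integral>y. F (\<lambda>m\<in>K. y m / (1 + u)) \<partial>G)"
    unfolding law unfolding vector_law_def by (subst integral_distr) (auto intro!: measurable_restrict)
  finally show ?thesis unfolding a_def .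
qed

text \<open>The left-hand side is the Laplace transform of a Gamma variable split in Dirichlet proportions,
  with the Gamma variable integrated out; the right-hand side is that of independent Gamma variables.
  They agree because in a vector of independent Gamma variables the sum \<open>S\<close> is independent of every
  function \<open>R\<close> of the proportions: \<open>R\<close> does not change when the vector is scaled, so an exponential tilt
  by \<open>S\<close> does not change the law of \<open>R\<close>.\<close>

lemma gamma_mixture_over_dirichlet:
  fixes K :: "int set"
  assumes K: "finite K" "K \<noteq> {}" and \<alpha>: "0 < \<alpha>" and s: "\<And>m. 0 \<le> s m"
  defines "G \<equiv> PiM K (\<lambda>_. gamma_distribution \<alpha> 1)"
  shows "(\<integral>y. (1 + (\<Sum>m\<in>K. s m * (y m / (\<Sum>k\<in>K. y k)))) powr (- (\<alpha> * card K)) \<partial>G) =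
    (\<Prod>m\<in>K. (1 + s m) powr (- \<alpha>))"
proof -
  interpret prob_space G unfolding G_def using \<alpha> by (intro prob_space_PiM_gamma)
  have sets [measurable_cong]: "sets G = sets (PiM K (\<lambda>_. borel))"
    unfolding G_def by (intro sets_PiM_cong) auto
  have comp [measurable]: "(\<lambda>y. y m) \<in> borel_measurable G" if "m \<in> K" for m
    using measurable_component_singleton[OF that, of "\<lambda>_. borel"] by (simp add: measurable_cong_sets[OF sets refl])
  have pos: "AE y in G. \<forall>m\<in>K. 0 < y m" unfolding G_def
    using K \<alpha> by (intro AE_finite_allI AE_PiM_component prob_space_gamma_distribution AE_gamma_distribution_pos) auto
  define a where "a = \<alpha> * card K"
  define S where "S y = (\<Sum>k\<in>K. y k)" for y :: "int \<Rightarrow> real"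
  define R where "R y = (\<Sum>m\<in>K. s m * (y m / S y))" for y :: "int \<Rightarrow> real"
  have S' [measurable]: "S \<in> borel_measurable (PiM K (\<lambda>_. borel))"
    unfolding S_def by (intro borel_measurable_sum measurable_component_singleton)
  have R' [measurable]: "R \<in> borel_measurable (PiM K (\<lambda>_. borel))"
    unfolding R_def by (intro borel_measurable_sum borel_measurable_times borel_measurable_divide S'
        measurable_component_singleton borel_measurable_const)
  have Sm: "S \<in> borel_measurable G" and Rm: "R \<in> borel_measurable G" by measurable
  have S0: "AE y in G. 0 < S y" using pos by eventually_elim (use K in \<open>auto simp: S_def intro!: sum_pos\<close>)
  have R0: "AE y in G. 0 \<le> R y" using pos S0
    by eventually_elim (use s in \<open>auto simp: R_def less_imp_le intro!: sum_nonneg mult_nonneg_nonneg divide_nonneg_nonneg\<close>)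
  have homogeneous: "R (\<lambda>m\<in>K. y m / (1 + u)) = R y" if "0 \<le> u" for u y
  proof -
    have "S (\<lambda>m\<in>K. y m / (1 + u)) = S y / (1 + u)"
      by (simp add: S_def sum_divide_distrib)
    with that show ?thesis by (auto simp: R_def intro!: sum.cong)
  qed
  have tilt: "(\<integral>y. exp (- (u * S y)) * F (R y) \<partial>G) = (1 + u) powr (- a) * (\<integral>y. F (R y) \<partial>G)"
    if "0 \<le> u" and [measurable]: "F \<in> borel_measurable borel" for u and F :: "real \<Rightarrow> real"
  proof -
    have "(\<lambda>y. F (R y)) \<in> borel_measurable (PiM K (\<lambda>_. borel))" by measurable
    from tilted_gamma_vector_is_scaled[OF K(1) \<alpha> that(1) this] show ?thesis
      unfolding S_def a_def G_def by (simp only: homogeneous[OF that(1)])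
  qed
  have lapS: "(\<integral>y. exp (- (u * S y)) \<partial>G) = (1 + u) powr (- a)" if "0 \<le> u" for u
    using tilt[OF that, of "\<lambda>_. 1"] prob_space by simp
  have indep: "measure G ((S -` A \<inter> space G) \<inter> (R -` B \<inter> space G)) =
      measure G (S -` A \<inter> space G) * measure G (R -` B \<inter> space G)"
    if [measurable]: "A \<in> sets borel" "B \<in> sets borel" for A B
  proof -
    define p where "p = (\<integral>y. indicat_real B (R y) \<partial>G)"
    have ip: "p = measure G (R -` B \<inter> space G)"
      unfolding p_def using Rm by (subst Bochner_Integration.integral_cong[OF refl, of _ _ "indicat_real (R -` B \<inter> space G)"])
        (auto simp: indicator_def)
    have iA: "(\<integral>y. indicat_real A (S y) \<partial>G) = measure G (S -` A \<inter> space G)"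
      using Sm by (subst Bochner_Integration.integral_cong[OF refl, of _ _ "indicat_real (S -` A \<inter> space G)"])
        (auto simp: indicator_def)
    have S00: "AE y in G. 0 \<le> S y" using S0 by eventually_elim simp
    have p01: "0 \<le> p" "p \<le> 1" by (simp_all add: ip)
    have "(\<integral>y. indicat_real B (R y) * indicat_real A (S y) \<partial>G) = (\<integral>y. p * indicat_real A (S y) \<partial>G)"
    proof (rule laplace_determines_weighted_law)
      fix n :: nat
      show "(\<integral>y. indicat_real B (R y) * exp (- (real n * S y)) \<partial>G) = (\<integral>y. p * exp (- (real n * S y)) \<partial>G)"
        using tilt[of "real n" "indicat_real B"] lapS[of "real n"] by (simp add: p_def mult.commute)
    qed (use Sm Rm S00 p01 in \<open>auto intro: finite_measure_axioms\<close>)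
    then have "(\<integral>y. indicat_real B (R y) * indicat_real A (S y) \<partial>G) = p * measure G (S -` A \<inter> space G)"
      by (simp add: iA)
    moreover have "(\<integral>y. indicat_real B (R y) * indicat_real A (S y) \<partial>G) = measure G ((S -` A \<inter> space G) \<inter> (R -` B \<inter> space G))"
      using Sm Rm by (subst Bochner_Integration.integral_cong[OF refl, of _ _ "indicat_real ((S -` A \<inter> space G) \<inter> (R -` B \<inter> space G))"])
        (auto simp: indicator_def intro: measurable_sets)
    ultimately show ?thesis by (simp add: ip)
  qed
  have "(\<integral>y. (1 + R y) powr (- a) \<partial>G) = (\<integral>y. (\<integral>z. exp (- \<bar>S z * R y\<bar>) \<partial>G) \<partial>G)"
  proof (rule integral_cong_AE)
    show "AE y in G. (1 + R y) powr (- a) = (\<integral>z. exp (- \<bar>S z * R y\<bar>) \<partial>G)"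
      using R0
    proof eventually_elim
      case (elim y)
      have "AE z in G. exp (- \<bar>S z * R y\<bar>) = exp (- (R y * S z))"
        using S0 by eventually_elim (use elim in \<open>simp add: abs_mult mult.commute\<close>)
      then have "(\<integral>z. exp (- \<bar>S z * R y\<bar>) \<partial>G) = (\<integral>z. exp (- (R y * S z)) \<partial>G)"
        using Sm by (intro integral_cong_AE) auto
      then show ?case using lapS[OF elim] by simp
    qed
    show "(\<lambda>y. (1 + R y) powr (- a)) \<in> borel_measurable G"
      by (rule measurable_compose[OF Rm]) measurable
    show "(\<lambda>y. \<integral>z. exp (- \<bar>S z * R y\<bar>) \<partial>G) \<in> borel_measurable G"
    proof (rule borel_measurable_lebesgue_integral)
      have SR: "(\<lambda>p. S (snd p)) \<in> borel_measurable (G \<Otimes>\<^sub>M G)" "(\<lambda>p. R (fst p)) \<in> borel_measurable (G \<Otimes>\<^sub>M G)"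
        by (rule measurable_compose[OF measurable_snd Sm], rule measurable_compose[OF measurable_fst Rm])
      show "(\<lambda>(y, z). exp (- \<bar>S z * R y\<bar>)) \<in> borel_measurable (G \<Otimes>\<^sub>M G)"
        unfolding case_prod_unfold
        by (intro measurable_compose[OF _ borel_measurable_exp] borel_measurable_uminus borel_measurable_abs
            borel_measurable_times SR)
    qed
  qed
  also have "\<dots> = (\<integral>y. exp (- \<bar>S y * R y\<bar>) \<partial>G)"
  proof -
    let ?f = "\<lambda>(x, r). exp (- \<bar>x * r\<bar>) :: real"
    have "(\<integral>y. ?f (S y, R y) \<partial>G) = (\<integral>y. (\<integral>z. ?f (S z, R y) \<partial>G) \<partial>G)"
    proof (rule integral_of_independent[OF prob_space_axioms Sm Rm, where f = ?f and C = 1])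
      show "?f \<in> borel_measurable (borel \<Otimes>\<^sub>M borel)" by measurable
      show "\<bar>?f z\<bar> \<le> 1" for z by (auto simp: case_prod_unfold)
    qed (rule indep)
    then show ?thesis by simp
  qed
  also have "\<dots> = (\<integral>y. exp (- (\<Sum>m\<in>K. s m * y m)) \<partial>G)"
  proof (rule integral_cong_AE)
    show "AE y in G. exp (- \<bar>S y * R y\<bar>) = exp (- (\<Sum>m\<in>K. s m * y m))"
      using S0 R0
    proof eventually_elim
      case (elim y)
      have "S y * R y = (\<Sum>m\<in>K. s m * y m)"
        using elim(1) by (simp add: R_def sum_distrib_left)
      moreover have "0 \<le> S y * R y" using elim by simp
      ultimately show ?case by simp
    qed
    show "(\<lambda>y. exp (- \<bar>S y * R y\<bar>)) \<in> borel_measurable G"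
      by (intro measurable_compose[OF _ borel_measurable_exp] borel_measurable_uminus borel_measurable_abs
          borel_measurable_times Sm Rm)
    show "(\<lambda>y. exp (- (\<Sum>m\<in>K. s m * y m))) \<in> borel_measurable G"
      by (intro measurable_compose[OF _ borel_measurable_exp] borel_measurable_uminus borel_measurable_sum
          borel_measurable_times borel_measurable_const comp)
  qed
  also have "\<dots> = (\<Prod>m\<in>K. (1 + s m) powr (- \<alpha>))"
    unfolding G_def by (rule laplace_PiM_gamma) (use K \<alpha> s in auto)
  finally show ?thesis by (simp add: R_def S_def a_def)
qed

section \<open>Window equations for symmetric functions\<close>

lemma permutation_extending_bijection:
  assumes K: "finite K" and T: "T \<subseteq> K" "T' \<subseteq> K" and f: "bij_betw f T T'"
  obtains \<sigma> where "\<sigma> permutes K" "\<And>x. x \<in> T \<Longrightarrow> \<sigma> x = f x"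
proof -
  have "card T = card T'" by (rule bij_betw_same_card[OF f])
  then have "card (K - T) = card (K - T')"
    using K T by (simp add: card_Diff_subset finite_subset)
  then obtain g where g: "bij_betw g (K - T) (K - T')"
    using K by (metis finite_Diff finite_same_card_bij)
  define \<sigma> where "\<sigma> x = (if x \<in> T then f x else if x \<in> K then g x else x)" for x
  have "bij_betw \<sigma> T T'" using f by (rule bij_betw_cong[THEN iffD1, rotated]) (simp add: \<sigma>_def)
  moreover have "bij_betw \<sigma> (K - T) (K - T')" using g by (rule bij_betw_cong[THEN iffD1, rotated]) (simp add: \<sigma>_def)
  ultimately have "bij_betw \<sigma> (T \<union> (K - T)) (T' \<union> (K - T'))"
    by (rule bij_betw_combine) blast
  with T have "bij_betw \<sigma> K K" by (simp add: Un_absorb1)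
  then have "\<sigma> permutes K"
    using T by (intro bij_imp_permutes) (auto simp: \<sigma>_def)
  then show ?thesis by (rule that) (simp add: \<sigma>_def)
qed

text \<open>The combinatorial heart of the argument. Here \<open>L\<close> is the joint Laplace transform of the shares
  of one row, \<open>t\<close> is a finitely supported test sequence on the integers, and row \<open>i\<close> sees the values of
  \<open>t\<close> in the window \<open>i + K\<close>.

  For \<open>t\<close> with support \<open>T \<subseteq> K\<close>, each window contains either all of \<open>T\<close> or fewer points. By induction \<open>L\<close>
  factorizes on the latter; on the former it equals \<open>L t\<close> by symmetry, whatever the position of the
  window. Cancelling the factorized windows leaves an equation between powers of \<open>L t\<close> and of its
  proposed value, with the number of full windows as exponent. This number is positive since the
  window at \<open>0\<close> is full.\<close>

lemma window_equation_factorizes: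
  fixes L :: "(int \<Rightarrow> real) \<Rightarrow> real" and \<phi> h :: "real \<Rightarrow> real" and K :: "int set"
  assumes K: "finite K"
    and local: "\<And>s s'. (\<And>m. m \<in> K \<Longrightarrow> s m = s' m) \<Longrightarrow> L s = L s'"
    and symmetric: "\<And>s \<sigma>. (\<And>m. 0 \<le> s m) \<Longrightarrow> \<sigma> permutes K \<Longrightarrow> L (\<lambda>m. s (\<sigma> m)) = L s"
    and pos: "\<And>s. (\<And>m. 0 \<le> s m) \<Longrightarrow> 0 < L s"
    and one: "L (\<lambda>_. 0) = 1"
    and single: "\<And>m x. m \<in> K \<Longrightarrow> 0 \<le> x \<Longrightarrow> L (\<lambda>j. if j = m then x else 0) = h x"
    and windows: "\<And>T t. finite T \<Longrightarrow> (\<And>j. 0 \<le> t j) \<Longrightarrow> (\<And>j. j \<notin> T \<Longrightarrow> t j = 0) \<Longrightarrow>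
      (\<Prod>i\<in>(\<lambda>(j, m). j - m) ` (T \<times> K). L (\<lambda>m. t (i + m))) = (\<Prod>j\<in>T. \<phi> (t j))"
  shows "\<And>x. 0 \<le> x \<Longrightarrow> \<phi> x = h x ^ card K"
    and "\<And>s. (\<And>m. 0 \<le> s m) \<Longrightarrow> L s = (\<Prod>m\<in>K. h (s m))"
proof -
  show phi: "\<phi> x = h x ^ card K" if x: "0 \<le> x" for x
  proof -
    have I: "(\<lambda>(j, m). j - m) ` ({0} \<times> K) = uminus ` K" by force
    have "\<phi> x = (\<Prod>i\<in>uminus ` K. L (\<lambda>m. if i + m = 0 then x else 0))"
      using windows[of "{0}" "\<lambda>j. if j = 0 then x else 0"] x unfolding I by simp
    also have "\<dots> = (\<Prod>m\<in>K. L (\<lambda>j. if - m + j = 0 then x else 0))"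
      by (simp add: prod.reindex)
    also have "\<dots> = (\<Prod>m\<in>K. h x)"
    proof (rule prod.cong[OF refl])
      fix m assume m: "m \<in> K"
      have "(\<lambda>j. if - m + j = 0 then x else 0) = (\<lambda>j. if j = m then x else 0)" by auto
      then show "L (\<lambda>j. if - m + j = 0 then x else 0) = h x" using single[OF m x] by simp
    qed
    finally show ?thesis by simp
  qed
  have h: "0 < h x" if "0 \<le> x" "K \<noteq> {}" for x
  proof -
    from that obtain m where m: "m \<in> K" by blast
    have "0 < L (\<lambda>j. if j = m then x else 0)" using that by (intro pos) auto
    then show ?thesis using single[OF m that(1)] by simp
  qed
  have h0: "h 0 = 1" if "K \<noteq> {}"
  proof -
    from that obtain m where m: "m \<in> K" by blast
    then show ?thesis using single[OF m, of 0] one by simp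
  qed
  have factor: "T \<subseteq> K \<Longrightarrow> (\<And>j. 0 \<le> s j) \<Longrightarrow> (\<And>j. j \<notin> T \<Longrightarrow> s j = 0) \<Longrightarrow> L s = (\<Prod>j\<in>T. h (s j))" for T s
  proof (induction "card T" arbitrary: T s rule: less_induct)
    case (less T s)
    show ?case
    proof (cases "T = {}")
      case True
      then have "s = (\<lambda>_. 0)" using less.prems(3) by auto
      then show ?thesis using one True by simp
    next
      case False
      have T: "finite T" using less.prems(1) K by (rule finite_subset)
      have Kne: "K \<noteq> {}" using False less.prems(1) by auto
      define I where "I = (\<lambda>(j, m). j - m) ` (T \<times> K)"
      have I: "finite I" using T K by (simp add: I_def)
      \<comment> \<open>The points of \<open>T\<close> seen from row \<open>i\<close>; \<open>F\<close> collects the rows that see all of them.\<close>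
      define V where "V i = {j\<in>T. j - i \<in> K}" for i
      define F where "F = {i\<in>I. V i = T}"
      have F: "finite F" "F \<subseteq> I" using I by (auto simp: F_def)
      have "0 \<in> F"
      proof -
        from False obtain j where j: "j \<in> T" by blast
        have "(j, j) \<in> T \<times> K" using j less.prems(1) by auto
        then have "0 \<in> I" unfolding I_def by force
        with less.prems(1) show ?thesis by (auto simp: F_def V_def)
      qed
      then have cF: "card F > 0" using F by (auto simp: card_gt_0_iff)
      \<comment> \<open>A full window carries the values of \<open>s\<close> at shifted places; a permutation of \<open>K\<close> that extends the shift moves them back.\<close>
      have full: "L (\<lambda>m. s (i + m)) = L s" if "i \<in> F" for i
      proof -
        have sub: "(\<lambda>j. j - i) ` T \<subseteq> K" using that by (auto simp: F_def V_def)
        have "bij_betw (\<lambda>j. j - i) T ((\<lambda>j. j - i) ` T)" by (auto simp: bij_betw_def inj_on_def)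
        then obtain \<sigma> where \<sigma>: "\<sigma> permutes K" "\<And>j. j \<in> T \<Longrightarrow> \<sigma> j = j - i"
          using permutation_extending_bijection[OF K less.prems(1) sub] by metis
        have "L (\<lambda>m. s (i + m)) = L (\<lambda>m. s (i + \<sigma> m))"
          using symmetric[of "\<lambda>m. s (i + m)" \<sigma>] less.prems(2) \<sigma>(1) by simp
        also have "\<dots> = L s"
        proof (rule local)
          fix m assume "m \<in> K"
          show "s (i + \<sigma> m) = s m"
          proof (cases "m \<in> T")
            case True then show ?thesis by (simp add: \<sigma>)
          next
            case False
            have "i + \<sigma> m \<notin> T"
            proof
              assume *: "i + \<sigma> m \<in> T"
              then have "\<sigma> (i + \<sigma> m) = \<sigma> m" using \<sigma>(2) by simp
              then have "i + \<sigma> m = m" using permutes_inj[OF \<sigma>(1)] by (auto dest: injD)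
              with * False show False by simp
            qed
            then show ?thesis using less.prems(3) False by simp
          qed
        qed
        finally show ?thesis .
      qed
      have partial: "L (\<lambda>m. s (i + m)) = (\<Prod>j\<in>V i. h (s j))" if "i \<in> I - F" for i
      proof -
        let ?T = "(\<lambda>j. j - i) ` V i"
        have inj: "inj_on (\<lambda>j. j - i) (V i)" by (auto simp: inj_on_def)
        have "V i \<subset> T" using that by (auto simp: F_def V_def)
        then have c: "card ?T < card T" using T inj by (simp add: card_image psubset_card_mono)
        have "L (\<lambda>m. s (i + m)) = L (\<lambda>m. if m \<in> ?T then s (i + m) else 0)"
        proof (rule local)
          fix m assume m: "m \<in> K"
          show "s (i + m) = (if m \<in> ?T then s (i + m) else 0)"
          proof (cases "i + m \<in> T")
            case True
            then have "i + m \<in> V i" using m by (simp add: V_def)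
            then have "m \<in> ?T" by force
            then show ?thesis by simp
          qed (use less.prems(3) in auto)
        qed
        also have "\<dots> = (\<Prod>m\<in>?T. h (if m \<in> ?T then s (i + m) else 0))"
          by (rule less.hyps[OF c]) (use less.prems(2) in \<open>auto simp: V_def\<close>)
        also have "\<dots> = (\<Prod>m\<in>?T. h (s (i + m)))" by simp
        also have "\<dots> = (\<Prod>j\<in>V i. h (s j))" by (simp add: prod.reindex[OF inj])
        finally show ?thesis .
      qed
      define H where "H = (\<Prod>j\<in>T. h (s j))"
      define R where "R = (\<Prod>i\<in>I - F. \<Prod>j\<in>V i. h (s j))"
      have hs: "0 < h (s j)" for j using h less.prems(2) Kne by blast
      have R: "R \<noteq> 0" unfolding R_def using hs by (simp add: prod_zero_iff I T V_def less_imp_neq[THEN not_sym])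
      have "L s ^ card F * R = (\<Prod>i\<in>F. L (\<lambda>m. s (i + m))) * (\<Prod>i\<in>I - F. L (\<lambda>m. s (i + m)))"
        by (simp add: full partial R_def)
      also have "\<dots> = (\<Prod>i\<in>I. L (\<lambda>m. s (i + m)))"
        by (subst mult.commute) (rule prod.subset_diff[OF F(2) I, symmetric])
      also have "\<dots> = (\<Prod>j\<in>T. \<phi> (s j))"
        unfolding I_def by (rule windows) (use T less.prems in auto)
      also have "\<dots> = (\<Prod>j\<in>T. \<Prod>i\<in>I. if j - i \<in> K then h (s j) else 1)"
      proof (rule prod.cong[OF refl])
        fix j assume j: "j \<in> T"
        have "{i\<in>I. j - i \<in> K} = (\<lambda>m. j - m) ` K"
        proof (intro equalityI subsetI)
          fix i assume "i \<in> {i\<in>I. j - i \<in> K}"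
          then show "i \<in> (\<lambda>m. j - m) ` K" by (intro image_eqI[of _ _ "j - i"]) auto
        qed (use j in \<open>auto simp: I_def\<close>)
        then have "card {i\<in>I. j - i \<in> K} = card K"
          by (simp add: card_image inj_on_def)
        then have "\<phi> (s j) = (\<Prod>i\<in>{i\<in>I. j - i \<in> K}. h (s j))"
          using phi less.prems(2) by simp
        then show "\<phi> (s j) = (\<Prod>i\<in>I. if j - i \<in> K then h (s j) else 1)"
          by (simp only: prod.inter_filter[OF I])
      qed
      also have "\<dots> = (\<Prod>i\<in>I. \<Prod>j\<in>T. if j - i \<in> K then h (s j) else 1)"
        by (rule prod.swap)
      also have "\<dots> = (\<Prod>i\<in>I. \<Prod>j\<in>V i. h (s j))"
        using T by (simp add: V_def prod.inter_filter)
      also have "\<dots> = (\<Prod>i\<in>F. \<Prod>j\<in>V i. h (s j)) * R"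
        using prod.subset_diff[OF F(2) I, of "\<lambda>i. \<Prod>j\<in>V i. h (s j)"] by (simp add: R_def mult.commute)
      also have "(\<Prod>i\<in>F. \<Prod>j\<in>V i. h (s j)) = H ^ card F"
        by (simp add: F_def H_def)
      finally have "L s ^ card F = H ^ card F" using R by simp
      moreover have "0 \<le> L s" using pos less.prems(2) by (simp add: less_imp_le)
      moreover have "0 \<le> H" unfolding H_def using hs by (intro prod_nonneg) (auto simp: less_imp_le)
      ultimately show ?thesis unfolding H_def[symmetric] using cF by (rule power_eq_imp_eq_base)
    qed
  qed
  show "L s = (\<Prod>m\<in>K. h (s m))" if "\<And>m. 0 \<le> s m" for s
  proof -
    have "L s = L (\<lambda>m. if m \<in> K then s m else 0)" by (rule local) simp
    also have "\<dots> = (\<Prod>m\<in>K. h (if m \<in> K then s m else 0))"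
      by (rule factor) (use that in auto)
    finally show ?thesis by simp
  qed
qed

section \<open>A differential equation for Laplace transforms\<close>

text \<open>Differentiation relative to the half-line includes the endpoint \<open>0\<close>. The difference quotients
  of \<open>exp (- u X)\<close> are bounded by \<open>X\<close>, so \<open>Z X\<close> dominates.\<close>

lemma has_derivative_laplace:
  fixes X Z :: "'a \<Rightarrow> real"
  assumes [measurable]: "X \<in> borel_measurable M" "Z \<in> borel_measurable M"
    and X0: "AE \<omega> in M. 0 \<le> X \<omega>"
    and intZ: "integrable M Z" and intZX: "integrable M (\<lambda>\<omega>. Z \<omega> * X \<omega>)"
    and u: "0 \<le> u"
  shows "((\<lambda>u. \<integral>\<omega>. Z \<omega> * exp (- (u * X \<omega>)) \<partial>M) has_field_derivative
     - (\<integral>\<omega>. Z \<omega> * X \<omega> * exp (- (u * X \<omega>)) \<partial>M)) (at u within {0..})"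
  unfolding has_field_derivative_iff tendsto_at_iff_sequentially comp_def
proof (intro allI impI)
  fix V assume V: "\<forall>i. V i \<in> {0..} - {u}" and lim: "V \<longlonglongrightarrow> u"
  have int: "integrable M (\<lambda>\<omega>. Z \<omega> * exp (- (v * X \<omega>)))" if "0 \<le> v" for v
    by (rule Bochner_Integration.integrable_bound[OF intZ])
      (use X0 that in \<open>auto elim!: eventually_mono simp: abs_mult intro!: mult_left_le\<close>)
  have "(\<lambda>n. \<integral>\<omega>. Z \<omega> * ((exp (- (V n * X \<omega>)) - exp (- (u * X \<omega>))) / (V n - u)) \<partial>M)
      \<longlonglongrightarrow> (\<integral>\<omega>. Z \<omega> * (- X \<omega> * exp (- (u * X \<omega>))) \<partial>M)"
  proof (rule integral_dominated_convergence[where w = "\<lambda>\<omega>. \<bar>Z \<omega> * X \<omega>\<bar>"])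
    show "integrable M (\<lambda>\<omega>. \<bar>Z \<omega> * X \<omega>\<bar>)" using intZX by simp
    show "AE \<omega> in M. (\<lambda>n. Z \<omega> * ((exp (- (V n * X \<omega>)) - exp (- (u * X \<omega>))) / (V n - u)))
        \<longlonglongrightarrow> Z \<omega> * (- X \<omega> * exp (- (u * X \<omega>)))"
    proof (intro AE_I2 tendsto_mult tendsto_const)
      fix \<omega>
      have "((\<lambda>v. exp (- (v * X \<omega>))) has_field_derivative - X \<omega> * exp (- (u * X \<omega>))) (at u within {0..})"
        by (auto intro!: derivative_eq_intros)
      then show "(\<lambda>n. (exp (- (V n * X \<omega>)) - exp (- (u * X \<omega>))) / (V n - u)) \<longlonglongrightarrow> - X \<omega> * exp (- (u * X \<omega>))"
        unfolding has_field_derivative_iff tendsto_at_iff_sequentially comp_def using V lim by blast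
    qed
    show "AE \<omega> in M. norm (Z \<omega> * ((exp (- (V n * X \<omega>)) - exp (- (u * X \<omega>))) / (V n - u))) \<le> \<bar>Z \<omega> * X \<omega>\<bar>" for n
      using X0
    proof eventually_elim
      case (elim \<omega>)
      have lip: "exp (- a) - exp (- b) \<le> b - a" if "0 \<le> a" "a \<le> b" for a b :: real
      proof -
        have e: "1 - exp (- (b - a)) \<le> b - a"
          using exp_ge_add_one_self[of "- (b - a)"] by linarith
        have "exp (- a) - exp (- b) = exp (- a) * (1 - exp (- (b - a)))"
          by (simp add: algebra_simps exp_add[symmetric])
        also have "\<dots> \<le> 1 * (1 - exp (- (b - a)))"
          using that by (intro mult_right_mono) auto
        also have "\<dots> \<le> b - a" using e by (simp only: mult_1)
        finally show ?thesis .
      qed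
      have "\<bar>exp (- (V n * X \<omega>)) - exp (- (u * X \<omega>))\<bar> \<le> \<bar>V n - u\<bar> * X \<omega>"
      proof (cases "V n \<le> u")
        case True
        then have "V n * X \<omega> \<le> u * X \<omega>" using elim by (rule mult_right_mono)
        with lip[of "V n * X \<omega>" "u * X \<omega>"] V elim True show ?thesis by (auto simp: algebra_simps)
      next
        case False
        then have "u * X \<omega> \<le> V n * X \<omega>" using elim by (intro mult_right_mono) auto
        with lip[of "u * X \<omega>" "V n * X \<omega>"] u elim False show ?thesis by (auto simp: algebra_simps)
      qed
      moreover have "\<bar>V n - u\<bar> > 0" using V by auto
      ultimately have "\<bar>(exp (- (V n * X \<omega>)) - exp (- (u * X \<omega>))) / (V n - u)\<bar> \<le> X \<omega>"
        by (simp add: abs_divide divide_le_eq mult.commute)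
      then have "\<bar>Z \<omega>\<bar> * \<bar>(exp (- (V n * X \<omega>)) - exp (- (u * X \<omega>))) / (V n - u)\<bar> \<le> \<bar>Z \<omega>\<bar> * X \<omega>"
        by (rule mult_left_mono) simp
      then show ?case using elim by (simp only: real_norm_def abs_mult abs_of_nonneg)
    qed
  qed auto
  also have "(\<lambda>n. \<integral>\<omega>. Z \<omega> * ((exp (- (V n * X \<omega>)) - exp (- (u * X \<omega>))) / (V n - u)) \<partial>M) =
    (\<lambda>n. ((\<integral>\<omega>. Z \<omega> * exp (- (V n * X \<omega>)) \<partial>M) - (\<integral>\<omega>. Z \<omega> * exp (- (u * X \<omega>)) \<partial>M)) / (V n - u))"
  proof
    fix n
    have "(\<integral>\<omega>. Z \<omega> * exp (- (V n * X \<omega>)) \<partial>M) - (\<integral>\<omega>. Z \<omega> * exp (- (u * X \<omega>)) \<partial>M) =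
      (\<integral>\<omega>. Z \<omega> * exp (- (V n * X \<omega>)) - Z \<omega> * exp (- (u * X \<omega>)) \<partial>M)"
      using V u by (intro Bochner_Integration.integral_diff[symmetric] int) auto
    then show "(\<integral>\<omega>. Z \<omega> * ((exp (- (V n * X \<omega>)) - exp (- (u * X \<omega>))) / (V n - u)) \<partial>M) =
      ((\<integral>\<omega>. Z \<omega> * exp (- (V n * X \<omega>)) \<partial>M) - (\<integral>\<omega>. Z \<omega> * exp (- (u * X \<omega>)) \<partial>M)) / (V n - u)"
      by (simp add: right_diff_distrib)
  qed
  finally show "(\<lambda>n. ((\<integral>\<omega>. Z \<omega> * exp (- (V n * X \<omega>)) \<partial>M) - (\<integral>\<omega>. Z \<omega> * exp (- (u * X \<omega>)) \<partial>M)) / (V n - u))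
      \<longlonglongrightarrow> - (\<integral>\<omega>. Z \<omega> * X \<omega> * exp (- (u * X \<omega>)) \<partial>M)"
    by (simp add: mult.assoc)
qed

text \<open>With \<open>B = - h'\<close> and \<open>C = h''\<close> the equation \<open>h h'' = (1 + \<beta>) h'\<^sup>2\<close> says that \<open>h / B\<close> has the
  constant derivative \<open>\<beta>\<close>. Thus \<open>h / B = c + \<beta> u\<close>, and integrating \<open>h' / h = - 1 / (c + \<beta> u)\<close> gives the
  Laplace transform of a Gamma law of shape \<open>1 / \<beta>\<close> and rate \<open>c / \<beta>\<close>.\<close>

lemma gamma_laplace_of_ode:
  fixes h B C :: "real \<Rightarrow> real"
  assumes h: "\<And>u. 0 \<le> u \<Longrightarrow> (h has_field_derivative - B u) (at u within {0..})"
    and B: "\<And>u. 0 \<le> u \<Longrightarrow> (B has_field_derivative - C u) (at u within {0..})"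
    and Bpos: "\<And>u. 0 \<le> u \<Longrightarrow> 0 < B u"
    and h0: "h 0 = 1" and \<beta>: "0 < \<beta>"
    and ode: "\<And>u. 0 \<le> u \<Longrightarrow> h u * C u = (1 + \<beta>) * (B u)\<^sup>2"
  obtains \<alpha> \<gamma> where "0 < \<alpha>" "0 < \<gamma>" "\<And>u. 0 \<le> u \<Longrightarrow> h u = (1 + u / \<gamma>) powr (- \<alpha>)"
proof -
  define c where "c = 1 / B 0"
  have c: "0 < c" using Bpos[of 0] by (simp add: c_def)
  have "\<exists>k. \<forall>u\<in>{0..}. h u / B u - \<beta> * u = k"
  proof (rule has_field_derivative_zero_constant)
    fix u :: real assume "u \<in> {0..}"
    then have u: "0 \<le> u" by simp
    have "((\<lambda>u. h u / B u - \<beta> * u) has_field_derivative (- B u * B u - h u * (- C u)) / (B u * B u) - \<beta>) (at u within {0..})"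
      using Bpos[OF u] by (auto intro!: derivative_eq_intros h B u)
    moreover have "(- B u * B u - h u * (- C u)) / (B u * B u) - \<beta> = 0"
      using ode[OF u] Bpos[OF u] by (simp add: divide_simps power2_eq_square algebra_simps)
    ultimately show "((\<lambda>u. h u / B u - \<beta> * u) has_field_derivative 0) (at u within {0..})" by simp
  qed simp
  then have lin: "h u / B u - \<beta> * u = c" if "0 \<le> u" for u
    using that h0 unfolding c_def by (metis atLeast_iff diff_zero mult_zero_right order_refl)
  then have hB: "h u = B u * (c + \<beta> * u)" if "0 \<le> u" for u
  proof -
    have "h u / B u = c + \<beta> * u" using lin[OF that] by simp
    then show ?thesis using Bpos[OF that] by (simp add: nonzero_divide_eq_eq mult.commute)
  qed
  have cpos: "0 < c + \<beta> * u" if "0 \<le> u" for u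
    using c \<beta> that by (intro add_pos_nonneg) auto
  have "\<exists>k. \<forall>u\<in>{0..}. h u * (c + \<beta> * u) powr (1 / \<beta>) = k"
  proof (rule has_field_derivative_zero_constant)
    fix u :: real assume "u \<in> {0..}"
    then have u: "0 \<le> u" by simp
    have p: "((\<lambda>u. (c + \<beta> * u) powr (1 / \<beta>)) has_field_derivative 1 / \<beta> * (c + \<beta> * u) powr (1 / \<beta> - 1) * \<beta>) (at u within {0..})"
      using cpos[OF u] by (auto intro!: derivative_eq_intros simp: powr_diff)
    have "((\<lambda>u. h u * (c + \<beta> * u) powr (1 / \<beta>)) has_field_derivative
       - B u * (c + \<beta> * u) powr (1 / \<beta>) + (1 / \<beta> * (c + \<beta> * u) powr (1 / \<beta> - 1) * \<beta>) * h u) (at u within {0..})"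
      by (rule DERIV_mult[OF h[OF u] p])
    moreover have "- B u * (c + \<beta> * u) powr (1 / \<beta>) + (1 / \<beta> * (c + \<beta> * u) powr (1 / \<beta> - 1) * \<beta>) * h u = 0"
      using cpos[OF u] \<beta> by (simp add: hB[OF u] powr_diff)
    ultimately show "((\<lambda>u. h u * (c + \<beta> * u) powr (1 / \<beta>)) has_field_derivative 0) (at u within {0..})" by simp
  qed simp
  then have k: "h u * (c + \<beta> * u) powr (1 / \<beta>) = c powr (1 / \<beta>)" if "0 \<le> u" for u
    using that h0 by (metis add.right_neutral atLeast_iff mult_1 mult_zero_right order_refl)
  show ?thesis
  proof (rule that[of "1 / \<beta>" "c / \<beta>"])
    fix u :: real assume u: "0 \<le> u"
    have "1 + u / (c / \<beta>) = (c + \<beta> * u) / c" using c by (simp add: field_simps)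
    then have "(1 + u / (c / \<beta>)) powr (- (1 / \<beta>)) = c powr (1 / \<beta>) / (c + \<beta> * u) powr (1 / \<beta>)"
      using c cpos[OF u] by (simp add: powr_divide powr_minus)
    also have "\<dots> = h u"
      using k[OF u] cpos[OF u] by (simp add: field_simps)
    finally show "h u = (1 + u / (c / \<beta>)) powr (- (1 / \<beta>))" by simp
  qed (use c \<beta> in auto)
qed

section \<open>Splitting a random size in exchangeable proportions\<close>

lemma prod_two_exceptions:
  fixes a b c :: "'b::comm_monoid_mult"
  assumes "finite K" "p \<in> K" "q \<in> K" "p \<noteq> q"
  shows "(\<Prod>m\<in>K. if m = p then a else if m = q then b else c) = a * b * c ^ (card K - 2)"
proof -
  have "(\<Prod>m\<in>K. if m = p then a else if m = q then b else c) =
      a * (b * (\<Prod>m\<in>K - {p} - {q}. if m = p then a else if m = q then b else c))"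
    using assms by (subst prod.remove[of _ p], simp, simp, subst prod.remove[of _ q]) auto
  also have "(\<Prod>m\<in>K - {p} - {q}. if m = p then a else if m = q then b else c) = (\<Prod>m\<in>K - {p} - {q}. c)"
    by (intro prod.cong) auto
  also have "\<dots> = c ^ (card K - 2)"
    using assms by (simp add: numeral_2_eq_2)
  finally show ?thesis by (simp add: mult.assoc)
qed

text \<open>A size \<open>\<tau>\<close> and proportions \<open>\<pi>\<close> on separate probability spaces; on the product space they are
  independent, and the size is split into the shares \<open>\<tau> \<pi>\<^sub>m\<close>. This is the mechanism of one row of the
  matrix.\<close>

locale random_split =
  size: prob_space M + proportions: prob_space N
  for M :: "'a measure" and N :: "'b measure" +
  fixes \<tau> :: "'a \<Rightarrow> real" and \<pi> :: "int \<Rightarrow> 'b \<Rightarrow> real" and K :: "int set"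
  assumes \<tau>_measurable [measurable]: "\<tau> \<in> borel_measurable M"
    and \<tau>_nonneg: "AE \<omega> in M. 0 \<le> \<tau> \<omega>"
    and \<tau>_integrable: "integrable M \<tau>" and \<tau>_square_integrable: "integrable M (\<lambda>\<omega>. (\<tau> \<omega>)\<^sup>2)"
    and \<pi>_measurable [measurable]: "\<And>m. \<pi> m \<in> borel_measurable N"
    and finite_K: "finite K"
    and \<pi>_nonneg: "AE \<omega> in N. \<forall>m\<in>K. 0 \<le> \<pi> m \<omega>"
    and \<pi>_sum: "AE \<omega> in N. (\<Sum>m\<in>K. \<pi> m \<omega>) = 1"
    and \<pi>_exchangeable: "exchangeable N K \<pi>"
begin

sublocale pair: pair_prob_space M N ..

definition size_laplace :: "real \<Rightarrow> real" where
  "size_laplace u = (\<integral>\<omega>. exp (- (u * \<tau> \<omega>)) \<partial>M)"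

text \<open>The joint Laplace transform of the shares, written with the size already integrated out.\<close>

definition joint_laplace :: "(int \<Rightarrow> real) \<Rightarrow> real" where
  "joint_laplace s = (\<integral>\<omega>. size_laplace (\<Sum>m\<in>K. s m * \<pi> m \<omega>) \<partial>N)"

definition share :: "int \<Rightarrow> 'a \<times> 'b \<Rightarrow> real" where
  "share m z = \<tau> (fst z) * \<pi> m (snd z)"

lemma share_measurable [measurable]: "share m \<in> borel_measurable (M \<Otimes>\<^sub>M N)"
  unfolding share_def by measurable

lemma K_nonempty: "K \<noteq> {}"
proof
  assume "K = {}"
  then have "AE \<omega> in N. False" using \<pi>_sum by simp
  then show False using proportions.AE_False by simp
qed

lemma AE_size_and_proportions: "AE z in M \<Otimes>\<^sub>M N. 0 \<le> \<tau> (fst z) \<and> (\<forall>m\<in>K. 0 \<le> \<pi> m (snd z)) \<and> (\<Sum>m\<in>K. \<pi> m (snd z)) = 1"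
proof (rule pair.AE_pair_measure)
  show "{z \<in> space (M \<Otimes>\<^sub>M N). 0 \<le> \<tau> (fst z) \<and> (\<forall>m\<in>K. 0 \<le> \<pi> m (snd z)) \<and> (\<Sum>m\<in>K. \<pi> m (snd z)) = 1} \<in> sets (M \<Otimes>\<^sub>M N)"
    using finite_K by measurable
  show "AE x in M. AE y in N. 0 \<le> \<tau> (fst (x, y)) \<and> (\<forall>m\<in>K. 0 \<le> \<pi> m (snd (x, y))) \<and> (\<Sum>m\<in>K. \<pi> m (snd (x, y))) = 1"
    using \<tau>_nonneg by eventually_elim (use \<pi>_nonneg \<pi>_sum in \<open>auto elim: eventually_elim2\<close>)
qed

lemma AE_shares: "AE z in M \<Otimes>\<^sub>M N. (\<forall>m\<in>K. 0 \<le> share m z \<and> share m z \<le> \<tau> (fst z)) \<and> (\<Sum>m\<in>K. share m z) = \<tau> (fst z)"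
  using AE_size_and_proportions
proof eventually_elim
  case (elim z)
  have "\<pi> m (snd z) \<le> 1" if "m \<in> K" for m
    using elim member_le_sum[OF that, of "\<lambda>m. \<pi> m (snd z)"] finite_K by auto
  then show ?case using elim by (auto simp: share_def sum_distrib_left[symmetric] mult_left_le)
qed

lemma \<pi>_le_1: "m \<in> K \<Longrightarrow> AE \<omega> in N. \<pi> m \<omega> \<le> 1"
  using \<pi>_nonneg \<pi>_sum
proof eventually_elim
  case (elim \<omega>)
  then show ?case using member_le_sum[of m K "\<lambda>m. \<pi> m \<omega>"] finite_K by auto
qed

lemma size_laplace_measurable [measurable]: "size_laplace \<in> borel_measurable borel"
proof -
  have "(\<lambda>u. \<integral>\<omega>. exp (- (u * \<tau> \<omega>)) \<partial>M) \<in> borel_measurable borel"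
    by (rule size.borel_measurable_lebesgue_integral) measurable
  then show ?thesis unfolding size_laplace_def [abs_def] .
qed

lemma size_laplace_integrable: "0 \<le> u \<Longrightarrow> integrable M (\<lambda>\<omega>. exp (- (u * \<tau> \<omega>)))"
  using \<tau>_nonneg by (intro size.integrable_const_bound[of _ 1]) (auto elim!: eventually_mono)

lemma size_laplace_0 [simp]: "size_laplace 0 = 1"
  by (simp add: size_laplace_def size.prob_space)

lemma size_laplace_le_1: "0 \<le> u \<Longrightarrow> size_laplace u \<le> 1"
proof -
  assume u: "0 \<le> u"
  have "size_laplace u \<le> (\<integral>\<omega>. 1 \<partial>M)" unfolding size_laplace_def
    using \<tau>_nonneg u by (intro integral_mono_AE size_laplace_integrable) (auto elim!: eventually_mono)
  then show ?thesis by (simp add: size.prob_space)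
qed

lemma size_laplace_pos: "0 \<le> u \<Longrightarrow> 0 < size_laplace u"
proof -
  assume u: "0 \<le> u"
  have "0 \<le> size_laplace u" unfolding size_laplace_def by (rule integral_nonneg_AE) simp
  moreover have "size_laplace u \<noteq> 0"
  proof
    assume "size_laplace u = 0"
    then have "AE \<omega> in M. exp (- (u * \<tau> \<omega>)) = 0"
      using integral_nonneg_eq_0_iff_AE[OF size_laplace_integrable[OF u]] by (simp add: size_laplace_def)
    then show False using size.AE_False by simp
  qed
  ultimately show ?thesis by simp
qed

lemma AE_weights_nonneg: "(\<And>m. 0 \<le> s m) \<Longrightarrow> AE \<omega> in N. 0 \<le> (\<Sum>m\<in>K. s m * \<pi> m \<omega>)"
  using \<pi>_nonneg by (auto elim!: eventually_mono intro!: sum_nonneg)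

lemma joint_laplace_integrable:
  "(\<And>m. 0 \<le> s m) \<Longrightarrow> integrable N (\<lambda>\<omega>. size_laplace (\<Sum>m\<in>K. s m * \<pi> m \<omega>))"
  using AE_weights_nonneg[of s]
  by (intro proportions.integrable_const_bound[of _ 1])
     (auto elim!: eventually_mono simp: size_laplace_le_1 less_imp_le[OF size_laplace_pos])

lemma joint_laplace_pos: "(\<And>m. 0 \<le> s m) \<Longrightarrow> 0 < joint_laplace s"
proof -
  assume s: "\<And>m. 0 \<le> s m"
  have nn: "AE \<omega> in N. 0 < size_laplace (\<Sum>m\<in>K. s m * \<pi> m \<omega>)"
    using AE_weights_nonneg[OF s] by eventually_elim (rule size_laplace_pos)
  then have "0 \<le> joint_laplace s" unfolding joint_laplace_def
    by (intro integral_nonneg_AE) (auto elim!: eventually_mono)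
  moreover have "joint_laplace s \<noteq> 0"
  proof
    assume "joint_laplace s = 0"
    moreover have "AE \<omega> in N. 0 \<le> size_laplace (\<Sum>m\<in>K. s m * \<pi> m \<omega>)"
      using nn by eventually_elim simp
    ultimately have "AE \<omega> in N. size_laplace (\<Sum>m\<in>K. s m * \<pi> m \<omega>) = 0"
      using integral_nonneg_eq_0_iff_AE[OF joint_laplace_integrable, of s] s by (simp add: joint_laplace_def)
    with nn have "AE \<omega> in N. False" by eventually_elim simp
    then show False using proportions.AE_False by simp
  qed
  ultimately show ?thesis by simp
qed

lemma joint_laplace_permute:
  assumes \<sigma>: "\<sigma> permutes K"
  shows "joint_laplace (\<lambda>m. s (\<sigma> m)) = joint_laplace s"
proof -
  have \<rho>: "inv \<sigma> permutes K" by (rule permutes_inv[OF \<sigma>])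
  define f where "f y = size_laplace (\<Sum>m\<in>K. s m * y m)" for y :: "int \<Rightarrow> real"
  have f: "f \<in> borel_measurable (PiM K (\<lambda>_. borel))" unfolding f_def
    by (intro measurable_compose[OF _ size_laplace_measurable] borel_measurable_sum borel_measurable_times
        borel_measurable_const measurable_component_singleton)
  have law: "(\<integral>y. f y \<partial>vector_law N K X) = (\<integral>\<omega>. f (\<lambda>m. X m \<omega>) \<partial>N)"
    if "\<And>m. X m \<in> borel_measurable N" for X
    unfolding vector_law_def using f that
    by (subst integral_distr) (auto intro!: measurable_restrict simp: f_def)
  have "joint_laplace (\<lambda>m. s (\<sigma> m)) = (\<integral>\<omega>. f (\<lambda>m. \<pi> (inv \<sigma> m) \<omega>) \<partial>N)"
    unfolding joint_laplace_def f_def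
  proof (intro Bochner_Integration.integral_cong refl arg_cong[where f = size_laplace])
    fix \<omega>
    show "(\<Sum>m\<in>K. s (\<sigma> m) * \<pi> m \<omega>) = (\<Sum>m\<in>K. s m * \<pi> (inv \<sigma> m) \<omega>)"
      by (subst sum.permute[OF \<rho>]) (simp add: permutes_inverses[OF \<sigma>])
  qed
  also have "\<dots> = (\<integral>y. f y \<partial>vector_law N K (\<lambda>m. \<pi> (inv \<sigma> m)))" by (subst law) auto
  also have "vector_law N K (\<lambda>m. \<pi> (inv \<sigma> m)) = vector_law N K \<pi>"
    using \<pi>_exchangeable \<rho> by (auto simp: exchangeable_def)
  also have "(\<integral>y. f y \<partial>\<dots>) = joint_laplace s" by (subst law) (simp_all add: f_def joint_laplace_def)
  finally show ?thesis .
qed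

lemma joint_laplace_single:
  assumes m: "m \<in> K" "m' \<in> K"
  shows "joint_laplace (\<lambda>j. if j = m then x else 0) = joint_laplace (\<lambda>j. if j = m' then x else 0)"
proof -
  have "(\<lambda>j. if Transposition.transpose m m' j = m' then x else 0) = (\<lambda>j. if j = m then x else 0)"
    by (auto simp: Transposition.transpose_def)
  then show ?thesis
    using joint_laplace_permute[OF permutes_swap_id[OF m], of "\<lambda>j. if j = m' then x else 0"] by simp
qed

lemma joint_laplace_eq:
  assumes s: "\<And>m. 0 \<le> s m"
  shows "(\<integral>z. exp (- (\<Sum>m\<in>K. s m * share m z)) \<partial>(M \<Otimes>\<^sub>M N)) = joint_laplace s"
proof -
  have "integrable (M \<Otimes>\<^sub>M N) (\<lambda>z. exp (- (\<Sum>m\<in>K. s m * share m z)))"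
    by (rule pair.integrable_const_bound[of _ 1])
      (use AE_shares s in \<open>auto elim!: eventually_mono intro!: sum_nonneg mult_nonneg_nonneg\<close>)
  then have "(\<integral>z. exp (- (\<Sum>m\<in>K. s m * share m z)) \<partial>(M \<Otimes>\<^sub>M N)) =
     (\<integral>y. (\<integral>x. exp (- (\<Sum>m\<in>K. s m * share m (x, y))) \<partial>M) \<partial>N)"
    using pair.integral_snd[of "\<lambda>x y. exp (- (\<Sum>m\<in>K. s m * share m (x, y)))"]
    by (simp add: case_prod_unfold)
  also have "\<dots> = joint_laplace s"
    unfolding joint_laplace_def size_laplace_def
    by (intro Bochner_Integration.integral_cong refl) (simp add: share_def sum_distrib_left mult_ac)
  finally show ?thesis .
qed

lemma product_expectation:
  assumes f: "integrable M f" and g: "integrable N g"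
  shows "integrable (M \<Otimes>\<^sub>M N) (\<lambda>z. f (fst z) * g (snd z) :: real)"
    and "(\<integral>z. f (fst z) * g (snd z) \<partial>(M \<Otimes>\<^sub>M N)) = (\<integral>x. f x \<partial>M) * (\<integral>y. g y \<partial>N)"
proof -
  have [measurable]: "f \<in> borel_measurable M" "g \<in> borel_measurable N" using f g by auto
  show int: "integrable (M \<Otimes>\<^sub>M N) (\<lambda>z. f (fst z) * g (snd z))"
    by (rule pair.Fubini_integrable) (use f g in \<open>auto simp: abs_mult\<close>)
  then show "(\<integral>z. f (fst z) * g (snd z) \<partial>(M \<Otimes>\<^sub>M N)) = (\<integral>x. f x \<partial>M) * (\<integral>y. g y \<partial>N)"
    using pair.integral_fst'[OF int] by simp
qed

lemma AE_\<pi>_le_1: "AE \<omega> in N. \<forall>m\<in>K. 0 \<le> \<pi> m \<omega> \<and> \<pi> m \<omega> \<le> 1"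
proof -
  have "AE \<omega> in N. \<forall>m\<in>K. \<pi> m \<omega> \<le> 1" using finite_K by (intro AE_finite_allI \<pi>_le_1)
  with \<pi>_nonneg show ?thesis by eventually_elim auto
qed

lemma \<tau>_power_integrable: "n \<le> 2 \<Longrightarrow> integrable M (\<lambda>\<omega>. \<tau> \<omega> ^ n)"
  using \<tau>_integrable \<tau>_square_integrable by (auto simp: le_Suc_eq numeral_2_eq_2)

lemma \<pi>_monomial_integrable: "integrable N (\<lambda>\<omega>. \<Prod>m\<in>K. \<pi> m \<omega> ^ e m)"
proof (rule proportions.integrable_const_bound[of _ 1])
  show "AE \<omega> in N. norm (\<Prod>m\<in>K. \<pi> m \<omega> ^ e m) \<le> 1"
    using AE_\<pi>_le_1 by eventually_elim (auto simp: abs_prod power_abs intro!: prod_le_1 power_le_one)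
qed measurable

end

text \<open>The shares of the size are independent, expressed through their joint Laplace transform \<open>joint_laplace\<close>
  and the Laplace transform \<open>h\<close> of a single share.\<close>

locale factored_split = random_split +
  fixes h :: "real \<Rightarrow> real"
  assumes single: "\<And>m x. m \<in> K \<Longrightarrow> 0 \<le> x \<Longrightarrow> joint_laplace (\<lambda>j. if j = m then x else 0) = h x"
    and factor: "\<And>s. (\<And>m. 0 \<le> s m) \<Longrightarrow> joint_laplace s = (\<Prod>m\<in>K. h (s m))"
begin

lemma share_laplace:
  assumes m: "m \<in> K" and x: "0 \<le> x"
  shows "(\<integral>z. exp (- (x * share m z)) \<partial>(M \<Otimes>\<^sub>M N)) = h x"
proof -
  have sum1: "(\<Sum>j\<in>K. (if j = m then x else 0) * share j z) = x * share m z" for z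
    using finite_K m by (subst sum.remove[OF finite_K m]) auto
  show ?thesis
    using joint_laplace_eq[of "\<lambda>j. if j = m then x else 0"] single[OF m x] x by (simp add: sum1)
qed

lemma share_nonneg: "m \<in> K \<Longrightarrow> AE z in M \<Otimes>\<^sub>M N. 0 \<le> share m z"
  using AE_shares by (auto elim: eventually_mono)

lemma shares_same_law: "m \<in> K \<Longrightarrow> m' \<in> K \<Longrightarrow>
  distr (M \<Otimes>\<^sub>M N) borel (share m) = distr (M \<Otimes>\<^sub>M N) borel (share m')"
  by (rule laplace_determines_distr) (simp_all add: share_nonneg share_laplace pair.prob_space_axioms)

lemma shares_independent: "pair.indep_vars (\<lambda>_. borel) share K"
proof (subst pair.indep_vars_iff_distr_eq_PiM'[OF K_nonempty])
  have "vector_law (M \<Otimes>\<^sub>M N) K share = PiM K (\<lambda>m. distr (M \<Otimes>\<^sub>M N) borel (share m))"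
  proof (rule vector_law_eq_PiM_of_laplace[OF pair.prob_space_axioms finite_K])
    fix m assume m: "m \<in> K"
    show "prob_space (distr (M \<Otimes>\<^sub>M N) borel (share m))" by (rule pair.prob_space_distr) simp
    show "AE x in distr (M \<Otimes>\<^sub>M N) borel (share m). 0 \<le> x"
      by (subst AE_distr_iff) (auto simp: share_nonneg m)
  next
    fix t assume t: "\<And>m::int. 0 \<le> (t m :: real)"
    show "(\<integral>z. exp (- (\<Sum>m\<in>K. t m * share m z)) \<partial>(M \<Otimes>\<^sub>M N)) =
        (\<Prod>m\<in>K. \<integral>x. exp (- (t m * x)) \<partial>distr (M \<Otimes>\<^sub>M N) borel (share m))"
      by (simp add: joint_laplace_eq t factor integral_distr share_laplace cong: prod.cong)
  qed (simp_all add: share_nonneg)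
  then show "distr (M \<Otimes>\<^sub>M N) (Pi\<^sub>M K (\<lambda>_. borel)) (\<lambda>z. \<lambda>m\<in>K. share m z) = PiM K (\<lambda>m. distr (M \<Otimes>\<^sub>M N) borel (share m))"
    by (simp add: vector_law_def)
qed simp

definition share_moment :: "int \<Rightarrow> nat \<Rightarrow> real \<Rightarrow> real" where
  "share_moment m n u = (\<integral>z. share m z ^ n * exp (- (u * share m z)) \<partial>(M \<Otimes>\<^sub>M N))"

lemma \<tau>_fst_power_integrable: "n \<le> 2 \<Longrightarrow> integrable (M \<Otimes>\<^sub>M N) (\<lambda>z. \<tau> (fst z) ^ n)"
  using product_expectation(1)[OF \<tau>_power_integrable, of n "\<lambda>_. 1"] by simp

lemma share_power_integrable:
  assumes m: "m \<in> K" and n: "n \<le> 2" and u: "0 \<le> u"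
  shows "integrable (M \<Otimes>\<^sub>M N) (\<lambda>z. share m z ^ n * exp (- (u * share m z)))"
proof (rule Bochner_Integration.integrable_bound[OF \<tau>_fst_power_integrable[OF n]])
  show "AE z in M \<Otimes>\<^sub>M N. norm (share m z ^ n * exp (- (u * share m z))) \<le> norm (\<tau> (fst z) ^ n)"
    using AE_shares
  proof eventually_elim
    case (elim z)
    then have p: "0 \<le> share m z" "share m z \<le> \<tau> (fst z)" using m by auto
    then have "share m z ^ n * exp (- (u * share m z)) \<le> \<tau> (fst z) ^ n * 1"
      using u by (intro mult_mono power_mono) auto
    then show ?case using p by (simp add: abs_mult)
  qed
qed measurable

lemma share_moment_indep_of_index: "m \<in> K \<Longrightarrow> m' \<in> K \<Longrightarrow> share_moment m n u = share_moment m' n u"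
proof -
  assume "m \<in> K" "m' \<in> K"
  have eq: "share_moment m n u = (\<integral>x. x ^ n * exp (- (u * x)) \<partial>distr (M \<Otimes>\<^sub>M N) borel (share m))" for m
    unfolding share_moment_def by (subst integral_distr) auto
  show ?thesis unfolding eq by (simp add: shares_same_law[OF \<open>m \<in> K\<close> \<open>m' \<in> K\<close>])
qed

lemma share_moment_0: "m \<in> K \<Longrightarrow> 0 \<le> u \<Longrightarrow> share_moment m 0 u = h u"
  by (simp add: share_moment_def share_laplace)

lemma share_moment_derivative:
  assumes m: "m \<in> K" and n: "n \<le> 1" and u: "0 \<le> u"
  shows "(share_moment m n has_field_derivative - share_moment m (Suc n) u) (at u within {0..})"
proof -
  have "integrable (M \<Otimes>\<^sub>M N) (\<lambda>z. share m z ^ n)" "integrable (M \<Otimes>\<^sub>M N) (\<lambda>z. share m z ^ n * share m z)"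
    using share_power_integrable[OF m, of n 0] share_power_integrable[OF m, of "Suc n" 0] n
    by (simp_all add: mult.commute)
  from has_derivative_laplace[OF _ _ share_nonneg[OF m] this u]
  show ?thesis by (simp add: share_moment_def[abs_def] mult_ac)
qed

text \<open>The source of all information about the laws: the left-hand side uses the independence of size
  and proportions, the right-hand side the independence of the shares, whose sum is the size. The
  exponential factor, a tilt by the size, is compatible with both.\<close>

lemma moment_identity:
  assumes e: "(\<Sum>m\<in>K. e m) = n" "n \<le> 2" and u: "0 \<le> u"
  shows "(\<integral>\<omega>. \<tau> \<omega> ^ n * exp (- (u * \<tau> \<omega>)) \<partial>M) * (\<integral>\<omega>. (\<Prod>m\<in>K. \<pi> m \<omega> ^ e m) \<partial>N) =
    (\<Prod>m\<in>K. share_moment m (e m) u)"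
proof -
  have em: "e m \<le> 2" if "m \<in> K" for m
    using member_le_sum[OF that, of e] finite_K e by simp
  have "integrable M (\<lambda>\<omega>. \<tau> \<omega> ^ n * exp (- (u * \<tau> \<omega>)))"
    by (rule Bochner_Integration.integrable_bound[OF \<tau>_power_integrable[OF e(2)]])
      (use \<tau>_nonneg u in \<open>auto elim!: eventually_mono simp: abs_mult intro!: mult_left_le\<close>)
  note pe = product_expectation[OF this \<pi>_monomial_integrable]
  have "(\<Prod>m\<in>K. share_moment m (e m) u) = (\<integral>z. (\<Prod>m\<in>K. share m z ^ e m * exp (- (u * share m z))) \<partial>(M \<Otimes>\<^sub>M N))"
    unfolding share_moment_def
  proof (rule pair.indep_vars_lebesgue_integral[symmetric, OF finite_K])
    show "pair.indep_vars (\<lambda>_. borel) (\<lambda>m z. share m z ^ e m * exp (- (u * share m z))) K"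
      by (rule pair.indep_vars_compose2[OF shares_independent]) measurable
  qed (use share_power_integrable em u in auto)
  also have "\<dots> = (\<integral>z. (\<tau> (fst z) ^ n * exp (- (u * \<tau> (fst z)))) * (\<Prod>m\<in>K. \<pi> m (snd z) ^ e m) \<partial>(M \<Otimes>\<^sub>M N))"
  proof (rule integral_cong_AE)
    show "AE z in M \<Otimes>\<^sub>M N. (\<Prod>m\<in>K. share m z ^ e m * exp (- (u * share m z))) =
        (\<tau> (fst z) ^ n * exp (- (u * \<tau> (fst z)))) * (\<Prod>m\<in>K. \<pi> m (snd z) ^ e m)"
      using AE_shares
    proof eventually_elim
      case (elim z)
      have "(\<Prod>m\<in>K. exp (- (u * share m z))) = exp (- (u * (\<Sum>m\<in>K. share m z)))"
        using finite_K by (simp add: exp_sum[symmetric] sum_negf sum_distrib_left)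
      moreover have "(\<Prod>m\<in>K. share m z ^ e m) = \<tau> (fst z) ^ n * (\<Prod>m\<in>K. \<pi> m (snd z) ^ e m)"
        by (simp add: share_def power_mult_distrib prod.distrib power_sum[symmetric] e(1))
      ultimately show ?case using elim by (simp add: prod.distrib)
    qed
  qed measurable
  also have "\<dots> = (\<integral>\<omega>. \<tau> \<omega> ^ n * exp (- (u * \<tau> \<omega>)) \<partial>M) * (\<integral>\<omega>. (\<Prod>m\<in>K. \<pi> m \<omega> ^ e m) \<partial>N)"
    by (rule pe(2))
  finally show ?thesis ..
qed

lemma \<pi>_monomials:
  assumes "p \<in> K"
  shows "(\<Prod>m\<in>K. \<pi> m \<omega> ^ (if m = p then n else 0)) = \<pi> p \<omega> ^ n"
proof -
  have "(\<Prod>m\<in>K. \<pi> m \<omega> ^ (if m = p then n else 0)) = (\<Prod>m\<in>K. if m = p then \<pi> m \<omega> ^ n else 1)"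
    by (intro prod.cong) auto
  then show ?thesis using finite_K assms by (simp add: prod.delta)
qed

lemma first_moment_identity:
  assumes "p \<in> K"
  shows "(\<integral>\<omega>. \<tau> \<omega> \<partial>M) * (\<integral>\<omega>. \<pi> p \<omega> \<partial>N) = share_moment p 1 0"
proof -
  have "(\<integral>\<omega>. \<tau> \<omega> ^ 1 * exp (- (0 * \<tau> \<omega>)) \<partial>M) * (\<integral>\<omega>. (\<Prod>m\<in>K. \<pi> m \<omega> ^ (if m = p then 1 else 0)) \<partial>N)
     = (\<Prod>m\<in>K. share_moment m (if m = p then 1 else 0) 0)"
    using finite_K assms by (intro moment_identity) auto
  also have "\<dots> = (\<Prod>m\<in>K. if m = p then share_moment p 1 0 else 1)"
    by (intro prod.cong) (auto simp: share_moment_def pair.prob_space)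
  also have "\<dots> = share_moment p 1 0" using finite_K assms by simp
  finally show ?thesis using \<pi>_monomials[OF assms, of _ 1] by simp
qed

definition size_moment :: "real \<Rightarrow> real" where
  "size_moment u = (\<integral>\<omega>. \<tau> \<omega> ^ 2 * exp (- (u * \<tau> \<omega>)) \<partial>M)"

lemma square_moment_identity:
  assumes "p \<in> K" "0 \<le> u"
  shows "size_moment u * (\<integral>\<omega>. \<pi> p \<omega> ^ 2 \<partial>N) = share_moment p 2 u * h u ^ (card K - 1)"
proof -
  have "size_moment u * (\<integral>\<omega>. (\<Prod>m\<in>K. \<pi> m \<omega> ^ (if m = p then 2 else 0)) \<partial>N)
     = (\<Prod>m\<in>K. share_moment m (if m = p then 2 else 0) u)"
    unfolding size_moment_def using finite_K assms by (intro moment_identity) auto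
  also have "\<dots> = share_moment p 2 u * (\<Prod>m\<in>K - {p}. share_moment m (if m = p then 2 else 0) u)"
    using finite_K assms by (subst prod.remove[of _ p]) auto
  also have "(\<Prod>m\<in>K - {p}. share_moment m (if m = p then 2 else 0) u) = (\<Prod>m\<in>K - {p}. h u)"
    using assms by (intro prod.cong) (auto simp: share_moment_0)
  also have "\<dots> = h u ^ (card K - 1)" using finite_K assms by simp
  finally show ?thesis using \<pi>_monomials[OF assms(1), of _ 2] by simp
qed

lemma mixed_moment_identity:
  assumes pq: "p \<in> K" "q \<in> K" "p \<noteq> q" and u: "0 \<le> u"
  shows "size_moment u * (\<integral>\<omega>. \<pi> p \<omega> * \<pi> q \<omega> \<partial>N) = (share_moment p 1 u)\<^sup>2 * h u ^ (card K - 2)"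
proof -
  have "size_moment u * (\<integral>\<omega>. (\<Prod>m\<in>K. \<pi> m \<omega> ^ (if m = p then 1 else if m = q then 1 else 0)) \<partial>N)
     = (\<Prod>m\<in>K. share_moment m (if m = p then 1 else if m = q then 1 else 0) u)"
    unfolding size_moment_def
  proof (rule moment_identity)
    have "(\<Sum>m\<in>K. if m = p then 1 else if m = q then 1 else 0) = (\<Sum>m\<in>K. (if m = p then 1 else 0) + (if m = q then 1 else (0::nat)))"
      using pq by (intro sum.cong) auto
    then show "(\<Sum>m\<in>K. if m = p then 1 else if m = q then 1 else 0) = (2::nat)"
      using finite_K pq by (simp add: sum.distrib)
  qed (use u in auto)
  also have "\<dots> = (\<Prod>m\<in>K. if m = p then share_moment p 1 u else if m = q then share_moment q 1 u else h u)"
    using u by (intro prod.cong) (auto simp: share_moment_0)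
  also have "\<dots> = share_moment p 1 u * share_moment q 1 u * h u ^ (card K - 2)"
    by (rule prod_two_exceptions[OF finite_K pq])
  also have "share_moment q 1 u = share_moment p 1 u" using pq by (intro share_moment_indep_of_index)
  also have "(\<lambda>\<omega>. \<Prod>m\<in>K. \<pi> m \<omega> ^ (if m = p then 1 else if m = q then 1 else 0)) = (\<lambda>\<omega>. \<pi> p \<omega> * \<pi> q \<omega>)"
  proof
    fix \<omega>
    have "(\<Prod>m\<in>K. \<pi> m \<omega> ^ (if m = p then 1 else if m = q then 1 else 0)) =
        (\<Prod>m\<in>K. if m = p then \<pi> p \<omega> else if m = q then \<pi> q \<omega> else 1)"
      by (intro prod.cong) auto
    then show "(\<Prod>m\<in>K. \<pi> m \<omega> ^ (if m = p then 1 else if m = q then 1 else 0)) = \<pi> p \<omega> * \<pi> q \<omega>"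
      by (simp add: prod_two_exceptions[OF finite_K pq])
  qed
  finally show ?thesis by (simp add: power2_eq_square)
qed

lemma h_pos: "0 \<le> u \<Longrightarrow> 0 < h u"
proof -
  assume u: "0 \<le> u"
  obtain m where m: "m \<in> K" using K_nonempty by blast
  show ?thesis using joint_laplace_pos[of "\<lambda>j. if j = m then u else 0"] single[OF m u] u by simp
qed

lemma h_0: "h 0 = 1"
proof -
  obtain m where m: "m \<in> K" using K_nonempty by blast
  show ?thesis using single[OF m, of 0] by (simp add: joint_laplace_def proportions.prob_space)
qed

lemma \<pi>_mean: "p \<in> K \<Longrightarrow> (\<integral>\<omega>. \<tau> \<omega> \<partial>M) \<noteq> 0 \<Longrightarrow> (\<integral>\<omega>. \<pi> p \<omega> \<partial>N) = 1 / card K"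
proof -
  assume p: "p \<in> K" and \<tau>: "(\<integral>\<omega>. \<tau> \<omega> \<partial>M) \<noteq> 0"
  have int: "integrable N (\<pi> m)" if "m \<in> K" for m
    using \<pi>_monomial_integrable[of "\<lambda>j. if j = m then 1 else 0"] \<pi>_monomials[OF that, of _ 1] by simp
  have eq: "(\<integral>\<omega>. \<pi> m \<omega> \<partial>N) = (\<integral>\<omega>. \<pi> p \<omega> \<partial>N)" if m: "m \<in> K" for m
    using first_moment_identity[OF m] first_moment_identity[OF p] share_moment_indep_of_index[OF m p, of 1 0] \<tau>
    by (metis mult_left_cancel)
  have "1 = (\<integral>\<omega>. (\<Sum>m\<in>K. \<pi> m \<omega>) \<partial>N)"
    using \<pi>_sum by (subst integral_cong_AE[of _ _ "\<lambda>_. 1"]) (auto simp: proportions.prob_space)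
  also have "\<dots> = (\<Sum>m\<in>K. \<integral>\<omega>. \<pi> m \<omega> \<partial>N)" using int by simp
  also have "\<dots> = card K * (\<integral>\<omega>. \<pi> p \<omega> \<partial>N)" by (simp add: eq)
  finally show ?thesis using K_nonempty finite_K by (simp add: field_simps)
qed

text \<open>This is Lukacs' characterization of the Gamma law. The moment identities for \<open>\<pi>\<^sub>p\<^sup>2\<close> and for
  \<open>\<pi>\<^sub>p \<pi>\<^sub>q\<close> have the same second moment of the tilted size as a factor. Their quotient is therefore a
  relation between \<open>h\<close>, \<open>h'\<close> and \<open>h''\<close> with constant coefficients, the differential equation of a Gamma
  transform with \<open>1 + \<beta> = E \<pi>\<^sub>p\<^sup>2 / E (\<pi>\<^sub>p \<pi>\<^sub>q)\<close>. The condition \<open>\<beta> > 0\<close> means \<open>E (\<pi>\<^sub>p - \<pi>\<^sub>q)\<^sup>2 > 0\<close>. If this fails for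
  all pairs, the proportions are constant, the identities give a vanishing variance of the size, and
  the situation is one of the excluded trivial ones.\<close>

theorem marginal_laplace_is_gamma:
  assumes K2: "card K \<noteq> 1"
    and nonzero: "\<not> (AE \<omega> in M. \<tau> \<omega> = 0)"
    and random: "\<And>c. (AE \<omega> in M. \<tau> \<omega> = c) \<Longrightarrow> (\<forall>i\<in>K. \<exists>p. AE \<omega> in N. \<pi> i \<omega> = p) \<Longrightarrow> False"
  obtains \<alpha> \<gamma> where "0 < \<alpha>" "0 < \<gamma>" "\<And>u. 0 \<le> u \<Longrightarrow> h u = (1 + u / \<gamma>) powr (- \<alpha>)"
proof -
  have k: "2 \<le> card K" using K2 K_nonempty finite_K by (metis One_nat_def Suc_leI card_gt_0_iff le_neq_implies_less numeral_2_eq_2)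
  define \<mu> where "\<mu> = (\<integral>\<omega>. \<tau> \<omega> \<partial>M)"
  have "0 \<le> \<mu>" unfolding \<mu>_def by (rule integral_nonneg_AE[OF \<tau>_nonneg])
  moreover have "\<mu> \<noteq> 0" using nonzero integral_nonneg_eq_0_iff_AE[OF \<tau>_integrable \<tau>_nonneg] by (simp add: \<mu>_def)
  ultimately have \<mu>: "0 < \<mu>" by simp
  have \<pi>m: "(\<integral>\<omega>. \<pi> p \<omega> \<partial>N) = 1 / card K" if "p \<in> K" for p using \<pi>_mean[OF that] \<mu> by (simp add: \<mu>_def)
  have Bpos: "0 < share_moment p 1 u" if p: "p \<in> K" and u: "0 \<le> u" for p u
  proof -
    have nn: "AE z in M \<Otimes>\<^sub>M N. 0 \<le> share p z ^ 1 * exp (- (u * share p z))"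
      using share_nonneg[OF p] by eventually_elim simp
    then have "0 \<le> share_moment p 1 u" unfolding share_moment_def by (rule integral_nonneg_AE)
    moreover have "share_moment p 1 u \<noteq> 0"
    proof
      assume "share_moment p 1 u = 0"
      then have "AE z in M \<Otimes>\<^sub>M N. share p z ^ 1 * exp (- (u * share p z)) = 0"
        using integral_nonneg_eq_0_iff_AE[OF share_power_integrable[OF p _ u] nn] by (simp add: share_moment_def)
      then have "AE z in M \<Otimes>\<^sub>M N. share p z = 0" by eventually_elim simp
      then have "share_moment p 1 0 = 0" unfolding share_moment_def
        by (subst integral_cong_AE[of _ _ "\<lambda>_. 0"]) auto
      then show False using first_moment_identity[OF p] \<pi>m[OF p] \<mu> k by (simp add: \<mu>_def)
    qed
    ultimately show ?thesis by simp
  qed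
  define d where "d p q = (\<integral>\<omega>. \<pi> p \<omega> * \<pi> q \<omega> \<partial>N)" for p q
  have int2: "integrable N (\<lambda>\<omega>. \<pi> p \<omega> * \<pi> q \<omega>)" if "p \<in> K" "q \<in> K" for p q
    by (rule proportions.integrable_const_bound[of _ 1])
      (use AE_\<pi>_le_1 that in \<open>auto elim!: eventually_mono simp: abs_mult intro!: mult_le_one\<close>)
  have sq: "size_moment u * d p p = share_moment p 2 u * h u ^ (card K - 1)" if "p \<in> K" "0 \<le> u" for p u
    using square_moment_identity[OF that] by (simp add: d_def power2_eq_square)
  have mixed: "size_moment u * d p q = (share_moment p 1 u)\<^sup>2 * h u ^ (card K - 2)"
    if "p \<in> K" "q \<in> K" "p \<noteq> q" "0 \<le> u" for p q u
    using mixed_moment_identity[OF that] by (simp add: d_def)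
  \<comment> \<open>Two proportions that differ with positive probability exist, since otherwise both size and proportions are constant.\<close>
  have "\<exists>p q. p \<in> K \<and> q \<in> K \<and> \<not> (AE \<omega> in N. \<pi> p \<omega> = \<pi> q \<omega>)"
  proof (rule ccontr)
    assume "\<not> ?thesis"
    then have "AE \<omega> in N. \<forall>p\<in>K. \<forall>q\<in>K. \<pi> p \<omega> = \<pi> q \<omega>"
      using finite_K by (intro AE_finite_allI) auto
    with \<pi>_sum have det: "AE \<omega> in N. \<forall>p\<in>K. \<pi> p \<omega> = 1 / card K"
    proof eventually_elim
      case (elim \<omega>)
      show ?case
      proof
        fix p assume p: "p \<in> K"
        have "(\<Sum>m\<in>K. \<pi> m \<omega>) = (\<Sum>m\<in>K. \<pi> p \<omega>)"
          by (rule sum.cong[OF refl]) (use elim(2) p in blast)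
        then have "real (card K) * \<pi> p \<omega> = 1" using elim(1) by simp
        then show "\<pi> p \<omega> = 1 / card K" using k by (simp add: field_simps)
      qed
    qed
    obtain p where p: "p \<in> K" using K_nonempty by blast
    obtain q where q: "q \<in> K" "p \<noteq> q"
      using k p finite_K by (metis card_le_Suc0_iff_eq not_less_eq_eq numeral_2_eq_2)
    have d: "d p q = 1 / (card K)\<^sup>2"
    proof -
      have "AE \<omega> in N. \<pi> p \<omega> * \<pi> q \<omega> = 1 / (card K)\<^sup>2"
        using det by eventually_elim (use p q in \<open>simp add: power2_eq_square\<close>)
      then have "d p q = (\<integral>\<omega>. 1 / (card K)\<^sup>2 \<partial>N)" unfolding d_def by (intro integral_cong_AE) auto
      then show ?thesis by (simp add: proportions.prob_space)
    qed
    have "size_moment 0 * d p q = (\<mu> / card K)\<^sup>2"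
      using mixed[OF p q, of 0] first_moment_identity[OF p] \<pi>m[OF p] h_0 by (simp add: \<mu>_def)
    then have "size_moment 0 = \<mu>\<^sup>2" using k by (simp add: d power_divide field_simps)
    then have sm: "(\<integral>\<omega>. (\<tau> \<omega>)\<^sup>2 \<partial>M) = \<mu>\<^sup>2" by (simp add: size_moment_def)
    have "(\<integral>\<omega>. (\<tau> \<omega> - \<mu>)\<^sup>2 \<partial>M) = 0"
      using size.variance_eq[OF \<tau>_integrable \<tau>_square_integrable] sm by (simp add: \<mu>_def)
    moreover have "integrable M (\<lambda>\<omega>. (\<tau> \<omega> - \<mu>)\<^sup>2)"
      using \<tau>_integrable \<tau>_square_integrable by (simp add: power2_diff)
    ultimately have "AE \<omega> in M. (\<tau> \<omega> - \<mu>)\<^sup>2 = 0"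
      by (subst integral_nonneg_eq_0_iff_AE[symmetric]) auto
    then have "AE \<omega> in M. \<tau> \<omega> = \<mu>" by eventually_elim simp
    moreover have "\<forall>i\<in>K. \<exists>p. AE \<omega> in N. \<pi> i \<omega> = p"
    proof
      fix i assume "i \<in> K"
      then have "AE \<omega> in N. \<pi> i \<omega> = 1 / card K" using det by (auto elim: eventually_mono)
      then show "\<exists>p. AE \<omega> in N. \<pi> i \<omega> = p" by blast
    qed
    ultimately show False by (rule random)
  qed
  then obtain p q where pq: "p \<in> K" "q \<in> K" and ne: "\<not> (AE \<omega> in N. \<pi> p \<omega> = \<pi> q \<omega>)" by blast
  then have "p \<noteq> q" by auto
  have T: "size_moment u * d p q > 0" if "0 \<le> u" for u
    using mixed[OF pq \<open>p \<noteq> q\<close> that] Bpos[OF pq(1) that] h_pos[OF that] by simp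
  have T0: "size_moment 0 \<noteq> 0" using T[of 0] by auto
  have dnn: "0 \<le> d p q" unfolding d_def
    by (rule integral_nonneg_AE) (use AE_\<pi>_le_1 pq in \<open>auto elim: eventually_mono\<close>)
  then have dpos: "0 < d p q" using T[of 0] by (cases "d p q = 0") auto
  have dqq: "d q q = d p p"
    using sq[OF pq(1), of 0] sq[OF pq(2), of 0] share_moment_indep_of_index[OF pq, of 2 0] T0
    by (metis mult_left_cancel order_refl)
  have expand: "(\<lambda>\<omega>. (\<pi> p \<omega> - \<pi> q \<omega>)\<^sup>2) =
      (\<lambda>\<omega>. \<pi> p \<omega> * \<pi> p \<omega> + \<pi> q \<omega> * \<pi> q \<omega> - 2 * (\<pi> p \<omega> * \<pi> q \<omega>))"
    by (rule ext) (simp add: power2_eq_square algebra_simps)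
  have "0 < (\<integral>\<omega>. (\<pi> p \<omega> - \<pi> q \<omega>)\<^sup>2 \<partial>N)"
  proof -
    have int: "integrable N (\<lambda>\<omega>. (\<pi> p \<omega> - \<pi> q \<omega>)\<^sup>2)"
      unfolding expand using int2[OF pq(1) pq(1)] int2[OF pq] int2[OF pq(2) pq(2)] by simp
    have "(\<integral>\<omega>. (\<pi> p \<omega> - \<pi> q \<omega>)\<^sup>2 \<partial>N) \<noteq> 0"
    proof
      assume "(\<integral>\<omega>. (\<pi> p \<omega> - \<pi> q \<omega>)\<^sup>2 \<partial>N) = 0"
      then have "AE \<omega> in N. (\<pi> p \<omega> - \<pi> q \<omega>)\<^sup>2 = 0"
        using int by (subst integral_nonneg_eq_0_iff_AE[symmetric]) auto
      then have "AE \<omega> in N. \<pi> p \<omega> = \<pi> q \<omega>" by eventually_elim simp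
      with ne show False by blast
    qed
    moreover have "0 \<le> (\<integral>\<omega>. (\<pi> p \<omega> - \<pi> q \<omega>)\<^sup>2 \<partial>N)" by (rule integral_nonneg_AE) simp
    ultimately show ?thesis by linarith
  qed
  also have "(\<integral>\<omega>. (\<pi> p \<omega> - \<pi> q \<omega>)\<^sup>2 \<partial>N) = d p p + d q q - 2 * d p q"
    unfolding expand using int2[OF pq(1) pq(1)] int2[OF pq] int2[OF pq(2) pq(2)] by (simp add: d_def)
  finally have gt: "d p q < d p p" using dqq by simp
  define \<beta> where "\<beta> = d p p / d p q - 1"
  have \<beta>: "0 < \<beta>" using gt dpos by (simp add: \<beta>_def)
  have ode: "h u * share_moment p 2 u = (1 + \<beta>) * (share_moment p 1 u)\<^sup>2" if u: "0 \<le> u" for u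
  proof -
    \<comment> \<open>The unknown moment of the size cancels between the two second-order identities.\<close>
    have hk: "h u ^ (card K - 1) = h u * h u ^ (card K - 2)"
      using k by (metis Suc_diff_le diff_Suc_Suc numeral_2_eq_2 One_nat_def power_Suc)
    have "d p q * (share_moment p 2 u * (h u * h u ^ (card K - 2))) = d p q * (size_moment u * d p p)"
      using sq[OF pq(1) u] hk by simp
    also have "\<dots> = d p p * (size_moment u * d p q)" by simp
    also have "\<dots> = d p p * ((share_moment p 1 u)\<^sup>2 * h u ^ (card K - 2))"
      using mixed[OF pq \<open>p \<noteq> q\<close> u] by simp
    finally have "(d p q * (h u * share_moment p 2 u)) * h u ^ (card K - 2) =
        (d p p * (share_moment p 1 u)\<^sup>2) * h u ^ (card K - 2)" by (simp add: mult_ac)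
    then have "d p q * (h u * share_moment p 2 u) = d p p * (share_moment p 1 u)\<^sup>2"
      using h_pos[OF u] by simp
    then show ?thesis using dpos by (simp add: \<beta>_def field_simps)
  qed
  have hp: "(h has_field_derivative - share_moment p 1 u) (at u within {0..})" if u: "0 \<le> u" for u
  proof (rule has_field_derivative_transform_within[OF _ zero_less_one])
    show "(share_moment p 0 has_field_derivative - share_moment p 1 u) (at u within {0..})"
      using share_moment_derivative[OF pq(1), of 0 u] u by simp
  qed (use u pq share_moment_0 in auto)
  have Bp: "(share_moment p 1 has_field_derivative - share_moment p 2 u) (at u within {0..})" if "0 \<le> u" for u
    using share_moment_derivative[OF pq(1), of 1 u] that by (simp add: numeral_2_eq_2)
  show ?thesis
    by (rule gamma_laplace_of_ode[OF hp Bp Bpos[OF pq(1)] h_0 \<beta> ode]) (auto intro: that)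
qed

lemma size_law_of_gamma_laplace:
  assumes \<alpha>: "0 < \<alpha>" and \<gamma>: "0 < \<gamma>"
    and h: "\<And>u. 0 \<le> u \<Longrightarrow> h u = (1 + u / \<gamma>) powr (- \<alpha>)"
    and size: "\<And>u. 0 \<le> u \<Longrightarrow> size_laplace u = h u ^ card K"
  shows "distr M borel \<tau> = gamma_distribution (\<alpha> * card K) \<gamma>"
proof -
  have k: "0 < card K" using K_nonempty finite_K by (simp add: card_gt_0_iff)
  have a: "0 < \<alpha> * card K" using \<alpha> k by simp
  have "distr M borel \<tau> = distr (gamma_distribution (\<alpha> * card K) \<gamma>) borel (\<lambda>x. x)"
  proof (rule laplace_determines_distr[OF size.prob_space_axioms prob_space_gamma_distribution[OF a \<gamma>] \<tau>_measurable _ \<tau>_nonneg])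
    show "AE x in gamma_distribution (\<alpha> * card K) \<gamma>. 0 \<le> x"
      using AE_gamma_distribution_pos[of "\<alpha> * card K" \<gamma>] by (auto elim: eventually_mono)
    fix u :: real assume u: "0 \<le> u"
    have "0 \<le> u / \<gamma>" using u \<gamma> by simp
    then have "((1 + u / \<gamma>) powr (- \<alpha>)) ^ card K = (1 + u / \<gamma>) powr (- (\<alpha> * card K))"
      using k by (simp add: powr_power mult.commute)
    then show "(\<integral>\<omega>. exp (- (u * \<tau> \<omega>)) \<partial>M) = (\<integral>x. exp (- (u * x)) \<partial>gamma_distribution (\<alpha> * card K) \<gamma>)"
      using size[OF u] h[OF u] laplace_gamma_distribution[OF a \<gamma> u] by (simp add: size_laplace_def)
  qed simp
  then show ?thesis by (simp add: distr_id2)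
qed

lemma distr_snd: "distr (M \<Otimes>\<^sub>M N) N snd = N"
proof (rule measure_eqI)
  fix A assume "A \<in> sets (distr (M \<Otimes>\<^sub>M N) N snd)"
  then have A: "A \<in> sets N" by simp
  then have "snd -` A \<inter> space (M \<Otimes>\<^sub>M N) = space M \<times> A"
    using sets.sets_into_space by (auto simp: space_pair_measure)
  with A show "emeasure (distr (M \<Otimes>\<^sub>M N) N snd) A = emeasure N A"
    by (simp add: emeasure_distr proportions.emeasure_pair_measure_Times size.emeasure_space_1)
qed simp

text \<open>The shares, rescaled to rate 1, are independent Gamma variables, and the proportions are the
  shares divided by their sum.\<close>

lemma proportions_law_of_gamma_laplace:
  assumes \<alpha>: "0 < \<alpha>" and \<gamma>: "0 < \<gamma>"
    and h: "\<And>u. 0 \<le> u \<Longrightarrow> h u = (1 + u / \<gamma>) powr (- \<alpha>)"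
  shows "vector_law N K \<pi> = dirichlet_distribution K (\<lambda>_. \<alpha>)"
proof -
  let ?Q = "M \<Otimes>\<^sub>M N" and ?G = "PiM K (\<lambda>_. gamma_distribution \<alpha> 1)"
  let ?B = "PiM K (\<lambda>_. borel) :: (int \<Rightarrow> real) measure"
  let ?X = "\<lambda>m z. \<gamma> * share m z"
  have law: "vector_law ?Q K ?X = ?G"
  proof (rule vector_law_eq_PiM_of_laplace[OF pair.prob_space_axioms finite_K])
    fix m assume m: "m \<in> K"
    show "AE z in ?Q. 0 \<le> \<gamma> * share m z" using share_nonneg[OF m] by eventually_elim (use \<gamma> in simp)
    show "AE x in gamma_distribution \<alpha> 1. 0 \<le> x"
      using AE_gamma_distribution_pos[of \<alpha> 1] by (auto elim: eventually_mono)
    show "prob_space (gamma_distribution \<alpha> 1)" using \<alpha> by (intro prob_space_gamma_distribution) auto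
  next
    fix t assume t: "\<And>m::int. 0 \<le> (t m :: real)"
    have "(\<integral>z. exp (- (\<Sum>m\<in>K. t m * (\<gamma> * share m z))) \<partial>?Q) = joint_laplace (\<lambda>m. \<gamma> * t m)"
      using joint_laplace_eq[of "\<lambda>m. \<gamma> * t m"] t \<gamma> by (simp add: mult_ac)
    also have "\<dots> = (\<Prod>m\<in>K. h (\<gamma> * t m))" using t \<gamma> by (intro factor) simp
    also have "\<dots> = (\<Prod>m\<in>K. \<integral>x. exp (- (t m * x)) \<partial>gamma_distribution \<alpha> 1)"
      using t \<gamma> \<alpha> by (intro prod.cong refl) (simp add: h laplace_gamma_distribution)
    finally show "(\<integral>z. exp (- (\<Sum>m\<in>K. t m * (\<gamma> * share m z))) \<partial>?Q) =
        (\<Prod>m\<in>K. \<integral>x. exp (- (t m * x)) \<partial>gamma_distribution \<alpha> 1)" .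
  qed simp_all
  have mX: "(\<lambda>z. \<lambda>m\<in>K. ?X m z) \<in> measurable ?Q ?B" by (intro measurable_restrict) measurable
  have mr: "(\<lambda>y. \<lambda>i\<in>K. y i / (\<Sum>k\<in>K. y k)) \<in> measurable ?B ?B"
    by (intro measurable_restrict borel_measurable_divide borel_measurable_sum measurable_component_singleton)
  have Gpos: "AE y in ?G. \<forall>m\<in>K. 0 < y m"
    using finite_K \<alpha> by (intro AE_finite_allI AE_PiM_component prob_space_gamma_distribution AE_gamma_distribution_pos) auto
  have "AE z in ?Q. \<forall>m\<in>K. 0 < (\<lambda>m\<in>K. ?X m z) m"
    using Gpos unfolding law[symmetric] vector_law_def by (rule AE_distrD[OF mX])
  then have pos: "AE z in ?Q. \<forall>m\<in>K. 0 < ?X m z" by eventually_elim simp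
  have "dirichlet_distribution K (\<lambda>_. \<alpha>) = distr (distr ?Q ?B (\<lambda>z. \<lambda>m\<in>K. ?X m z)) ?B (\<lambda>y. \<lambda>i\<in>K. y i / (\<Sum>k\<in>K. y k))"
    unfolding dirichlet_distribution_def law[symmetric] by (simp add: vector_law_def)
  also have "\<dots> = distr ?Q ?B (\<lambda>z. \<lambda>i\<in>K. ?X i z / (\<Sum>k\<in>K. ?X k z))"
    by (subst distr_distr[OF mr mX]) (auto simp: comp_def intro!: arg_cong[where f = "distr ?Q ?B"] ext restrict_ext)
  also have "\<dots> = distr ?Q ?B (\<lambda>z. \<lambda>i\<in>K. \<pi> i (snd z))"
  proof (rule distr_cong_AE)
    show "AE z in ?Q. (\<lambda>i\<in>K. ?X i z / (\<Sum>k\<in>K. ?X k z)) = (\<lambda>i\<in>K. \<pi> i (snd z))"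
      using pos AE_shares
    proof eventually_elim
      case (elim z)
      obtain m where "m \<in> K" using K_nonempty by blast
      with elim have "0 < share m z" "share m z \<le> \<tau> (fst z)" using \<gamma> by (auto simp: zero_less_mult_iff)
      then have "0 < \<tau> (fst z)" by linarith
      then show ?case using \<gamma> elim(2)
        by (intro restrict_ext) (simp add: sum_distrib_left[symmetric] share_def)
    qed
    show "(\<lambda>z. \<lambda>i\<in>K. \<pi> i (snd z)) \<in> measurable ?Q ?B" by (intro measurable_restrict) measurable
    show "(\<lambda>z. \<lambda>i\<in>K. ?X i z / (\<Sum>k\<in>K. ?X k z)) \<in> measurable ?Q ?B" by (intro measurable_restrict) measurable
  qed simp_all
  also have "\<dots> = distr (distr ?Q N snd) ?B (\<lambda>\<omega>. \<lambda>i\<in>K. \<pi> i \<omega>)"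
    by (subst distr_distr) (auto simp: comp_def intro!: measurable_restrict)
  also have "\<dots> = vector_law N K \<pi>" by (simp add: distr_snd vector_law_def)
  finally show ?thesis ..
qed

end

context random_split
begin

text \<open>The converse of the characterization: a Gamma size with Dirichlet proportions has independent
  Gamma shares.\<close>

lemma joint_laplace_of_gamma_dirichlet:
  fixes \<alpha> \<gamma> :: real
  assumes \<alpha>: "0 < \<alpha>" and \<gamma>: "0 < \<gamma>" and s: "\<And>m. 0 \<le> s m"
    and size: "\<And>u. 0 \<le> u \<Longrightarrow> size_laplace u = (1 + u / \<gamma>) powr (- (\<alpha> * card K))"
    and dirichlet: "vector_law N K \<pi> = dirichlet_distribution K (\<lambda>_. \<alpha>)"
  shows "joint_laplace s = (\<Prod>m\<in>K. (1 + s m / \<gamma>) powr (- \<alpha>))"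
proof -
  let ?G = "PiM K (\<lambda>_. gamma_distribution \<alpha> 1)"
  let ?B = "PiM K (\<lambda>_. borel) :: (int \<Rightarrow> real) measure"
  let ?r = "\<lambda>y. \<lambda>i\<in>K. y i / (\<Sum>k\<in>K. y k)"
  define f where "f y = size_laplace (\<Sum>m\<in>K. s m * y m)" for y :: "int \<Rightarrow> real"
  have f: "f \<in> borel_measurable ?B" unfolding f_def
    by (intro measurable_compose[OF _ size_laplace_measurable] borel_measurable_sum borel_measurable_times
        borel_measurable_const measurable_component_singleton)
  have sets: "sets ?G = sets ?B" by (intro sets_PiM_cong) auto
  have mr: "?r \<in> measurable ?G ?B"
    unfolding measurable_cong_sets[OF sets refl]
    by (intro measurable_restrict borel_measurable_divide borel_measurable_sum measurable_component_singleton)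
  have fr: "(\<lambda>y. f (?r y)) \<in> borel_measurable ?G"
    by (rule measurable_compose[OF mr f])
  have Gpos: "AE y in ?G. \<forall>m\<in>K. 0 < y m"
    using finite_K \<alpha> by (intro AE_finite_allI AE_PiM_component prob_space_gamma_distribution AE_gamma_distribution_pos) auto
  have "joint_laplace s = (\<integral>y. f y \<partial>vector_law N K \<pi>)"
    unfolding vector_law_def using f
    by (subst integral_distr) (auto intro!: measurable_restrict simp: f_def joint_laplace_def)
  also have "\<dots> = (\<integral>y. f (?r y) \<partial>?G)"
    unfolding dirichlet unfolding dirichlet_distribution_def unfolding vector_law_def by (rule integral_distr[OF mr f])
  also have "\<dots> = (\<integral>y. (1 + (\<Sum>m\<in>K. (s m / \<gamma>) * (y m / (\<Sum>k\<in>K. y k)))) powr (- (\<alpha> * card K)) \<partial>?G)"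
  proof (rule integral_cong_AE[OF fr])
    show "AE y in ?G. f (?r y) = (1 + (\<Sum>m\<in>K. (s m / \<gamma>) * (y m / (\<Sum>k\<in>K. y k)))) powr (- (\<alpha> * card K))"
      using Gpos
    proof eventually_elim
      case (elim y)
      have "0 \<le> (\<Sum>m\<in>K. s m * (y m / (\<Sum>k\<in>K. y k)))"
        using elim s by (intro sum_nonneg mult_nonneg_nonneg divide_nonneg_nonneg) (auto intro: less_imp_le)
      from size[OF this] show ?case by (simp add: f_def sum_divide_distrib mult.commute)
    qed
    have "(\<lambda>y. (\<Sum>m\<in>K. (s m / \<gamma>) * (y m / (\<Sum>k\<in>K. y k)))) \<in> borel_measurable ?G"
      unfolding measurable_cong_sets[OF sets refl]
      by (intro borel_measurable_sum borel_measurable_times borel_measurable_const borel_measurable_divide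
          measurable_component_singleton)
    then show "(\<lambda>y. (1 + (\<Sum>m\<in>K. (s m / \<gamma>) * (y m / (\<Sum>k\<in>K. y k)))) powr (- (\<alpha> * card K))) \<in> borel_measurable ?G"
      by (rule measurable_compose) measurable
  qed
  also have "\<dots> = (\<Prod>m\<in>K. (1 + s m / \<gamma>) powr (- \<alpha>))"
    using s \<gamma> by (intro gamma_mixture_over_dirichlet finite_K K_nonempty \<alpha>) simp
  finally show ?thesis .
qed

end

section \<open>The random matrix\<close>

text \<open>Summation along rows instead of columns: column \<open>j\<close> receives the share \<open>m\<close> of row \<open>j - m\<close>. The
  rows on the right are those that reach \<open>T\<close> at all; they may also reach columns outside \<open>T\<close>, where
  \<open>g\<close> is neutral.\<close>

lemma (in comm_monoid_set) window_reindex: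
  fixes T K :: "int set"
  assumes T: "finite T" and K: "finite K" and z: "\<And>i m. i + m \<notin> T \<Longrightarrow> g i m = \<^bold>1"
  shows "F (\<lambda>j. F (\<lambda>m. g (j - m) m) K) T = F (\<lambda>i. F (\<lambda>m. g i m) K) ((\<lambda>(j, m). j - m) ` (T \<times> K))"
proof -
  let ?I = "(\<lambda>(j, m). j - m) ` (T \<times> K)"
  let ?f = "\<lambda>(j, m). (j - m, m)"
  have inj: "inj_on ?f (T \<times> K)" by (auto simp: inj_on_def)
  have "F (\<lambda>j. F (\<lambda>m. g (j - m) m) K) T = F (\<lambda>(j, m). g (j - m) m) (T \<times> K)"
    by (rule cartesian_product)
  also have "\<dots> = F (\<lambda>(i, m). g i m) (?f ` (T \<times> K))"
    by (subst reindex[OF inj]) (auto intro!: cong)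
  also have "\<dots> = F (\<lambda>(i, m). g i m) (?I \<times> K)"
  proof (rule mono_neutral_left)
    show "\<forall>p\<in>?I \<times> K - ?f ` (T \<times> K). (case p of (i, m) \<Rightarrow> g i m) = \<^bold>1"
    proof
      fix p assume p: "p \<in> ?I \<times> K - ?f ` (T \<times> K)"
      obtain i m where im: "p = (i, m)" by (cases p)
      have "i + m \<notin> T"
      proof
        assume "i + m \<in> T"
        then have "p \<in> ?f ` (T \<times> K)" using p im by (intro image_eqI[of _ _ "(i + m, m)"]) auto
        with p show False by blast
      qed
      then show "(case p of (i, m) \<Rightarrow> g i m) = \<^bold>1" by (simp add: im z)
    qed
  qed (use T K in auto)
  also have "\<dots> = F (\<lambda>i. F (\<lambda>m. g i m) K) ?I"
    by (rule cartesian_product[symmetric])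
  finally show ?thesis .
qed

text \<open>Both sides take the value zero when the series does not converge absolutely. The integral has
  the advantage that its measurability in parameters is known.\<close>

lemma infsum_eq_lebesgue_integral:
  fixes f :: "'a \<Rightarrow> real"
  shows "infsum f UNIV = (\<integral>i. f i \<partial>count_space UNIV)"
proof (cases "Infinite_Set_Sum.abs_summable_on f UNIV")
  case True
  then show ?thesis using infsetsum_infsum[OF True] by (simp add: infsetsum_def)
next
  case False
  then have "\<not> f summable_on UNIV"
    using abs_summable_equivalent summable_on_iff_abs_summable_on_real by blast
  then have "infsum f UNIV = 0" by (rule infsum_not_exists)
  moreover have "\<not> integrable (count_space UNIV) f" using False by (simp add: abs_summable_on_def)
  ultimately show ?thesis by (simp add: not_integrable_integral_eq)
qed

locale random_row_times_matrix =
  proportions: prob_space N + M: prob_space M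
  for N :: "'b measure" and M :: "'a measure" +
  fixes \<pi> :: "int \<Rightarrow> 'b \<Rightarrow> real" and K :: "int set"
    and \<tau> :: "int \<Rightarrow> 'a \<Rightarrow> real" and P :: "int \<Rightarrow> int \<Rightarrow> 'a \<Rightarrow> real"
  assumes \<pi>_distribution: "random_probability_distribution N \<pi>"
    and K_support: "K = {i. 0 < measure N {\<omega> \<in> space N. 0 < \<pi> i \<omega>}}"
    and K_finite: "finite K"
    and K_exchangeable: "exchangeable N K \<pi>"
    and rows_independent: "M.indep_vars (\<lambda>_. PiM UNIV (\<lambda>_. borel)) (\<lambda>i \<omega> j. P i (i + j) \<omega>) UNIV"
    and rows_law: "\<And>i. sequence_law M (\<lambda>j. P i (i + j)) = sequence_law N \<pi>"
    and sizes_independent: "M.indep_vars (\<lambda>_. borel) \<tau> UNIV"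
    and sizes_law: "\<And>i. distr M borel (\<tau> i) = distr M borel (\<tau> 0)"
    and sizes_nonneg: "\<And>i. AE \<omega> in M. 0 \<le> \<tau> i \<omega>"
    and sizes_integrable: "\<And>i. integrable M (\<tau> i)"
    and sizes_variance: "integrable M (\<lambda>\<omega>. (\<tau> 0 \<omega> - M.expectation (\<tau> 0))\<^sup>2)"
    and sizes_matrix_independent: "indep_elements M
           (PiM UNIV (\<lambda>_. borel)) (\<lambda>\<omega> j. \<tau> j \<omega>)
           (PiM UNIV (\<lambda>_. PiM UNIV (\<lambda>_. borel))) (\<lambda>\<omega> i j. P i j \<omega>)"
begin

lemma sizes_measurable [measurable]: "\<tau> i \<in> borel_measurable M"
  using sizes_integrable[of i] by auto

lemma proportion_measurable [measurable]: "\<pi> j \<in> borel_measurable N"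
  using \<pi>_distribution by (simp add: random_probability_distribution_def)

lemma matrix_measurable [measurable]: "P i j \<in> borel_measurable M"
proof -
  have "(\<lambda>\<omega> j. P i (i + j) \<omega>) \<in> measurable M (PiM UNIV (\<lambda>_. borel))"
    using rows_independent by (auto simp: M.indep_vars_def)
  from measurable_compose[OF this measurable_component_singleton[of "j - i"]]
  show ?thesis by simp
qed

lemma proportions_vanish_outside: "AE \<omega> in N. (\<forall>j. 0 \<le> \<pi> j \<omega>) \<and> (\<forall>j. j \<notin> K \<longrightarrow> \<pi> j \<omega> = 0)"
proof -
  have nonneg: "AE \<omega> in N. \<forall>j. 0 \<le> \<pi> j \<omega>"
    using \<pi>_distribution unfolding random_probability_distribution_def by (auto elim: eventually_mono)
  have "AE \<omega> in N. j \<notin> K \<longrightarrow> \<not> 0 < \<pi> j \<omega>" for j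
  proof (cases "j \<in> K")
    case False
    then have "\<not> 0 < measure N {\<omega> \<in> space N. 0 < \<pi> j \<omega>}" unfolding K_support by simp
    then have "measure N {\<omega> \<in> space N. 0 < \<pi> j \<omega>} = 0" using measure_nonneg[of N] by (metis less_eq_real_def)
    moreover have "{\<omega> \<in> space N. 0 < \<pi> j \<omega>} \<in> sets N" by measurable
    ultimately have "AE \<omega> in N. \<omega> \<notin> {\<omega> \<in> space N. 0 < \<pi> j \<omega>}"
      by (intro AE_not_in null_setsI) (simp_all add: proportions.emeasure_eq_measure)
    then show ?thesis using AE_space by eventually_elim auto
  qed simp
  then have "AE \<omega> in N. \<forall>j. j \<notin> K \<longrightarrow> \<not> 0 < \<pi> j \<omega>" by (simp add: AE_all_countable)
  with nonneg show ?thesis by eventually_elim (auto intro: antisym simp: not_less)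
qed

lemma proportions_sum_to_one: "AE \<omega> in N. (\<Sum>m\<in>K. \<pi> m \<omega>) = 1"
proof -
  have "AE \<omega> in N. ((\<lambda>j. \<pi> j \<omega>) has_sum 1) UNIV"
    using \<pi>_distribution unfolding random_probability_distribution_def by (auto elim: eventually_mono)
  then show ?thesis using proportions_vanish_outside
  proof eventually_elim
    case (elim \<omega>)
    have "((\<lambda>j. \<pi> j \<omega>) has_sum 1) K"
      using elim by (subst has_sum_cong_neutral[of UNIV K _ "\<lambda>j. \<pi> j \<omega>"]) auto
    then show ?case using K_finite has_sum_finite has_sum_unique by blast
  qed
qed

sublocale random_split M N "\<tau> 0" \<pi> K
proof
  show "AE \<omega> in N. \<forall>m\<in>K. 0 \<le> \<pi> m \<omega>" using proportions_vanish_outside by (auto elim: eventually_mono)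
  show "integrable M (\<lambda>\<omega>. (\<tau> 0 \<omega>)\<^sup>2)"
  proof -
    define c where "c = M.expectation (\<tau> 0)"
    have eq: "(\<lambda>\<omega>. (\<tau> 0 \<omega>)\<^sup>2) = (\<lambda>\<omega>. (\<tau> 0 \<omega> - c)\<^sup>2 + (2 * c * \<tau> 0 \<omega> - c\<^sup>2))"
      by (rule ext) (simp add: power2_eq_square algebra_simps)
    show ?thesis unfolding eq using sizes_variance sizes_integrable[of 0] by (simp add: c_def)
  qed
qed (use sizes_nonneg sizes_integrable K_finite proportions_sum_to_one K_exchangeable in auto)

lemma AE_rows: "AE \<omega> in M. \<forall>i j. 0 \<le> P i (i + j) \<omega> \<and> (j \<notin> K \<longrightarrow> P i (i + j) \<omega> = 0)"
proof -
  let ?B = "PiM UNIV (\<lambda>_. borel) :: (int \<Rightarrow> real) measure"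
  let ?Q = "\<lambda>y::int \<Rightarrow> real. \<forall>j. 0 \<le> y j \<and> (j \<notin> K \<longrightarrow> y j = 0)"
  have mQ: "{y \<in> space ?B. ?Q y} \<in> sets ?B" by measurable
  have law: "(AE \<omega> in L. ?Q (\<lambda>j. X j \<omega>)) \<longleftrightarrow> (AE y in sequence_law L X. ?Q y)"
    if "\<And>j. X j \<in> borel_measurable L" for L :: "'z measure" and X
    unfolding vector_law_def using mQ that
    by (subst AE_distr_iff) (auto intro!: measurable_restrict)
  have "AE \<omega> in N. ?Q (\<lambda>j. \<pi> j \<omega>)"
    using proportions_vanish_outside by eventually_elim auto
  then have "AE y in sequence_law N \<pi>. ?Q y" by (subst (asm) law) auto
  then have "AE \<omega> in M. ?Q (\<lambda>j. P i (i + j) \<omega>)" for i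
    unfolding rows_law[symmetric, of i] by (subst (asm) law[symmetric]) auto
  then show ?thesis by (simp add: AE_all_countable)
qed

lemma row_times_matrix_measurable [measurable]: "row_times_matrix \<tau> P j \<in> borel_measurable M"
proof -
  interpret C: sigma_finite_measure "count_space (UNIV :: int set)"
    by (rule sigma_finite_measure_count_space)
  have "(\<lambda>(\<omega>, i). \<tau> i \<omega> * P i j \<omega>) \<in> borel_measurable (M \<Otimes>\<^sub>M count_space UNIV)"
    unfolding case_prod_unfold
    by (rule measurable_compose_countable[where f = "\<lambda>i p. \<tau> i (fst p) * P i j (fst p)" and g = snd]) measurable
  from C.borel_measurable_lebesgue_integral[OF this]
  show ?thesis by (simp add: row_times_matrix_def[abs_def] infsum_eq_lebesgue_integral)
qed

lemma row_times_matrix_eq: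
  "AE \<omega> in M. \<forall>j. row_times_matrix \<tau> P j \<omega> = (\<Sum>m\<in>K. \<tau> (j - m) \<omega> * P (j - m) j \<omega>)"
  using AE_rows
proof eventually_elim
  case (elim \<omega>)
  show ?case
  proof
    fix j
    have zero: "P i j \<omega> = 0" if "i \<notin> (\<lambda>m. j - m) ` K" for i
    proof -
      have "j - i \<notin> K" using that by (auto simp: image_iff algebra_simps)
      then show ?thesis using elim[rule_format, of i "j - i"] by simp
    qed
    have "row_times_matrix \<tau> P j \<omega> = (\<Sum>\<^sub>\<infinity>i\<in>(\<lambda>m. j - m) ` K. \<tau> i \<omega> * P i j \<omega>)"
      unfolding row_times_matrix_def using zero by (intro infsum_cong_neutral) auto
    also have "\<dots> = (\<Sum>i\<in>(\<lambda>m. j - m) ` K. \<tau> i \<omega> * P i j \<omega>)" using K_finite by simp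
    also have "\<dots> = (\<Sum>m\<in>K. \<tau> (j - m) \<omega> * P (j - m) j \<omega>)"
      by (subst sum.reindex) (auto simp: inj_on_def)
    finally show "row_times_matrix \<tau> P j \<omega> = (\<Sum>m\<in>K. \<tau> (j - m) \<omega> * P (j - m) j \<omega>)" .
  qed
qed

lemma laplace_independent_sizes:
  assumes I: "finite I" and q: "\<And>i. i \<in> I \<Longrightarrow> 0 \<le> q i"
  shows "(\<integral>\<omega>. exp (- (\<Sum>i\<in>I. \<tau> i \<omega> * q i)) \<partial>M) = (\<Prod>i\<in>I. size_laplace (q i))"
proof -
  have same: "(\<integral>\<omega>. exp (- (u * \<tau> i \<omega>)) \<partial>M) = size_laplace u" for i u
  proof -
    have "(\<integral>\<omega>. exp (- (u * \<tau> i \<omega>)) \<partial>M) = (\<integral>x. exp (- (u * x)) \<partial>distr M borel (\<tau> i))" for i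
      by (subst integral_distr) auto
    then show ?thesis using sizes_law[of i] by (simp add: size_laplace_def)
  qed
  have "(\<integral>\<omega>. exp (- (\<Sum>i\<in>I. \<tau> i \<omega> * q i)) \<partial>M) = (\<integral>\<omega>. (\<Prod>i\<in>I. exp (- (q i * \<tau> i \<omega>))) \<partial>M)"
    using I by (simp add: exp_sum[symmetric] sum_negf mult.commute)
  also have "\<dots> = (\<Prod>i\<in>I. \<integral>\<omega>. exp (- (q i * \<tau> i \<omega>)) \<partial>M)"
  proof (rule M.indep_vars_lebesgue_integral[OF I])
    show "M.indep_vars (\<lambda>_. borel) (\<lambda>i \<omega>. exp (- (q i * \<tau> i \<omega>))) I"
      by (rule M.indep_vars_compose2[OF M.indep_vars_subset[OF sizes_independent]]) auto
    show "integrable M (\<lambda>\<omega>. exp (- (q i * \<tau> i \<omega>)))" if "i \<in> I" for i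
      by (rule M.integrable_const_bound[of _ 1])
        (use sizes_nonneg[of i] q[OF that] in \<open>auto elim!: eventually_mono\<close>)
  qed
  also have "\<dots> = (\<Prod>i\<in>I. size_laplace (q i))" by (simp add: same)
  finally show ?thesis .
qed

text \<open>The rows are independent copies of \<open>\<pi>\<close>, read from the diagonal.\<close>

lemma laplace_rows:
  assumes I: "finite I" and t: "\<And>j. 0 \<le> t j"
  shows "(\<integral>\<omega>. (\<Prod>i\<in>I. size_laplace (\<Sum>m\<in>K. t (i + m) * P i (i + m) \<omega>)) \<partial>M) =
    (\<Prod>i\<in>I. joint_laplace (\<lambda>m. t (i + m)))"
proof -
  let ?B = "PiM UNIV (\<lambda>_. borel) :: (int \<Rightarrow> real) measure"
  let ?f = "\<lambda>i y. size_laplace (\<Sum>m\<in>K. t (i + m) * y m)"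
  have f: "?f i \<in> borel_measurable ?B" for i
    by (intro measurable_compose[OF _ size_laplace_measurable] borel_measurable_sum borel_measurable_times
        borel_measurable_const measurable_component_singleton) simp
  have "(\<integral>\<omega>. (\<Prod>i\<in>I. ?f i (\<lambda>j. P i (i + j) \<omega>)) \<partial>M) = (\<Prod>i\<in>I. \<integral>\<omega>. ?f i (\<lambda>j. P i (i + j) \<omega>) \<partial>M)"
  proof (rule M.indep_vars_lebesgue_integral[OF I])
    show "M.indep_vars (\<lambda>_. borel) (\<lambda>i \<omega>. ?f i (\<lambda>j. P i (i + j) \<omega>)) I"
      by (rule M.indep_vars_compose2[OF M.indep_vars_subset[OF rows_independent]]) (auto intro: f)
    show "integrable M (\<lambda>\<omega>. ?f i (\<lambda>j. P i (i + j) \<omega>))" for i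
    proof (rule M.integrable_const_bound[of _ 1])
      show "AE \<omega> in M. norm (?f i (\<lambda>j. P i (i + j) \<omega>)) \<le> 1"
        using AE_rows
      proof eventually_elim
        case (elim \<omega>)
        have "0 \<le> (\<Sum>m\<in>K. t (i + m) * P i (i + m) \<omega>)"
          using elim t by (intro sum_nonneg mult_nonneg_nonneg) auto
        from size_laplace_pos[OF this] size_laplace_le_1[OF this] show ?case by simp
      qed
    qed measurable
  qed
  also have "\<dots> = (\<Prod>i\<in>I. joint_laplace (\<lambda>m. t (i + m)))"
  proof (rule prod.cong[OF refl])
    fix i
    have "(\<integral>\<omega>. ?f i (\<lambda>j. P i (i + j) \<omega>) \<partial>M) = (\<integral>y. ?f i y \<partial>sequence_law M (\<lambda>j. P i (i + j)))"
      unfolding vector_law_def using f by (subst integral_distr) (auto intro!: measurable_restrict)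
    also have "\<dots> = (\<integral>\<omega>. ?f i (\<lambda>j. \<pi> j \<omega>) \<partial>N)"
      unfolding rows_law unfolding vector_law_def using f by (subst integral_distr) (auto intro!: measurable_restrict)
    finally show "(\<integral>\<omega>. ?f i (\<lambda>j. P i (i + j) \<omega>) \<partial>M) = joint_laplace (\<lambda>m. t (i + m))"
      by (simp add: joint_laplace_def)
  qed
  finally show ?thesis .
qed

text \<open>The linear form \<open>\<Sum>j. t\<^sub>j \<tau>'\<^sub>j\<close> is the sum over the rows \<open>i\<close> of \<open>\<tau>\<^sub>i\<close> times the part of row \<open>i\<close> weighted by
  its window of \<open>t\<close>. Integrating first over the sizes with the matrix fixed, then over the independent
  rows, gives one factor for each row.\<close>

theorem laplace_row_times_matrix:
  assumes T: "finite T" and t: "\<And>j. 0 \<le> t j" and supp: "\<And>j. j \<notin> T \<Longrightarrow> t j = 0"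
  shows "(\<integral>\<omega>. exp (- (\<Sum>j\<in>T. t j * row_times_matrix \<tau> P j \<omega>)) \<partial>M) =
    (\<Prod>i\<in>(\<lambda>(j, m). j - m) ` (T \<times> K). joint_laplace (\<lambda>m. t (i + m)))"
proof -
  define I where "I = (\<lambda>(j, m). j - m) ` (T \<times> K)"
  have I: "finite I" using T K_finite by (simp add: I_def)
  let ?q = "\<lambda>i y. \<Sum>m\<in>K. t (i + m) * y i (i + m)"
  let ?S = "PiM UNIV (\<lambda>_. borel) :: (int \<Rightarrow> real) measure"
  let ?R = "PiM UNIV (\<lambda>_. PiM UNIV (\<lambda>_. borel)) :: (int \<Rightarrow> int \<Rightarrow> real) measure"
  \<comment> \<open>The absolute value makes the integrand bounded everywhere; the sum is nonnegative almost surely.\<close>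
  let ?f = "\<lambda>(x, y). exp (- \<bar>\<Sum>i\<in>I. x i * ?q i y\<bar>) :: real"
  have sum_eq: "(\<Sum>j\<in>T. t j * (\<Sum>m\<in>K. \<tau> (j - m) \<omega> * P (j - m) j \<omega>)) = (\<Sum>i\<in>I. \<tau> i \<omega> * (\<Sum>m\<in>K. t (i + m) * P i (i + m) \<omega>))" for \<omega>
    using sum.window_reindex[OF T K_finite, of "\<lambda>i m. t (i + m) * (\<tau> i \<omega> * P i (i + m) \<omega>)"] supp
    by (simp add: I_def sum_distrib_left mult_ac)
  have q0: "AE \<omega> in M. \<forall>i. 0 \<le> ?q i (\<lambda>i j. P i j \<omega>)"
    using AE_rows by eventually_elim (use t in \<open>auto intro!: sum_nonneg mult_nonneg_nonneg\<close>)
  have \<tau>0: "AE \<omega> in M. \<forall>i. 0 \<le> \<tau> i \<omega>" by (simp add: AE_all_countable sizes_nonneg)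
  have X: "(\<lambda>\<omega> j. \<tau> j \<omega>) \<in> measurable M ?S" and Y: "(\<lambda>\<omega> i j. P i j \<omega>) \<in> measurable M ?R"
    using sizes_matrix_independent by (auto simp: indep_elements_def)
  have comp1: "(\<lambda>p. fst p i) \<in> borel_measurable (?S \<Otimes>\<^sub>M ?R)" for i
    by (rule measurable_compose[OF measurable_fst]) (rule measurable_component_singleton, simp)
  have row: "(\<lambda>p. snd p i) \<in> measurable (?S \<Otimes>\<^sub>M ?R) ?S" for i
    by (rule measurable_compose[OF measurable_snd]) (rule measurable_component_singleton, simp)
  have comp2: "(\<lambda>p. snd p i j) \<in> borel_measurable (?S \<Otimes>\<^sub>M ?R)" for i j
    by (rule measurable_compose[OF row]) (rule measurable_component_singleton, simp)
  have fm: "?f \<in> borel_measurable (?S \<Otimes>\<^sub>M ?R)"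
    unfolding case_prod_unfold
    by (intro measurable_compose[OF _ borel_measurable_exp] borel_measurable_uminus borel_measurable_abs
        borel_measurable_sum borel_measurable_times borel_measurable_const comp1 comp2)
  have "(\<integral>\<omega>. exp (- (\<Sum>j\<in>T. t j * row_times_matrix \<tau> P j \<omega>)) \<partial>M) = (\<integral>\<omega>. ?f (\<lambda>j. \<tau> j \<omega>, \<lambda>i j. P i j \<omega>) \<partial>M)"
  proof (rule integral_cong_AE)
    show "AE \<omega> in M. exp (- (\<Sum>j\<in>T. t j * row_times_matrix \<tau> P j \<omega>)) = ?f (\<lambda>j. \<tau> j \<omega>, \<lambda>i j. P i j \<omega>)"
      using row_times_matrix_eq q0 \<tau>0
    proof eventually_elim
      case (elim \<omega>)
      have "0 \<le> (\<Sum>i\<in>I. \<tau> i \<omega> * (\<Sum>m\<in>K. t (i + m) * P i (i + m) \<omega>))"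
        by (rule sum_nonneg, rule mult_nonneg_nonneg) (use elim in auto)
      then show ?case using elim(1) sum_eq by simp
    qed
    show "(\<lambda>\<omega>. exp (- (\<Sum>j\<in>T. t j * row_times_matrix \<tau> P j \<omega>))) \<in> borel_measurable M" by measurable
    show "(\<lambda>\<omega>. ?f (\<lambda>j. \<tau> j \<omega>, \<lambda>i j. P i j \<omega>)) \<in> borel_measurable M"
      by (rule measurable_compose[OF measurable_Pair[OF X Y] fm])
  qed
  also have "\<dots> = (\<integral>\<omega>. (\<integral>\<omega>'. ?f (\<lambda>j. \<tau> j \<omega>', \<lambda>i j. P i j \<omega>) \<partial>M) \<partial>M)"
  proof (rule integral_of_independent[OF M.prob_space_axioms X Y, where f = ?f and C = 1])
    show "?f \<in> borel_measurable (?S \<Otimes>\<^sub>M ?R)" by (rule fm)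
    show "\<bar>?f z\<bar> \<le> 1" for z by (auto simp: case_prod_unfold)
    fix A B assume "A \<in> sets ?S" "B \<in> sets ?R"
    then show "measure M (((\<lambda>\<omega> j. \<tau> j \<omega>) -` A \<inter> space M) \<inter> ((\<lambda>\<omega> i j. P i j \<omega>) -` B \<inter> space M)) =
        measure M ((\<lambda>\<omega> j. \<tau> j \<omega>) -` A \<inter> space M) * measure M ((\<lambda>\<omega> i j. P i j \<omega>) -` B \<inter> space M)"
      using sizes_matrix_independent unfolding indep_elements_def
      by (intro M.indep_setD[where A = "sets (vimage_algebra (space M) (\<lambda>\<omega> j. \<tau> j \<omega>) ?S)"
            and B = "sets (vimage_algebra (space M) (\<lambda>\<omega> i j. P i j \<omega>) ?R)"]) (auto intro: in_vimage_algebra)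
  qed
  also have "\<dots> = (\<integral>\<omega>. (\<Prod>i\<in>I. size_laplace (\<Sum>m\<in>K. t (i + m) * P i (i + m) \<omega>)) \<partial>M)"
  proof (rule integral_cong_AE)
    show "AE \<omega> in M. (\<integral>\<omega>'. ?f (\<lambda>j. \<tau> j \<omega>', \<lambda>i j. P i j \<omega>) \<partial>M) = (\<Prod>i\<in>I. size_laplace (\<Sum>m\<in>K. t (i + m) * P i (i + m) \<omega>))"
      using q0
    proof eventually_elim
      case (elim \<omega>)
      have "(\<integral>\<omega>'. ?f (\<lambda>j. \<tau> j \<omega>', \<lambda>i j. P i j \<omega>) \<partial>M) = (\<integral>\<omega>'. exp (- (\<Sum>i\<in>I. \<tau> i \<omega>' * ?q i (\<lambda>i j. P i j \<omega>))) \<partial>M)"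
      proof (rule integral_cong_AE)
        show "AE \<omega>' in M. ?f (\<lambda>j. \<tau> j \<omega>', \<lambda>i j. P i j \<omega>) = exp (- (\<Sum>i\<in>I. \<tau> i \<omega>' * ?q i (\<lambda>i j. P i j \<omega>)))"
          using \<tau>0
        proof eventually_elim
          case (elim \<omega>')
          have "0 \<le> (\<Sum>i\<in>I. \<tau> i \<omega>' * ?q i (\<lambda>i j. P i j \<omega>))"
            by (rule sum_nonneg, rule mult_nonneg_nonneg)
              (use elim \<open>\<forall>i. 0 \<le> ?q i (\<lambda>i j. P i j \<omega>)\<close> in auto)
          then show ?case by simp
        qed
        show "(\<lambda>\<omega>'. ?f (\<lambda>j. \<tau> j \<omega>', \<lambda>i j. P i j \<omega>)) \<in> borel_measurable M"
          unfolding case_prod_conv by measurable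
        show "(\<lambda>\<omega>'. exp (- (\<Sum>i\<in>I. \<tau> i \<omega>' * ?q i (\<lambda>i j. P i j \<omega>)))) \<in> borel_measurable M" by measurable
      qed
      also have "\<dots> = (\<Prod>i\<in>I. size_laplace (?q i (\<lambda>i j. P i j \<omega>)))"
        by (rule laplace_independent_sizes[OF I]) (use elim in auto)
      finally show ?case by simp
    qed
    show "(\<lambda>\<omega>. \<integral>\<omega>'. ?f (\<lambda>j. \<tau> j \<omega>', \<lambda>i j. P i j \<omega>) \<partial>M) \<in> borel_measurable M"
    proof (rule M.borel_measurable_lebesgue_integral)
      show "(\<lambda>(\<omega>, \<omega>'). ?f (\<lambda>j. \<tau> j \<omega>', \<lambda>i j. P i j \<omega>)) \<in> borel_measurable (M \<Otimes>\<^sub>M M)"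
        unfolding case_prod_unfold fst_conv snd_conv
        by (intro measurable_compose[OF _ borel_measurable_exp] borel_measurable_uminus borel_measurable_abs
            borel_measurable_sum borel_measurable_times borel_measurable_const
            measurable_compose[OF measurable_fst matrix_measurable] measurable_compose[OF measurable_snd sizes_measurable])
    qed
    show "(\<lambda>\<omega>. \<Prod>i\<in>I. size_laplace (\<Sum>m\<in>K. t (i + m) * P i (i + m) \<omega>)) \<in> borel_measurable M" by measurable
  qed
  also have "\<dots> = (\<Prod>i\<in>I. joint_laplace (\<lambda>m. t (i + m)))"
    by (rule laplace_rows[OF I t])
  finally show ?thesis unfolding I_def .
qed

lemma row_times_matrix_nonneg: "AE \<omega> in M. 0 \<le> row_times_matrix \<tau> P j \<omega>"
proof -
  have "AE \<omega> in M. \<forall>i. 0 \<le> \<tau> i \<omega>" by (simp add: AE_all_countable sizes_nonneg)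
  with row_times_matrix_eq AE_rows show ?thesis
  proof eventually_elim
    case (elim \<omega>)
    have "0 \<le> P (j - m) j \<omega>" for m using elim(2)[rule_format, of "j - m" m] by simp
    with elim(1,3) show ?case by (auto intro!: sum_nonneg mult_nonneg_nonneg)
  qed
qed

text \<open>Equality of the laws becomes a functional equation between the joint transform of the shares of
  one row and the transform of a size.\<close>

lemma same_law_iff_windows:
  "sequence_law M (row_times_matrix \<tau> P) = sequence_law M \<tau> \<longleftrightarrow>
   (\<forall>T t. finite T \<longrightarrow> (\<forall>j. 0 \<le> t j) \<longrightarrow> (\<forall>j. j \<notin> T \<longrightarrow> t j = 0) \<longrightarrow>
     (\<Prod>i\<in>(\<lambda>(j, m). j - m) ` (T \<times> K). joint_laplace (\<lambda>m. t (i + m))) = (\<Prod>j\<in>T. size_laplace (t j)))"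
  (is "?law \<longleftrightarrow> ?windows")
proof
  assume law: ?law
  show ?windows
  proof (intro allI impI)
    fix T :: "int set" and t :: "int \<Rightarrow> real"
    assume T: "finite T" and t: "\<forall>j. 0 \<le> t j" "\<forall>j. j \<notin> T \<longrightarrow> t j = 0"
    let ?f = "\<lambda>y. exp (- (\<Sum>j\<in>T. t j * y j)) :: real"
    have f: "?f \<in> borel_measurable (PiM UNIV (\<lambda>_. borel))"
      by (intro measurable_compose[OF _ borel_measurable_exp] borel_measurable_uminus borel_measurable_sum
          borel_measurable_times borel_measurable_const measurable_component_singleton) simp
    have int: "(\<integral>y. ?f y \<partial>sequence_law M X) = (\<integral>\<omega>. ?f (\<lambda>j. X j \<omega>) \<partial>M)"
      if "\<And>j. X j \<in> borel_measurable M" for X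
      unfolding vector_law_def using f that by (subst integral_distr) (auto intro!: measurable_restrict)
    have "(\<Prod>i\<in>(\<lambda>(j, m). j - m) ` (T \<times> K). joint_laplace (\<lambda>m. t (i + m))) = (\<integral>\<omega>. ?f (\<lambda>j. row_times_matrix \<tau> P j \<omega>) \<partial>M)"
      using laplace_row_times_matrix[OF T] t by simp
    also have "\<dots> = (\<integral>y. ?f y \<partial>sequence_law M (row_times_matrix \<tau> P))"
      by (rule int[symmetric]) (rule row_times_matrix_measurable)
    also have "\<dots> = (\<integral>y. ?f y \<partial>sequence_law M \<tau>)" unfolding law ..
    also have "\<dots> = (\<integral>\<omega>. ?f (\<lambda>j. \<tau> j \<omega>) \<partial>M)"
      by (rule int) (rule sizes_measurable)
    also have "\<dots> = (\<Prod>j\<in>T. size_laplace (t j))"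
      using laplace_independent_sizes[OF T, of t] t by (simp add: mult.commute)
    finally show "(\<Prod>i\<in>(\<lambda>(j, m). j - m) ` (T \<times> K). joint_laplace (\<lambda>m. t (i + m))) = (\<Prod>j\<in>T. size_laplace (t j))" .
  qed
next
  assume windows: ?windows
  show ?law
  proof (rule laplace_determines_law[OF M.prob_space_axioms M.prob_space_axioms])
    fix T :: "int set" and t :: "int \<Rightarrow> real"
    assume T: "finite T" and t: "\<And>j. 0 \<le> t j"
    define t' where "t' j = (if j \<in> T then t j else 0)" for j
    have t': "0 \<le> t' j" "j \<notin> T \<Longrightarrow> t' j = 0" for j using t by (auto simp: t'_def)
    have eq: "(\<Sum>j\<in>T. t j * X j) = (\<Sum>j\<in>T. t' j * X j)" for X :: "int \<Rightarrow> real"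
      by (intro sum.cong) (auto simp: t'_def)
    have "(\<integral>\<omega>. exp (- (\<Sum>j\<in>T. t j * row_times_matrix \<tau> P j \<omega>)) \<partial>M) = (\<Prod>j\<in>T. size_laplace (t' j))"
    proof -
      have "(\<integral>\<omega>. exp (- (\<Sum>j\<in>T. t' j * row_times_matrix \<tau> P j \<omega>)) \<partial>M) =
          (\<Prod>i\<in>(\<lambda>(j, m). j - m) ` (T \<times> K). joint_laplace (\<lambda>m. t' (i + m)))"
        by (rule laplace_row_times_matrix[OF T]) (simp_all add: t')
      also have "\<dots> = (\<Prod>j\<in>T. size_laplace (t' j))"
        by (rule windows[rule_format, OF T]) (simp_all add: t')
      finally show ?thesis unfolding eq .
    qed
    also have "\<dots> = (\<integral>\<omega>. exp (- (\<Sum>j\<in>T. \<tau> j \<omega> * t' j)) \<partial>M)"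
      by (rule laplace_independent_sizes[symmetric, OF T]) (rule t')
    also have "\<dots> = (\<integral>\<omega>. exp (- (\<Sum>j\<in>T. t j * \<tau> j \<omega>)) \<partial>M)" unfolding eq by (simp add: mult.commute)
    finally show "(\<integral>\<omega>. exp (- (\<Sum>j\<in>T. t j * row_times_matrix \<tau> P j \<omega>)) \<partial>M) = (\<integral>\<omega>. exp (- (\<Sum>j\<in>T. t j * \<tau> j \<omega>)) \<partial>M)" .
  qed (use row_times_matrix_nonneg sizes_nonneg in auto)
qed

text \<open>Both sides of the window equation are products of Gamma transforms: every column in \<open>T\<close>
  receives one share of shape \<open>a / |K|\<close> from each of \<open>|K|\<close> rows, which add up to shape \<open>a\<close>.\<close>

theorem gamma_dirichlet_imp_same_law:
  assumes "gamma_dirichlet M \<tau> N \<pi> K"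
  shows "sequence_law M (row_times_matrix \<tau> P) = sequence_law M \<tau>"
  unfolding same_law_iff_windows
proof (intro allI impI)
  obtain a \<gamma> where a: "0 < a" and \<gamma>: "0 < \<gamma>"
    and \<tau>: "\<And>j. distr M borel (\<tau> j) = gamma_distribution a \<gamma>"
    and \<pi>: "vector_law N K \<pi> = dirichlet_distribution K (\<lambda>_. a / real (card K))"
    using assms unfolding gamma_dirichlet_def by blast
  define \<alpha> where "\<alpha> = a / real (card K)"
  have k: "0 < card K" using K_nonempty finite_K by (simp add: card_gt_0_iff)
  have \<alpha>: "0 < \<alpha>" and \<alpha>k: "\<alpha> * card K = a" using a k by (simp_all add: \<alpha>_def)
  have size: "size_laplace u = (1 + u / \<gamma>) powr (- (\<alpha> * card K))" if u: "0 \<le> u" for u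
  proof -
    have "size_laplace u = (\<integral>x. exp (- (u * x)) \<partial>distr M borel (\<tau> 0))"
      unfolding size_laplace_def by (subst integral_distr) auto
    then show ?thesis using laplace_gamma_distribution[OF a \<gamma> u] by (simp add: \<tau> \<alpha>k)
  qed
  fix T :: "int set" and t :: "int \<Rightarrow> real"
  assume T: "finite T" and t: "\<forall>j. 0 \<le> t j" and supp: "\<forall>j. j \<notin> T \<longrightarrow> t j = 0"
  let ?I = "(\<lambda>(j, m). j - m) ` (T \<times> K)"
  have "(\<Prod>i\<in>?I. joint_laplace (\<lambda>m. t (i + m))) = (\<Prod>i\<in>?I. \<Prod>m\<in>K. (1 + t (i + m) / \<gamma>) powr (- \<alpha>))"
    using t size \<pi> by (intro prod.cong refl joint_laplace_of_gamma_dirichlet[OF \<alpha> \<gamma>]) (auto simp: \<alpha>_def)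
  also have "\<dots> = (\<Prod>j\<in>T. \<Prod>m\<in>K. (1 + t (j - m + m) / \<gamma>) powr (- \<alpha>))"
    by (rule prod.window_reindex[OF T K_finite, of "\<lambda>i m. (1 + t (i + m) / \<gamma>) powr (- \<alpha>)", symmetric])
      (simp add: supp)
  also have "\<dots> = (\<Prod>j\<in>T. size_laplace (t j))"
  proof (rule prod.cong[OF refl])
    fix j
    have tj: "0 \<le> t j" using t by simp
    have "0 \<le> t j / \<gamma>" using tj \<gamma> by simp
    then have "((1 + t j / \<gamma>) powr (- \<alpha>)) ^ card K = (1 + t j / \<gamma>) powr (- (\<alpha> * card K))"
      using k by (simp add: powr_power mult.commute)
    then show "(\<Prod>m\<in>K. (1 + t (j - m + m) / \<gamma>) powr (- \<alpha>)) = size_laplace (t j)"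
      using size[OF tj] by simp
  qed
  finally show "(\<Prod>i\<in>?I. joint_laplace (\<lambda>m. t (i + m))) = (\<Prod>j\<in>T. size_laplace (t j))" .
qed

text \<open>The window equation forces the shares to be independent, and then they are Gamma variables.
  Knowing the law of a single share suffices to recover the laws of the size and of the proportions.\<close>

theorem same_law_imp_gamma_dirichlet:
  assumes law: "sequence_law M (row_times_matrix \<tau> P) = sequence_law M \<tau>"
    and nondegenerate: "\<not> degenerate M \<tau> N \<pi> K"
  shows "gamma_dirichlet M \<tau> N \<pi> K"
proof -
  obtain k where k: "k \<in> K" using K_nonempty by blast
  define h where "h x = joint_laplace (\<lambda>j. if j = k then x else 0)" for x
  have single: "joint_laplace (\<lambda>j. if j = m then x else 0) = h x" if "m \<in> K" "0 \<le> x" for m x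
    unfolding h_def by (rule joint_laplace_single[OF that(1) k])
  have local: "joint_laplace s = joint_laplace s'" if "\<And>m. m \<in> K \<Longrightarrow> s m = s' m" for s s'
    unfolding joint_laplace_def using that by (simp cong: sum.cong)
  have one: "joint_laplace (\<lambda>_. 0) = 1"
    by (simp add: joint_laplace_def proportions.prob_space)
  have windows: "(\<Prod>i\<in>(\<lambda>(j, m). j - m) ` (T \<times> K). joint_laplace (\<lambda>m. t (i + m))) = (\<Prod>j\<in>T. size_laplace (t j))"
    if "finite T" "\<And>j. 0 \<le> t j" "\<And>j. j \<notin> T \<Longrightarrow> t j = 0" for T t
    using law that unfolding same_law_iff_windows by blast
  have permute: "joint_laplace (\<lambda>m. s (\<sigma> m)) = joint_laplace s" if "\<And>m. 0 \<le> s m" "\<sigma> permutes K" for s \<sigma>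
    by (rule joint_laplace_permute) fact
  have size: "size_laplace x = h x ^ card K" if x: "0 \<le> x" for x
    by (rule window_equation_factorizes(1)[where L = joint_laplace and \<phi> = size_laplace and h = h and K = K])
      (fact K_finite local permute joint_laplace_pos one single windows x)+
  have product: "joint_laplace s = (\<Prod>m\<in>K. h (s m))" if s: "\<And>m. 0 \<le> s m" for s
    by (rule window_equation_factorizes(2)[where L = joint_laplace and \<phi> = size_laplace and h = h and K = K])
      (fact K_finite local permute joint_laplace_pos one single windows s)+
  interpret factored_split M N "\<tau> 0" \<pi> K h
    by unfold_locales (fact single product)+
  have c1: "\<not> (AE \<omega> in M. \<tau> 0 \<omega> = 0)" and c2: "card K \<noteq> 1"
    using nondegenerate unfolding degenerate_def by blast+
  have c3: False if "AE \<omega> in M. \<tau> 0 \<omega> = c" "\<forall>i\<in>K. \<exists>p. AE \<omega> in N. \<pi> i \<omega> = p" for c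
    using nondegenerate that unfolding degenerate_def by blast
  obtain \<alpha> \<gamma> where \<alpha>: "0 < \<alpha>" and \<gamma>: "0 < \<gamma>" and h: "\<And>u. 0 \<le> u \<Longrightarrow> h u = (1 + u / \<gamma>) powr (- \<alpha>)"
  proof (rule marginal_laplace_is_gamma[OF c2 c1])
    fix c assume "AE \<omega> in M. \<tau> 0 \<omega> = c" "\<forall>i\<in>K. \<exists>p. AE \<omega> in N. \<pi> i \<omega> = p"
    then show False by (rule c3)
  qed (rule that)
  have cK: "0 < card K" using K_nonempty finite_K by (simp add: card_gt_0_iff)
  have "distr M borel (\<tau> j) = gamma_distribution (\<alpha> * card K) \<gamma>" for j
    using size_law_of_gamma_laplace[OF \<alpha> \<gamma> h size] sizes_law[of j] by simp
  moreover have "vector_law N K \<pi> = dirichlet_distribution K (\<lambda>_. \<alpha> * card K / card K)"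
    using proportions_law_of_gamma_laplace[OF \<alpha> \<gamma> h] cK by simp
  moreover have "0 < \<alpha> * card K" using \<alpha> cK by simp
  ultimately show ?thesis unfolding gamma_dirichlet_def using \<gamma> by blast
qed

end

theorem theorem3:
  fixes N :: "'b measure" and \<pi> :: "int \<Rightarrow> 'b \<Rightarrow> real" and K :: "int set"
    and M :: "'a measure" and \<tau> :: "int \<Rightarrow> 'a \<Rightarrow> real" and P :: "int \<Rightarrow> int \<Rightarrow> 'a \<Rightarrow> real"
  assumes "prob_space N" and "prob_space M"
    and "random_probability_distribution N \<pi>"
    and "K = {i. 0 < measure N {\<omega> \<in> space N. 0 < \<pi> i \<omega>}}"
    and "finite K"
    and "\<forall>J\<subseteq>K. exchangeable N J \<pi>"
    and "prob_space.indep_vars M (\<lambda>_. PiM UNIV (\<lambda>_. borel)) (\<lambda>i \<omega> j. P i (i + j) \<omega>) UNIV"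
    and "\<forall>i. sequence_law M (\<lambda>j. P i (i + j)) = sequence_law N \<pi>"
    and "prob_space.indep_vars M (\<lambda>_. borel) \<tau> UNIV"
    and "\<forall>i. distr M borel (\<tau> i) = distr M borel (\<tau> 0)"
    and "\<forall>i. AE \<omega> in M. 0 \<le> \<tau> i \<omega>"
    and "\<forall>i. integrable M (\<tau> i)"
    and "\<forall>i. integrable M (\<lambda>\<omega>. (\<tau> i \<omega> - prob_space.expectation M (\<tau> i))\<^sup>2)"
    and "indep_elements M
           (PiM UNIV (\<lambda>_. borel)) (\<lambda>\<omega> j. \<tau> j \<omega>)
           (PiM UNIV (\<lambda>_. PiM UNIV (\<lambda>_. borel))) (\<lambda>\<omega> i j. P i j \<omega>)"
  shows "(\<not> degenerate M \<tau> N \<pi> K \<longrightarrow>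
            (sequence_law M (row_times_matrix \<tau> P) = sequence_law M \<tau> \<longleftrightarrow>
             gamma_dirichlet M \<tau> N \<pi> K)) \<and>
         (gamma_dirichlet M \<tau> N \<pi> K \<longrightarrow>
            sequence_law M (row_times_matrix \<tau> P) = sequence_law M \<tau>)"
proof -
  have "random_row_times_matrix N M \<pi> K \<tau> P"
    unfolding random_row_times_matrix_def random_row_times_matrix_axioms_def
    by (intro conjI allI assms assms(6)[rule_format] assms(8,10-13)[rule_format] subset_refl)
  then interpret random_row_times_matrix N M \<pi> K \<tau> P .
  show ?thesis
    using same_law_imp_gamma_dirichlet gamma_dirichlet_imp_same_law by blast
qed

end
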